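(* Let $N\ge 2$, $\beta>0$, and let $\xi(t)=(\xi_1(t),\dots,\xi_{N+1}(t))$, $t\in\mathbb{Z}_+$, be the growth process with neighbourhoods $U_i=\{i,i+1\}$ for $i=1,\dots,N$ and $U_{N+1}=\{N+1,1\}$ (asymmetric interaction), and let $\zeta(t)=(\zeta_1(t),\dots,\zeta_N(t))$, $\zeta_i(t)=\xi_i(t)-\xi_{N+1}(t)$, be its process of differences. (1) If $N=2$ and $0<\beta<1$, then the Markov chain $(\zeta(t),\,t\in\mathbb{Z}_+)$ is ergodic. Consequently, $\xi_1(t)=\xi_2(t)=\xi_3(t)$ for infinitely many $t$ almost surely. (2) If $\beta>1$, then the Markov chain $(\zeta(t),\,t\in\mathbb{Z}_+)$ is transient. Moreover, if also $N=2$, then the trajectory of $(\zeta_1(t),\zeta_2(t))$ is essentially a clockwise spiral, and $\xi_1(t)=\xi_2(t)=\xi_3(t)$ only for finitely many $t$ almost surely.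
   Context: $\mathbb{Z}_+=\{0,1,2,\dots\}$. The sites are $1,2,\dots,N+1$ with $N\ge 2$, arranged as a one-dimensional lattice torus. To each site $i$ is attached a neighbourhood $U_i\subset\{1,\dots,N+1\}$. The growth process is the discrete-time Markov chain $\xi(t)$ on $\mathbb{Z}_+^{N+1}$ with transition probabilities $$\mathbb{P}\{\xi_i(t+1)=\xi_i(t)+1,\ \xi_j(t+1)=\xi_j(t)\ \forall j\neq i\mid \xi(t)\}=\frac{\beta^{u_i(t)}}{\sum_{j=1}^{N+1}\beta^{u_j(t)}},\qquad u_i(t)=\sum_{j\in U_i}\xi_j(t),\quad i=1,\dots,N+1,$$ where $\beta>0$ is a parameter. The process of differences $\zeta(t)\in\mathbb{Z}^N$, $\zeta_i(t)=\xi_i(t)-\xi_{N+1}(t)$, $i=1,\dots,N$ (with the convention $\zeta_{N+1}(t)\equiv 0$), is itself a Markov chain on $\mathbb{Z}^N$: for $k=1,\dots,N$ it moves from $\zeta(t)$ to $\zeta(t)+e_k$ ($e_k$ the $k$-th unit vector) with probability proportional to $\beta^{\sum_{j\in U_k}\zeta_j(t)}$, and to $\zeta(t)-(1,\dots,1)$ with probability proportional to $\beta^{\sum_{j\in U_{N+1}}\zeta_j(t)}$. "Ergodic" means positive recurrent. "Transient" means that $|\zeta(t)|\to\infty$ as $t\to\infty$, where $|\cdot|$ is the Euclidean norm. Essentially a clockwise spiral: consider a planar process $\zeta(t)$ with polar coordinates $(\mathbf r(t),\varphi(t))$, $t\ge 0$, where the angle $\varphi(t)\in\mathbb{R}$ is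 tracked without reduction modulo $2\pi$ and is counted as increasing in the clockwise direction. The process is essentially a clockwise spiral if (i) $|\mathbf r(t)|\to\infty$ as $t\to\infty$, and (ii) for some large enough time $\tau_0$ such that $\varphi(\tau_0)=2\pi k_0$, where $k_0\in\mathbb{Z}$, we have $$\varphi(\tau_n)=2\pi k_0+\frac{\pi n}{2}\quad\text{for all } n=0,1,2,\dots,$$ where all $$\tau_n=\inf\Big\{t>\tau_{n-1}:\ \varphi(t)=\frac{\pi k}{2}\text{ for some }k\in\mathbb{Z}\Big\},\quad n=1,2,\dots,$$ are finite.
   Formalization: The literal spiral condition fails: at (r,0), r>0, the chain stays on the half-axis with probability near 1/2, repeating the angle. Here τ_n is the next time φ is a multiple of π/2 other than φ(τ_{n-1}); staying on, or returning to, the same half-axis at the same angle is not counted. *)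

theory Defs
  imports "HOL-Probability.Probability"
begin

section \<open>Discrete-time Markov chains on countable state spaces\<close>

definition markov_chain ::
    "'w measure \<Rightarrow> 's set \<Rightarrow> ('s \<Rightarrow> 's pmf) \<Rightarrow> (nat \<Rightarrow> 'w \<Rightarrow> 's) \<Rightarrow> bool" where
  "markov_chain M S K X \<longleftrightarrow>
     prob_space M \<and> countable S \<and>
     (\<forall>t. X t \<in> measurable M (count_space S)) \<and>
     (\<forall>t x y. \<P>(\<omega> in M. \<forall>s\<le>t. X s \<omega> = x s) > 0 \<longrightarrow>
        \<P>(\<omega> in M. X (Suc t) \<omega> = y \<bar> \<forall>s\<le>t. X s \<omega> = x s) = pmf (K (x t)) y)"

text \<open>
  The law on path space of the chain with kernel \<open>K\<close> started in \<open>x\<close>, obtained from the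
  Ionescu-Tulcea construction. The coordinate at time \<open>0\<close> is \<open>x\<close>, and the coordinate at time
  \<open>Suc i\<close> is drawn from \<open>K\<close> applied to the coordinate at time \<open>i\<close>.
\<close>

definition path_step :: "('s \<Rightarrow> 's pmf) \<Rightarrow> 's \<Rightarrow> nat \<Rightarrow> (nat \<Rightarrow> 's) \<Rightarrow> 's measure" where
  "path_step K x i \<omega> = measure_pmf (case i of 0 \<Rightarrow> return_pmf x | Suc j \<Rightarrow> K (\<omega> j))"

lemma Ionescu_Tulcea_path_step: "Ionescu_Tulcea (path_step K x) (\<lambda>_. count_space UNIV)"
proof (rule Ionescu_Tulcea.intro)
  fix i
  show "path_step K x i \<in> measurable (PiM {0..<i} (\<lambda>_. count_space UNIV)) (subprob_algebra (count_space UNIV))"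
  proof (cases i)
    case 0
    then show ?thesis
      by (auto simp: path_step_def[abs_def] space_subprob_algebra
          intro!: measurable_const measure_pmf.subprob_space_axioms)
  next
    case (Suc j)
    have "(\<lambda>\<omega>. \<omega> j) \<in> measurable (PiM {0..<i} (\<lambda>_. count_space UNIV)) (count_space UNIV)"
      by (rule measurable_component_singleton) (simp add: Suc)
    moreover have "(\<lambda>z. measure_pmf (K z)) \<in> measurable (count_space UNIV) (subprob_algebra (count_space UNIV))"
      by (auto simp: space_subprob_algebra measure_pmf.subprob_space_axioms)
    ultimately show ?thesis
      unfolding path_step_def[abs_def] Suc
      by (simp add: measurable_compose)
  qed
qed (simp add: path_step_def measure_pmf.prob_space_axioms)

interpretation path: Ionescu_Tulcea "path_step K x" "\<lambda>_. count_space UNIV" for K x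
  by (rule Ionescu_Tulcea_path_step)

definition path_law :: "('s \<Rightarrow> 's pmf) \<Rightarrow> 's \<Rightarrow> (nat \<Rightarrow> 's) measure" where
  "path_law K x = path.PF.lim K x"

lemma sets_path_law: "sets (path_law K x) = sets (PiM UNIV (\<lambda>_. count_space UNIV))"
  unfolding path_law_def by (rule path.PF.sets_lim)

lemma space_path_law: "space (path_law K x) = UNIV"
  unfolding path_law_def by (simp add: space_PiM)

lemma emeasure_path_law_finite:
  "emeasure (path_law K x) {\<omega>. \<forall>s\<le>t. \<omega> s = p s} =
     ennreal ((if p 0 = x then 1 else 0) * (\<Prod>s<t. pmf (K (p s)) (p (Suc s))))"
proof -
  let ?M = "\<lambda>_::nat. count_space (UNIV :: 's set)"
  let ?C = "\<lambda>n. path.C K x 0 n (\<lambda>_. undefined)"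
  let ?A = "\<lambda>n. PiE {0..<n} (\<lambda>s. {p s})"
  have A_sets: "?A n \<in> sets (PiM {0..<n} ?M)" for n
    by (intro sets_PiM_I_finite) auto
  have und: "(\<lambda>_. undefined) \<in> space (PiM {0..<0} ?M)"
    by (simp add: space_PiM)
  have setsC: "sets (?C n) = sets (PiM {0..<n} ?M)" for n
    using path.sets_C[OF und, of K x n] by simp
  have spaceC: "space (?C n) = space (PiM {0..<n} ?M)" for n
    using path.space_C[OF und, of K x n] by simp
  have step: "emeasure (?C (Suc n)) (?A (Suc n)) =
      emeasure (path_step K x n p) {p n} * emeasure (?C n) (?A n)" for n
  proof -
    have eP: "path.eP K x n \<in> measurable (?C n) (subprob_algebra (PiM {0..<Suc n} ?M))"
      using path.measurable_eP[of K x n] measurable_cong_sets[OF setsC refl] by blast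
    have ne: "space (?C n) \<noteq> {}"
      unfolding spaceC by (simp add: space_PiM PiE_eq_empty_iff)
    have "emeasure (?C (Suc n)) (?A (Suc n)) = (\<integral>\<^sup>+\<omega>. emeasure (path.eP K x n \<omega>) (?A (Suc n)) \<partial>?C n)"
      using emeasure_bind[OF ne eP A_sets] by simp
    also have "\<dots> = (\<integral>\<^sup>+\<omega>. emeasure (path_step K x n p) {p n} * indicator (?A n) \<omega> \<partial>?C n)"
    proof (rule nn_integral_cong)
      fix \<omega> assume "\<omega> \<in> space (?C n)"
      then have \<omega>: "\<omega> \<in> space (PiM {0..<n} ?M)"
        by (simp add: spaceC)
      have "emeasure (path.eP K x n \<omega>) (?A (Suc n)) =
          emeasure (path_step K x n \<omega>) ((\<lambda>y. fun_upd \<omega> n y) -` ?A (Suc n) \<inter> space (?M n))"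
        by (rule path.emeasure_eP[OF \<omega> A_sets])
      also have "(\<lambda>y. fun_upd \<omega> n y) -` ?A (Suc n) \<inter> space (?M n) = (if \<omega> \<in> ?A n then {p n} else {})"
        using \<omega> by (auto simp: space_PiM PiE_iff extensional_def Ball_def less_Suc_eq split: if_splits)
      also have "emeasure (path_step K x n \<omega>) (if \<omega> \<in> ?A n then {p n} else {}) =
          emeasure (path_step K x n p) {p n} * indicator (?A n) \<omega>"
      proof (cases "\<omega> \<in> ?A n")
        case True
        have "\<omega> s = p s" if "s < n" for s
          using PiE_mem[OF True, of s] that by simp
        then have "path_step K x n \<omega> = path_step K x n p"
          by (simp add: path_step_def split: nat.split)
        with True show ?thesis
          by simp
      qed simp
      finally show "emeasure (path.eP K x n \<omega>) (?A (Suc n)) = 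
          emeasure (path_step K x n p) {p n} * indicator (?A n) \<omega>" .
    qed
    also have "\<dots> = emeasure (path_step K x n p) {p n} * emeasure (?C n) (?A n)"
      using A_sets by (intro nn_integral_cmult_indicator) (simp add: setsC)
    finally show ?thesis .
  qed
  have C0: "emeasure (?C 0) (?A 0) = 1"
    using emeasure_return[OF A_sets[of 0], of "\<lambda>_. undefined"] by simp
  have main: "emeasure (?C (Suc t)) (?A (Suc t)) =
     ennreal ((if p 0 = x then 1 else 0) * (\<Prod>s<t. pmf (K (p s)) (p (Suc s))))" for t
  proof (induction t)
    case 0
    show ?case
      unfolding step[of 0] C0 by (simp add: path_step_def emeasure_pmf_single)
  next
    case (Suc t)
    show ?case
      unfolding step[of "Suc t"] Suc
      by (simp add: path_step_def emeasure_pmf_single ennreal_mult'[symmetric] mult_ac prod_nonneg)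
  qed
  have "{\<omega>. \<forall>s\<le>t. \<omega> s = p s} = prod_emb UNIV ?M {0..<Suc t} (?A (Suc t))"
    by (auto simp: prod_emb_def space_PiM PiE_iff less_Suc_eq_le)
  then have "emeasure (path_law K x) {\<omega>. \<forall>s\<le>t. \<omega> s = p s} = emeasure (path.CI K x {0..<Suc t}) (?A (Suc t))"
    unfolding path_law_def using path.lim[OF _ A_sets, of "Suc t" K x] by simp
  also have "\<dots> = emeasure (?C (Suc t)) (prod_emb {0..<Suc t} ?M {0..<Suc t} (?A (Suc t)))"
    by (rule path.emeasure_CI[OF subset_refl A_sets])
  also have "prod_emb {0..<Suc t} ?M {0..<Suc t} (?A (Suc t)) = ?A (Suc t)"
    by (rule prod_emb_id) (simp add: PiE_mono)
  finally show ?thesis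
    unfolding main .
qed

definition return_time :: "'s \<Rightarrow> (nat \<Rightarrow> 's) \<Rightarrow> ennreal" where
  "return_time x \<omega> = (INF t\<in>{t. 1 \<le> t \<and> \<omega> t = x}. of_nat t)"

text \<open>The infimum over the empty set is \<open>\<infinity>\<close>, so a finite mean forces almost sure return.\<close>

definition positive_recurrent :: "'s set \<Rightarrow> ('s \<Rightarrow> 's pmf) \<Rightarrow> bool" where
  "positive_recurrent S K \<longleftrightarrow> (\<forall>x\<in>S. (\<integral>\<^sup>+\<omega>. return_time x \<omega> \<partial>path_law K x) < \<infinity>)"

definition ergodic_chain ::
    "'w measure \<Rightarrow> 's set \<Rightarrow> ('s \<Rightarrow> 's pmf) \<Rightarrow> (nat \<Rightarrow> 'w \<Rightarrow> 's) \<Rightarrow> bool" where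
  "ergodic_chain M S K X \<longleftrightarrow> markov_chain M S K X \<and> positive_recurrent S K"


section \<open>The growth process and its process of differences\<close>

definition normalized_pmf :: "'a set \<Rightarrow> ('a \<Rightarrow> real) \<Rightarrow> 'a pmf" where
  "normalized_pmf A w = embed_pmf (\<lambda>i. if i \<in> A then w i / (\<Sum>j\<in>A. w j) else 0)"

lemma pmf_normalized_pmf:
  assumes "finite A" "A \<noteq> {}" "\<And>i. i \<in> A \<Longrightarrow> w i > 0"
  shows "pmf (normalized_pmf A w) i = (if i \<in> A then w i / (\<Sum>j\<in>A. w j) else 0)"
proof -
  have pos: "(\<Sum>j\<in>A. w j) > 0"
    using assms by (intro sum_pos) auto
  let ?f = "\<lambda>i. if i \<in> A then w i / (\<Sum>j\<in>A. w j) else 0"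
  have nn: "?f i \<ge> 0" for i
    using assms(3)[of i] pos by (cases "i \<in> A") (simp_all add: less_imp_le)
  have "(\<integral>\<^sup>+i. ennreal (?f i) \<partial>count_space UNIV) = (\<integral>\<^sup>+i. ennreal (?f i) \<partial>count_space A)"
    by (subst nn_integral_count_space_indicator[of A]) (auto intro!: nn_integral_cong simp: indicator_def)
  also have "\<dots> = (\<Sum>i\<in>A. ennreal (?f i))"
    using assms by (simp add: nn_integral_count_space_finite)
  also have "\<dots> = ennreal (\<Sum>i\<in>A. ?f i)"
    by (intro sum_ennreal nn)
  also have "(\<Sum>i\<in>A. ?f i) = 1"
    using pos by (simp add: sum_divide_distrib[symmetric])
  finally have "(\<integral>\<^sup>+i. ennreal (?f i) \<partial>count_space UNIV) = 1"
    by simp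
  then show ?thesis
    unfolding normalized_pmf_def by (rule pmf_embed_pmf[OF nn])
qed

text \<open>
  Sites are \<open>1, \<dots>, N + 1\<close>. Configurations are functions on all of \<open>nat\<close> vanishing off the sites;
  for differences this gives the convention \<open>\<zeta>\<^sub>N\<^sub>+\<^sub>1 = 0\<close>.
\<close>

definition growth_states :: "nat \<Rightarrow> (nat \<Rightarrow> nat) set" where
  "growth_states N = {x. \<forall>i. i \<notin> {1..N+1} \<longrightarrow> x i = 0}"

definition diff_states :: "nat \<Rightarrow> (nat \<Rightarrow> int) set" where
  "diff_states N = {z. \<forall>i. i \<notin> {1..N} \<longrightarrow> z i = 0}"

definition growth_kernel :: "nat \<Rightarrow> (nat \<Rightarrow> nat set) \<Rightarrow> real \<Rightarrow> (nat \<Rightarrow> nat) \<Rightarrow> (nat \<Rightarrow> nat) pmf" where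
  "growth_kernel N U \<beta> x =
     map_pmf (\<lambda>i. x(i := x i + 1)) (normalized_pmf {1..N+1} (\<lambda>i. \<beta> ^ (\<Sum>j\<in>U i. x j)))"

lemma pmf_growth_kernel:
  assumes "\<beta> > 0" "i \<in> {1..N+1}"
  shows "pmf (growth_kernel N U \<beta> x) (x(i := x i + 1)) =
    \<beta> ^ (\<Sum>j\<in>U i. x j) / (\<Sum>k\<in>{1..N+1}. \<beta> ^ (\<Sum>j\<in>U k. x j))"
proof -
  have "inj (\<lambda>i. x(i := x i + 1))"
  proof (rule injI)
    fix a b assume "x(a := x a + 1) = x(b := x b + 1)"
    from fun_cong[OF this, of a] show "a = b"
      by (simp split: if_splits)
  qed
  then have "pmf (growth_kernel N U \<beta> x) (x(i := x i + 1)) =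
      pmf (normalized_pmf {1..N+1} (\<lambda>i. \<beta> ^ (\<Sum>j\<in>U i. x j))) i"
    unfolding growth_kernel_def by (rule pmf_map_inj')
  also have "\<dots> = \<beta> ^ (\<Sum>j\<in>U i. x j) / (\<Sum>k\<in>{1..N+1}. \<beta> ^ (\<Sum>j\<in>U k. x j))"
    using assms by (subst pmf_normalized_pmf) auto
  finally show ?thesis .
qed

definition diff_step :: "nat \<Rightarrow> nat \<Rightarrow> (nat \<Rightarrow> int) \<Rightarrow> (nat \<Rightarrow> int)" where
  "diff_step N k z =
     (if k = N + 1 then (\<lambda>i. if i \<in> {1..N} then z i - 1 else z i) else z(k := z k + 1))"

definition diff_kernel :: "nat \<Rightarrow> (nat \<Rightarrow> nat set) \<Rightarrow> real \<Rightarrow> (nat \<Rightarrow> int) \<Rightarrow> (nat \<Rightarrow> int) pmf" where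
  "diff_kernel N U \<beta> z =
     map_pmf (\<lambda>k. diff_step N k z) (normalized_pmf {1..N+1} (\<lambda>k. \<beta> powi (\<Sum>j\<in>U k. z j)))"

definition growth_process ::
    "'w measure \<Rightarrow> nat \<Rightarrow> (nat \<Rightarrow> nat set) \<Rightarrow> real \<Rightarrow> (nat \<Rightarrow> 'w \<Rightarrow> nat \<Rightarrow> nat) \<Rightarrow> bool" where
  "growth_process M N U \<beta> \<xi> \<longleftrightarrow> markov_chain M (growth_states N) (growth_kernel N U \<beta>) \<xi>"

definition differences :: "nat \<Rightarrow> (nat \<Rightarrow> 'w \<Rightarrow> nat \<Rightarrow> nat) \<Rightarrow> nat \<Rightarrow> 'w \<Rightarrow> nat \<Rightarrow> int" where
  "differences N \<xi> t \<omega> i = (if i \<in> {1..N} then int (\<xi> t \<omega> i) - int (\<xi> t \<omega> (N + 1)) else 0)"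

definition asymmetric_nbhd :: "nat \<Rightarrow> nat \<Rightarrow> nat set" where
  "asymmetric_nbhd N i = (if i = N + 1 then {N + 1, 1} else {i, i + 1})"

definition transient_chain ::
    "'w measure \<Rightarrow> nat \<Rightarrow> (nat \<Rightarrow> nat set) \<Rightarrow> real \<Rightarrow> (nat \<Rightarrow> 'w \<Rightarrow> nat \<Rightarrow> int) \<Rightarrow> bool" where
  "transient_chain M N U \<beta> \<zeta> \<longleftrightarrow>
     markov_chain M (diff_states N) (diff_kernel N U \<beta>) \<zeta> \<and>
     (AE \<omega> in M. filterlim (\<lambda>t. L2_set (\<lambda>i. real_of_int (\<zeta> t \<omega> i)) {1..N}) at_top sequentially)"


section \<open>Clockwise spirals\<close>

text \<open>
  An unreduced clockwise angle of a planar sequence. Successive angles are joined along the shorter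
  arc; only when consecutive points lie on opposite rays from the origin are both choices
  \<open>\<plusminus>\<pi>\<close> allowed. At the origin the angle is arbitrary.
\<close>

definition clockwise_angle :: "(nat \<Rightarrow> complex) \<Rightarrow> (nat \<Rightarrow> real) \<Rightarrow> bool" where
  "clockwise_angle z \<phi> \<longleftrightarrow>
     (\<forall>t. z t = of_real (cmod (z t)) * cis (- \<phi> t)) \<and>
     (\<forall>t. z t \<noteq> 0 \<longrightarrow> z (Suc t) \<noteq> 0 \<longrightarrow> \<bar>\<phi> (Suc t) - \<phi> t\<bar> \<le> pi)"

text \<open>
  Times after \<open>s\<close> at which the path is on a coordinate half-axis other than the one met at time
  \<open>s\<close>. In discrete time a lattice path may sit on one half-axis for several consecutive steps;
  such a sojourn counts as a single visit, whence the condition \<open>\<phi> t \<noteq> \<phi> s\<close>.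
\<close>

definition new_axis_times :: "(nat \<Rightarrow> real) \<Rightarrow> nat \<Rightarrow> nat set" where
  "new_axis_times \<phi> s = {t. t > s \<and> (\<exists>k::int. \<phi> t = pi * of_int k / 2) \<and> \<phi> t \<noteq> \<phi> s}"

primrec axis_time :: "(nat \<Rightarrow> real) \<Rightarrow> nat \<Rightarrow> nat \<Rightarrow> nat" where
  "axis_time \<phi> \<tau>0 0 = \<tau>0"
| "axis_time \<phi> \<tau>0 (Suc n) = Inf (new_axis_times \<phi> (axis_time \<phi> \<tau>0 n))"

text \<open>Nonemptiness of \<open>new_axis_times\<close> says that the next axis time is finite.\<close>

definition essentially_clockwise_spiral :: "(nat \<Rightarrow> complex) \<Rightarrow> bool" where
  "essentially_clockwise_spiral z \<longleftrightarrow>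
     filterlim (\<lambda>t. cmod (z t)) at_top sequentially \<and>
     (\<exists>\<phi> \<tau>0. \<exists>k0::int.
        clockwise_angle z \<phi> \<and> (\<forall>t\<ge>\<tau>0. z t \<noteq> 0) \<and> \<phi> \<tau>0 = 2 * pi * of_int k0 \<and>
        (\<forall>n. new_axis_times \<phi> (axis_time \<phi> \<tau>0 n) \<noteq> {} \<and>
             \<phi> (axis_time \<phi> \<tau>0 n) = 2 * pi * of_int k0 + pi * real n / 2))"

end

theory Submission
  imports Defs
begin

text \<open>
  For \<open>\<beta> < 1\<close> and three sites there is a Foster-Lyapunov function, the gauge of a suitably
  tilted triangle. For \<open>\<beta> > 1\<close> put \<open>Z = (\<Sum>k. \<beta> ^ u\<^sub>k)\<close> and let \<open>S\<close> be the sum of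
  all heights. Then \<open>ln Z - 2 / (N + 1) * ln \<beta> * S\<close>, a function of the differences, is a
  submartingale with bounded increments and drift bounded away from \<open>0\<close>. Hence
  \<open>exp (- \<theta> * (ln Z - 2 / (N + 1) * ln \<beta> * S))\<close> contracts by a constant factor in mean for
  small \<open>\<theta> > 0\<close>, its sum over time is almost surely finite, and the chain is transient.

  For three sites a step that increments a site whose predecessor is maximal has probability at most
  \<open>\<beta> powr (2 / 3 * S) / Z\<close>, so by Borel-Cantelli only finitely many such steps occur. All
  other steps far from the origin either stay in the current half-axis or open quadrant or move to
  the next one clockwise, and none of these eight cells can be occupied forever.
\<close>

section \<open>Markov chains on countable state spaces\<close>

text \<open>Transience is claimed for every \<open>N\<close>, whatever shape the trajectory takes.
  The exponents \<open>u\<^sub>k\<close> have mean 2 / (N + 1) times the sum of all heights, so the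
  submartingale measures how far \<open>ln Z\<close> exceeds \<open>ln \<beta>\<close> times this
  mean; it is at most an affine function of the norm of the differences. Its exponential moment is
  used twice: along paths it gives transience, and in mean it bounds the Borel-Cantelli sum, because
  for three sites the bound for an unlikely step is exactly the exponential with \<theta> = 1.

  Unlikely steps keep positive probability at all times, so departure from a cell is proved for the
  chain killed at its first such step. Since almost every path eventually makes none, this is
  enough. It is the reason why sojourns carry a relation on steps besides a set of states.

  For \<beta> < 1 the drift holds only off a finite set, whereas a finite mean return time is needed
  at every state. Irreducibility shrinks the exceptional set to one arbitrary point.\<close>

lemma nn_integral_countable_rv:
  assumes A: "countable A" and Y: "Y \<in> measurable M (count_space A)"
  shows "(\<integral>\<^sup>+\<omega>. f (Y \<omega>) \<partial>M) = (\<integral>\<^sup>+a. f a * emeasure M (Y -` {a} \<inter> space M) \<partial>count_space A)"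
proof -
  have "(\<integral>\<^sup>+\<omega>. f (Y \<omega>) \<partial>M) = (\<integral>\<^sup>+\<omega>. (\<integral>\<^sup>+a. f a * indicator (Y -` {a} \<inter> space M) \<omega> \<partial>count_space A) \<partial>M)"
  proof (rule nn_integral_cong)
    fix \<omega> assume \<omega>: "\<omega> \<in> space M"
    then have "Y \<omega> \<in> A" using Y by (auto simp: measurable_def)
    have "(\<integral>\<^sup>+a. f a * indicator (Y -` {a} \<inter> space M) \<omega> \<partial>count_space A) =
      (\<integral>\<^sup>+a. f (Y \<omega>) * indicator {Y \<omega>} a \<partial>count_space A)"
      using \<omega> by (intro nn_integral_cong) (auto simp: indicator_def)
    also have "\<dots> = f (Y \<omega>)"
      using \<open>Y \<omega> \<in> A\<close> by (subst nn_integral_cmult_indicator) auto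
    finally show "f (Y \<omega>) = (\<integral>\<^sup>+a. f a * indicator (Y -` {a} \<inter> space M) \<omega> \<partial>count_space A)" by simp
  qed
  also have "\<dots> = (\<integral>\<^sup>+a. (\<integral>\<^sup>+\<omega>. f a * indicator (Y -` {a} \<inter> space M) \<omega> \<partial>M) \<partial>count_space A)"
    using measurable_sets[OF Y]
    by (subst nn_integral_count_space_nn_integral[OF A]) (auto simp: space_count_space intro!: borel_measurable_times_ennreal borel_measurable_indicator)
  also have "\<dots> = (\<integral>\<^sup>+a. f a * emeasure M (Y -` {a} \<inter> space M) \<partial>count_space A)"
    using Y by (intro nn_integral_cong nn_integral_cmult_indicator) (auto intro!: measurable_sets)
  finally show ?thesis .
qed

lemma nn_integral_count_space_Times:
  "(\<integral>\<^sup>+a. f a \<partial>count_space (A \<times> B)) = (\<integral>\<^sup>+x. \<integral>\<^sup>+y. f (x, y) \<partial>count_space B \<partial>count_space A)"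
proof -
  have "(\<integral>\<^sup>+a. f a \<partial>count_space (A \<times> B)) = (\<integral>\<^sup>+a. f a * indicator (A \<times> B) a \<partial>count_space UNIV)"
    by (subst nn_integral_count_space_indicator) auto
  also have "\<dots> = (\<integral>\<^sup>+x. \<integral>\<^sup>+y. f (x, y) * indicator (A \<times> B) (x, y) \<partial>count_space UNIV \<partial>count_space UNIV)"
    by (rule nn_integral_fst_count_space[symmetric])
  also have "\<dots> = (\<integral>\<^sup>+x. (\<integral>\<^sup>+y. f (x, y) \<partial>count_space B) * indicator A x \<partial>count_space UNIV)"
    by (intro nn_integral_cong, subst (2) nn_integral_count_space_indicator)
      (auto simp: indicator_def intro!: nn_integral_cong)
  finally show ?thesis by (simp add: nn_integral_count_space_indicator)
qed

lemma sets_path_event: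
  fixes X :: "nat \<Rightarrow> 'w \<Rightarrow> 's"
  assumes X: "\<And>s. X s \<in> measurable M (count_space S)"
  shows "{\<omega>\<in>space M. \<forall>s\<le>t. X s \<omega> = p s} \<in> sets M"
proof -
  have "X s -` {p s} \<inter> space M \<in> sets M" for s
  proof (cases "p s \<in> S")
    case True
    then show ?thesis by (intro measurable_sets[OF X]) auto
  next
    case False
    then have "X s -` {p s} \<inter> space M = {}"
      by (auto dest!: measurable_space[OF X[of s]])
    then show ?thesis by simp
  qed
  then have "(\<Inter>s\<in>{..t}. X s -` {p s} \<inter> space M) \<in> sets M" by (intro sets.finite_INT) auto
  also have "(\<Inter>s\<in>{..t}. X s -` {p s} \<inter> space M) = {\<omega>\<in>space M. \<forall>s\<le>t. X s \<omega> = p s}" by auto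
  finally show ?thesis .
qed

text \<open>The Markov property is a product formula for path probabilities instead of a conditional
  probability, so histories of probability 0 need no separate treatment. Both an arbitrary
  \<open>markov_chain\<close> and the canonical \<open>path_law\<close> are brought into this
  form.\<close>

locale countable_chain = prob_space M for M :: "'w measure" +
  fixes S :: "'s set" and K :: "'s \<Rightarrow> 's pmf" and X :: "nat \<Rightarrow> 'w \<Rightarrow> 's"
  assumes countable_S: "countable S"
    and closed_S: "x \<in> S \<Longrightarrow> set_pmf (K x) \<subseteq> S"
    and rv: "X t \<in> measurable M (count_space S)"
    and path_prob_Suc: "emeasure M {\<omega>\<in>space M. \<forall>s\<le>Suc t. X s \<omega> = p s} =
      emeasure M {\<omega>\<in>space M. \<forall>s\<le>t. X s \<omega> = p s} * ennreal (pmf (K (p t)) (p (Suc t)))"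
begin

lemma X_in_S: "\<omega> \<in> space M \<Longrightarrow> X t \<omega> \<in> S"
  using rv[of t] by (auto simp: measurable_def)

text \<open>Cutting the path at time \<open>t\<close> leaves a random variable with countably many
  values, which reduces measurability and integration to sums.\<close>

definition hist :: "nat \<Rightarrow> 'w \<Rightarrow> nat \<Rightarrow> 's" where
  "hist t \<omega> = restrict (\<lambda>s. X s \<omega>) {..t}"

lemmas sets_path = sets_path_event[where X = X, OF rv]

lemma hist_in_PiE: "\<omega> \<in> space M \<Longrightarrow> hist t \<omega> \<in> PiE {..t} (\<lambda>_. S)"
  by (simp add: hist_def restrict_PiE_iff X_in_S)

lemma measurable_hist: "hist t \<in> measurable M (count_space (PiE {..t} (\<lambda>_. S)))"
proof -
  have c: "countable (PiE {..t} (\<lambda>_. S))" by (intro countable_PiE countable_S) auto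
  have "hist t -` {p} \<inter> space M = {\<omega>\<in>space M. \<forall>s\<le>t. X s \<omega> = p s}" if "p \<in> PiE {..t} (\<lambda>_. S)" for p
    using that by (auto simp: hist_def PiE_def extensional_def fun_eq_iff)
  note pre = this
  have "hist t -` {p} \<inter> space M \<in> sets M" if "p \<in> PiE {..t} (\<lambda>_. S)" for p
    unfolding pre[OF that] by (rule sets_path)
  moreover have "hist t \<in> space M \<rightarrow> PiE {..t} (\<lambda>_. S)"
    by (intro funcsetI hist_in_PiE)
  ultimately show ?thesis
    by (intro iffD2[OF measurable_count_space_eq_countable[OF c]] conjI ballI)
qed

text \<open>A functional of the coordinates up to \<open>t\<close> factors through the countable
  discrete space of histories, so it is measurable into any target.\<close>

lemma measurable_history:
  assumes "\<And>p q. \<forall>s\<le>t. p s = q s \<Longrightarrow> G p = G q" and "range G \<subseteq> space N"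
  shows "(\<lambda>\<omega>. G (\<lambda>s. X s \<omega>)) \<in> measurable M N"
proof -
  have "(\<lambda>\<omega>. G (\<lambda>s. X s \<omega>)) = (\<lambda>\<omega>. G (hist t \<omega>))"
    by (rule ext, rule assms(1)) (simp add: hist_def)
  moreover have "(\<lambda>\<omega>. G (hist t \<omega>)) \<in> measurable M N"
    by (rule measurable_compose[OF measurable_hist]) (use assms(2) in auto)
  ultimately show ?thesis by simp
qed

lemma sets_history:
  assumes "\<And>p q. \<forall>s\<le>t. p s = q s \<Longrightarrow> P p = P q"
  shows "{\<omega>\<in>space M. P (\<lambda>s. X s \<omega>)} \<in> sets M"
proof -
  have "(\<lambda>\<omega>. P (\<lambda>s. X s \<omega>)) \<in> measurable M (count_space UNIV)"
  proof (rule measurable_history[where G = P and t = t])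
    show "P p = P q" if "\<forall>s\<le>t. p s = q s" for p q
      using that by (rule assms)
    show "range P \<subseteq> space (count_space UNIV)" by simp
  qed
  from measurable_sets[OF this, of "{True}"] show ?thesis
    by (simp add: vimage_def Int_def conj_commute)
qed

text \<open>The Markov property in integrated form, for functionals of the whole past and the next
  state. Both sides are sums over pairs of a history and a next state, matched term by term by the
  product formula. The drift and Borel-Cantelli arguments rest on this identity.\<close>

lemma one_step:
  assumes G: "\<And>p q y. \<forall>s\<le>t. p s = q s \<Longrightarrow> G p y = G q y"
  shows "(\<integral>\<^sup>+\<omega>. G (\<lambda>s. X s \<omega>) (X (Suc t) \<omega>) \<partial>M) =
    (\<integral>\<^sup>+\<omega>. (\<integral>\<^sup>+y. G (\<lambda>s. X s \<omega>) y \<partial>measure_pmf (K (X t \<omega>))) \<partial>M)"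
proof -
  let ?P = "PiE {..t} (\<lambda>_. S)"
  let ?\<mu> = "\<lambda>p. emeasure M {\<omega>\<in>space M. \<forall>s\<le>t. X s \<omega> = p s}"
  have cP: "countable ?P" by (intro countable_PiE countable_S) auto
  have cPS: "countable (?P \<times> S)" using cP countable_S by auto
  have pre: "hist t -` {p} \<inter> space M = {\<omega>\<in>space M. \<forall>s\<le>t. X s \<omega> = p s}" if "p \<in> ?P" for p
    using that by (auto simp: hist_def PiE_def extensional_def fun_eq_iff)
  have pre2: "(\<lambda>\<omega>. (hist t \<omega>, X (Suc t) \<omega>)) -` {(p, y)} \<inter> space M =
      {\<omega>\<in>space M. \<forall>s\<le>Suc t. X s \<omega> = (p(Suc t := y)) s}" if "p \<in> ?P" for p y
  proof -
    have "(\<lambda>\<omega>. (hist t \<omega>, X (Suc t) \<omega>)) -` {(p, y)} \<inter> space M = 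
       (hist t -` {p} \<inter> space M) \<inter> {\<omega>\<in>space M. X (Suc t) \<omega> = y}" by auto
    then show ?thesis unfolding pre[OF that] by (auto simp: le_Suc_eq)
  qed
  have meas: "(\<lambda>\<omega>. (hist t \<omega>, X (Suc t) \<omega>)) \<in> measurable M (count_space (?P \<times> S))"
  proof -
    have "(\<lambda>\<omega>. (hist t \<omega>, X (Suc t) \<omega>)) -` {a} \<inter> space M \<in> sets M" if "a \<in> ?P \<times> S" for a
    proof -
      obtain p y where "a = (p, y)" "p \<in> ?P" using \<open>a \<in> ?P \<times> S\<close> by (elim SigmaE)
      show ?thesis unfolding \<open>a = (p, y)\<close> pre2[OF \<open>p \<in> ?P\<close>] by (rule sets_path)
    qed
    moreover have "(\<lambda>\<omega>. (hist t \<omega>, X (Suc t) \<omega>)) \<in> space M \<rightarrow> ?P \<times> S"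
      by (intro funcsetI SigmaI hist_in_PiE X_in_S)
    ultimately show ?thesis
      by (intro iffD2[OF measurable_count_space_eq_countable[OF cPS]] conjI ballI)
  qed
  have "(\<integral>\<^sup>+\<omega>. G (\<lambda>s. X s \<omega>) (X (Suc t) \<omega>) \<partial>M) = (\<integral>\<^sup>+\<omega>. G (hist t \<omega>) (X (Suc t) \<omega>) \<partial>M)"
    by (intro nn_integral_cong G) (simp add: hist_def)
  also have "\<dots> = (\<integral>\<^sup>+\<omega>. (\<lambda>(p, y). G p y) (hist t \<omega>, X (Suc t) \<omega>) \<partial>M)" by simp
  also have "\<dots> = (\<integral>\<^sup>+a. (\<lambda>(p, y). G p y) a * emeasure M ((\<lambda>\<omega>. (hist t \<omega>, X (Suc t) \<omega>)) -` {a} \<inter> space M) \<partial>count_space (?P \<times> S))"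
    by (rule nn_integral_countable_rv[OF cPS meas])
  also have "\<dots> = (\<integral>\<^sup>+a. (\<lambda>(p, y). ?\<mu> p * (ennreal (pmf (K (p t)) y) * G p y)) a \<partial>count_space (?P \<times> S))"
  proof (rule nn_integral_cong)
    fix a assume "a \<in> space (count_space (?P \<times> S))"
    then obtain p y where a: "a = (p, y)" "p \<in> ?P" "y \<in> S" by auto
    have "?\<mu> (p(Suc t := y)) = ?\<mu> p" by (intro arg_cong[where f = "emeasure M"]) auto
    then show "(\<lambda>(p, y). G p y) a * emeasure M ((\<lambda>\<omega>. (hist t \<omega>, X (Suc t) \<omega>)) -` {a} \<inter> space M) =
      (\<lambda>(p, y). ?\<mu> p * (ennreal (pmf (K (p t)) y) * G p y)) a"
      using path_prob_Suc[of t "p(Suc t := y)"] unfolding a(1) pre2[OF a(2)]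
      by (simp add: mult_ac del: fun_upd_apply) (simp add: mult_ac)
  qed
  also have "\<dots> = (\<integral>\<^sup>+p. (\<integral>\<^sup>+y. ?\<mu> p * (ennreal (pmf (K (p t)) y) * G p y) \<partial>count_space S) \<partial>count_space ?P)"
    by (subst nn_integral_count_space_Times) (auto simp: cP)
  also have "\<dots> = (\<integral>\<^sup>+p. (\<integral>\<^sup>+y. G p y \<partial>measure_pmf (K (p t))) * emeasure M (hist t -` {p} \<inter> space M) \<partial>count_space ?P)"
  proof (rule nn_integral_cong)
    fix p assume "p \<in> space (count_space ?P)"
    then have p: "p \<in> ?P" by simp
    then have "p t \<in> S" by auto
    have "(\<integral>\<^sup>+y. ?\<mu> p * (ennreal (pmf (K (p t)) y) * G p y) \<partial>count_space S) =
        ?\<mu> p * (\<integral>\<^sup>+y. ennreal (pmf (K (p t)) y) * G p y \<partial>count_space S)"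
      by (rule nn_integral_cmult) simp
    also have "(\<integral>\<^sup>+y. ennreal (pmf (K (p t)) y) * G p y \<partial>count_space S) =
        (\<integral>\<^sup>+y. ennreal (pmf (K (p t)) y) * G p y \<partial>count_space UNIV)"
    proof (subst nn_integral_count_space_indicator, simp, rule nn_integral_cong)
      fix y
      have "pmf (K (p t)) y = 0" if "y \<notin> S"
        using that closed_S[OF \<open>p t \<in> S\<close>] by (auto simp: set_pmf_iff)
      then show "ennreal (pmf (K (p t)) y) * G p y * indicator S y = ennreal (pmf (K (p t)) y) * G p y"
        by (auto simp: indicator_def)
    qed
    also have "\<dots> = (\<integral>\<^sup>+y. G p y \<partial>measure_pmf (K (p t)))"
      by (rule nn_integral_measure_pmf[symmetric])
    finally show "(\<integral>\<^sup>+y. ?\<mu> p * (ennreal (pmf (K (p t)) y) * G p y) \<partial>count_space S) =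
      (\<integral>\<^sup>+y. G p y \<partial>measure_pmf (K (p t))) * emeasure M (hist t -` {p} \<inter> space M)"
      unfolding pre[OF p] by (simp add: mult_ac)
  qed
  also have "\<dots> = (\<integral>\<^sup>+\<omega>. (\<integral>\<^sup>+y. G (hist t \<omega>) y \<partial>measure_pmf (K (hist t \<omega> t))) \<partial>M)"
    by (rule nn_integral_countable_rv[OF cP measurable_hist, symmetric])
  also have "\<dots> = (\<integral>\<^sup>+\<omega>. (\<integral>\<^sup>+y. G (\<lambda>s. X s \<omega>) y \<partial>measure_pmf (K (X t \<omega>))) \<partial>M)"
  proof -
    have "(\<integral>\<^sup>+y. G (hist t \<omega>) y \<partial>measure_pmf (K (X t \<omega>))) =
      (\<integral>\<^sup>+y. G (\<lambda>s. X s \<omega>) y \<partial>measure_pmf (K (X t \<omega>)))" for \<omega>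
      by (intro nn_integral_cong G) (simp add: hist_def)
    then show ?thesis by (simp add: hist_def)
  qed
  finally show ?thesis .
qed

end

section \<open>Sojourns in a set and a drift criterion for their end\<close>

definition stay :: "'s set \<Rightarrow> ('s \<Rightarrow> 's \<Rightarrow> bool) \<Rightarrow> nat \<Rightarrow> nat \<Rightarrow> (nat \<Rightarrow> 's) \<Rightarrow> bool" where
  "stay A R t n p \<longleftrightarrow> (\<forall>s. t \<le> s \<and> s \<le> t + n \<longrightarrow> p s \<in> A) \<and> (\<forall>s. t \<le> s \<and> s < t + n \<longrightarrow> R (p s) (p (Suc s)))"

lemma stay_0: "stay A R t 0 p \<longleftrightarrow> p t \<in> A"
  by (auto simp: stay_def)

lemma stay_Suc: "stay A R t (Suc n) p \<longleftrightarrow> stay A R t n p \<and> p (Suc (t + n)) \<in> A \<and> R (p (t + n)) (p (Suc (t + n)))"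
  by (auto simp: stay_def le_Suc_eq less_Suc_eq)

lemma stay_cong: "\<forall>s\<le>t + n. p s = q s \<Longrightarrow> stay A R t n p = stay A R t n q"
  by (auto simp: stay_def)

lemma ennreal_eq_0I:
  fixes c B :: ennreal
  assumes "\<And>n. of_nat n * c \<le> B" and "B < \<top>"
  shows "c = 0"
proof (rule ccontr)
  assume "c \<noteq> 0"
  have "(SUP n. of_nat n * c) \<le> B" using assms(1) by (intro SUP_least)
  moreover have "(SUP n. of_nat n * c) = (SUP n. of_nat n) * c"
    by (rule SUP_mult_right_ennreal[symmetric])
  ultimately show False
    using assms(2) \<open>c \<noteq> 0\<close> by (simp add: ennreal_SUP_of_nat_eq_top ennreal_top_mult top_unique)
qed

context countable_chain
begin

lemma AE_step: "AE \<omega> in M. \<forall>t. X (Suc t) \<omega> \<in> set_pmf (K (X t \<omega>))"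
proof (subst AE_all_countable, rule allI)
  fix t
  have sets: "{\<omega>\<in>space M. X (Suc t) \<omega> \<notin> set_pmf (K (X t \<omega>))} \<in> sets M"
    using sets_history[where t = "Suc t" and P = "\<lambda>p. p (Suc t) \<notin> set_pmf (K (p t))"] by simp
  have "emeasure M {\<omega>\<in>space M. X (Suc t) \<omega> \<notin> set_pmf (K (X t \<omega>))} =
      (\<integral>\<^sup>+\<omega>. (\<lambda>p y. indicator (- set_pmf (K (p t))) y) (\<lambda>s. X s \<omega>) (X (Suc t) \<omega>) \<partial>M)"
    unfolding nn_integral_indicator[OF sets, symmetric] by (rule nn_integral_cong) (simp add: indicator_def)
  also have "\<dots> = (\<integral>\<^sup>+\<omega>. (\<integral>\<^sup>+y. indicator (- set_pmf (K (X t \<omega>))) y \<partial>measure_pmf (K (X t \<omega>))) \<partial>M)"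
    by (rule one_step) simp
  also have "\<dots> = (\<integral>\<^sup>+\<omega>. (\<integral>\<^sup>+y. 0 \<partial>measure_pmf (K (X t \<omega>))) \<partial>M)"
    by (intro nn_integral_cong nn_integral_cong_AE AE_pmfI) simp
  also have "\<dots> = 0" by simp
  finally show "AE \<omega> in M. X (Suc t) \<omega> \<in> set_pmf (K (X t \<omega>))"
    using sets by (subst AE_iff_measurable[OF sets]) auto
qed

text \<open>Dynkin's formula for the chain killed when it leaves \<open>A\<close> or makes a step
  outside \<open>R\<close>: each survived step costs \<epsilon> of the mean of \<open>V\<close>, so
  \<epsilon> times the sum of the survival probabilities is at most the initial mean. The hypothesis
  sees only the surviving part of the one-step mean; \<open>V\<close> may be large after the
  excluded steps.\<close>

lemma stay_bound:
  assumes V: "\<And>z. z \<in> S \<Longrightarrow> z \<in> A \<Longrightarrow> (\<integral>\<^sup>+y. V y * indicator {y\<in>A. R z y} y \<partial>measure_pmf (K z)) + \<epsilon> \<le> V z"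
  shows "(\<integral>\<^sup>+\<omega>. V (X (t + n) \<omega>) * indicator {p. Q (p t) \<and> stay A R t n p} (\<lambda>s. X s \<omega>) \<partial>M) +
      \<epsilon> * (\<Sum>k<n. emeasure M {\<omega>\<in>space M. Q (X t \<omega>) \<and> stay A R t k (\<lambda>s. X s \<omega>)})
    \<le> (\<integral>\<^sup>+\<omega>. V (X t \<omega>) * indicator {z\<in>A. Q z} (X t \<omega>) \<partial>M)"
proof (induction n)
  case 0
  show ?case by (auto simp: stay_0 indicator_def intro!: nn_integral_mono)
next
  case (Suc n)
  let ?I = "\<lambda>n \<omega>. indicator {p. Q (p t) \<and> stay A R t n p} (\<lambda>s. X s \<omega>) :: ennreal"
  have cong: "(Q (p t) \<and> stay A R t n p) = (Q (q t) \<and> stay A R t n q)" if "\<forall>s\<le>t + n. p s = q s" for p q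
    using that stay_cong[OF that, where A = A and R = R] by simp
  have sets: "{\<omega>\<in>space M. Q (X t \<omega>) \<and> stay A R t n (\<lambda>s. X s \<omega>)} \<in> sets M"
    by (rule sets_history[where t = "t + n" and P = "\<lambda>p. Q (p t) \<and> stay A R t n p"]) (rule cong)
  have ind: "indicator {p. Q (p t) \<and> stay A R t n p} p = (indicator {p. Q (p t) \<and> stay A R t n p} q :: ennreal)"
    if "\<forall>s\<le>t + n. p s = q s" for p q
    using cong[OF that] by (simp add: indicator_def)
  have meas: "(\<lambda>\<omega>. G (X (t + n) \<omega>) * ?I n \<omega>) \<in> borel_measurable M" for G :: "'s \<Rightarrow> ennreal"
  proof (rule measurable_history[where t = "t + n" and G = "\<lambda>p. G (p (t + n)) * indicator {p. Q (p t) \<and> stay A R t n p} p"])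
    show "G (p (t + n)) * indicator {p. Q (p t) \<and> stay A R t n p} p = G (q (t + n)) * indicator {p. Q (p t) \<and> stay A R t n p} q"
      if "\<forall>s\<le>t + n. p s = q s" for p q
      using that by (simp add: ind[OF that])
  qed simp
  have em: "emeasure M {\<omega>\<in>space M. Q (X t \<omega>) \<and> stay A R t n (\<lambda>s. X s \<omega>)} = (\<integral>\<^sup>+\<omega>. ?I n \<omega> \<partial>M)"
    unfolding nn_integral_indicator[OF sets, symmetric] by (rule nn_integral_cong) (simp add: indicator_def)
  let ?G = "\<lambda>p y. indicator {p. Q (p t) \<and> stay A R t n p} p * (V y * indicator {y\<in>A. R (p (t + n)) y} y)"
  have "(\<integral>\<^sup>+\<omega>. V (X (t + Suc n) \<omega>) * ?I (Suc n) \<omega> \<partial>M) = (\<integral>\<^sup>+\<omega>. ?G (\<lambda>s. X s \<omega>) (X (Suc (t + n)) \<omega>) \<partial>M)"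
    by (intro nn_integral_cong) (auto simp: stay_Suc indicator_def)
  also have "\<dots> = (\<integral>\<^sup>+\<omega>. (\<integral>\<^sup>+y. ?G (\<lambda>s. X s \<omega>) y \<partial>measure_pmf (K (X (t + n) \<omega>))) \<partial>M)"
  proof (rule one_step)
    show "?G p y = ?G q y" if "\<forall>s\<le>t + n. p s = q s" for p q y
      using that by (simp add: ind[OF that])
  qed
  also have "\<dots> = (\<integral>\<^sup>+\<omega>. (\<integral>\<^sup>+y. V y * indicator {y\<in>A. R (X (t + n) \<omega>) y} y \<partial>measure_pmf (K (X (t + n) \<omega>))) * ?I n \<omega> \<partial>M)"
    by (simp add: nn_integral_cmult mult.commute)
  finally have "(\<integral>\<^sup>+\<omega>. V (X (t + Suc n) \<omega>) * ?I (Suc n) \<omega> \<partial>M) + \<epsilon> * (\<integral>\<^sup>+\<omega>. ?I n \<omega> \<partial>M) =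
     (\<integral>\<^sup>+\<omega>. ((\<integral>\<^sup>+y. V y * indicator {y\<in>A. R (X (t + n) \<omega>) y} y \<partial>measure_pmf (K (X (t + n) \<omega>))) + \<epsilon>) * ?I n \<omega> \<partial>M)"
    using meas[of "\<lambda>_. 1"] meas[of "\<lambda>_. \<epsilon>"] meas[of "\<lambda>z. \<integral>\<^sup>+y. V y * indicator {y\<in>A. R z y} y \<partial>measure_pmf (K z)"]
    by (simp add: nn_integral_cmult[symmetric] nn_integral_add[symmetric] distrib_right)
  also have "\<dots> \<le> (\<integral>\<^sup>+\<omega>. V (X (t + n) \<omega>) * ?I n \<omega> \<partial>M)"
  proof (rule nn_integral_mono)
    fix \<omega> assume "\<omega> \<in> space M"
    then have "X (t + n) \<omega> \<in> S" by (rule X_in_S)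
    moreover have "X (t + n) \<omega> \<in> A" if "stay A R t n (\<lambda>s. X s \<omega>)" using that by (simp add: stay_def)
    ultimately show "((\<integral>\<^sup>+y. V y * indicator {y\<in>A. R (X (t + n) \<omega>) y} y \<partial>measure_pmf (K (X (t + n) \<omega>))) + \<epsilon>) * ?I n \<omega> \<le> V (X (t + n) \<omega>) * ?I n \<omega>"
      using V[of "X (t + n) \<omega>"] by (auto simp: indicator_def)
  qed
  finally have "(\<integral>\<^sup>+\<omega>. V (X (t + Suc n) \<omega>) * ?I (Suc n) \<omega> \<partial>M) + \<epsilon> * (\<integral>\<^sup>+\<omega>. ?I n \<omega> \<partial>M) \<le> 
     (\<integral>\<^sup>+\<omega>. V (X (t + n) \<omega>) * ?I n \<omega> \<partial>M)" .
  note step = this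
  let ?E = "\<lambda>k. emeasure M {\<omega>\<in>space M. Q (X t \<omega>) \<and> stay A R t k (\<lambda>s. X s \<omega>)}"
  have "\<epsilon> * (\<Sum>k<Suc n. ?E k) = \<epsilon> * (\<integral>\<^sup>+\<omega>. ?I n \<omega> \<partial>M) + \<epsilon> * (\<Sum>k<n. ?E k)"
    by (simp add: em distrib_left add.commute)
  then show ?case
    using order_trans[OF add_right_mono[OF step] Suc.IH] by (simp add: add.assoc)
qed

text \<open>A sojourn that never ends would cost \<epsilon> infinitely often, against a finite
  initial value of \<open>V\<close>.\<close>

lemma AE_not_stay:
  assumes V: "\<And>z. z \<in> S \<Longrightarrow> z \<in> A \<Longrightarrow> (\<integral>\<^sup>+y. V y * indicator {y\<in>A. R z y} y \<partial>measure_pmf (K z)) + \<epsilon> \<le> V z"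
    and fin: "\<And>z. z \<in> S \<Longrightarrow> z \<in> A \<Longrightarrow> V z < \<top>" and "\<epsilon> > 0"
  shows "AE \<omega> in M. \<forall>t. \<exists>s\<ge>t. \<not> (X s \<omega> \<in> A \<and> R (X s \<omega>) (X (Suc s) \<omega>))"
proof -
  \<comment> \<open>Fixing the state at time \<open>t\<close> replaces the mean of \<open>V\<close>,
    which may be infinite, by the finite number \<open>V z\<close>; countably many pairs of
    \<open>t\<close> and \<open>z\<close> suffice.\<close>
  have *: "AE \<omega> in M. X t \<omega> = z \<longrightarrow> \<not> (\<forall>n. stay A R t n (\<lambda>s. X s \<omega>))" if z: "z \<in> S" for t z
  proof (cases "z \<in> A")
    case False
    then have "\<not> stay A R t 0 (\<lambda>s. X s \<omega>)" if "X t \<omega> = z" for \<omega> using that by (simp add: stay_0)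
    then show ?thesis by (intro AE_I2 impI) blast
  next
    case True
    let ?F = "\<lambda>n. {\<omega>\<in>space M. X t \<omega> = z \<and> stay A R t n (\<lambda>s. X s \<omega>)}"
    have sets: "?F n \<in> sets M" for n
    proof (rule sets_history[where t = "t + n" and P = "\<lambda>p. p t = z \<and> stay A R t n p"])
      show "(p t = z \<and> stay A R t n p) = (q t = z \<and> stay A R t n q)" if "\<forall>s\<le>t + n. p s = q s" for p q
        using that stay_cong[OF that, where A = A and R = R] by simp
    qed
    have F: "{\<omega>\<in>space M. X t \<omega> = z \<and> (\<forall>n. stay A R t n (\<lambda>s. X s \<omega>))} = (\<Inter>n. ?F n)" by auto
    have "of_nat n * (\<epsilon> * emeasure M (\<Inter>n. ?F n)) \<le> V z" for n
    proof -
      have "of_nat n * (\<epsilon> * emeasure M (\<Inter>n. ?F n)) = \<epsilon> * (\<Sum>k<n. emeasure M (\<Inter>n. ?F n))"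
        by (simp add: mult_ac)
      also have "\<dots> \<le> \<epsilon> * (\<Sum>k<n. emeasure M (?F k))"
        using sets by (intro mult_left_mono sum_mono emeasure_mono) auto
      also have "\<dots> \<le> (\<integral>\<^sup>+\<omega>. V (X t \<omega>) * indicator {y\<in>A. y = z} (X t \<omega>) \<partial>M)"
        using stay_bound[of A V R \<epsilon> t n "\<lambda>y. y = z", OF V]
        by (rule order_trans[rotated]) auto
      also have "\<dots> \<le> (\<integral>\<^sup>+\<omega>. V z \<partial>M)"
        by (intro nn_integral_mono) (auto simp: indicator_def)
      finally show ?thesis by (simp add: emeasure_space_1)
    qed
    then have "\<epsilon> * emeasure M (\<Inter>n. ?F n) = 0"
      by (rule ennreal_eq_0I) (rule fin[OF z True])
    then have "emeasure M (\<Inter>n. ?F n) = 0" using \<open>\<epsilon> > 0\<close> by auto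
    then have "(\<Inter>n. ?F n) \<in> null_sets M" using sets by (intro null_setsI) auto
    then show ?thesis
      by (rule AE_I'[where N = "\<Inter>n. ?F n"]) auto
  qed
  have "AE \<omega> in M. \<forall>t. \<forall>z\<in>S. X t \<omega> = z \<longrightarrow> \<not> (\<forall>n. stay A R t n (\<lambda>s. X s \<omega>))"
    by (intro iffD2[OF AE_all_countable] allI iffD2[OF AE_ball_countable[OF countable_S]] ballI *)
  then show ?thesis
  proof (rule AE_mp[OF _ AE_I2], intro impI allI)
    fix \<omega> t
    assume "\<omega> \<in> space M" and H: "\<forall>t. \<forall>z\<in>S. X t \<omega> = z \<longrightarrow> \<not> (\<forall>n. stay A R t n (\<lambda>s. X s \<omega>))"
    then obtain n where "\<not> stay A R t n (\<lambda>s. X s \<omega>)" using X_in_S by blast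
    then show "\<exists>s\<ge>t. \<not> (X s \<omega> \<in> A \<and> R (X s \<omega>) (X (Suc s) \<omega>))"
      unfolding stay_def by blast
  qed
qed

end

text \<open>For a history of positive probability the product formula is the conditional probability
  cleared of its denominator; otherwise both sides vanish.\<close>

lemma markov_chain_countable_chain:
  assumes MC: "markov_chain M S K X" and closed: "\<And>x. x \<in> S \<Longrightarrow> set_pmf (K x) \<subseteq> S"
  shows "countable_chain M S K X"
proof -
  from MC interpret prob_space M by (simp add: markov_chain_def)
  have rv: "X t \<in> measurable M (count_space S)" for t using MC by (simp add: markov_chain_def)
  have trans: "measure M {\<omega>\<in>space M. \<forall>s\<le>t. X s \<omega> = x s} > 0 \<Longrightarrow>
     cond_prob M (\<lambda>\<omega>. X (Suc t) \<omega> = y) (\<lambda>\<omega>. \<forall>s\<le>t. X s \<omega> = x s) = pmf (K (x t)) y" for t x y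
    using MC unfolding markov_chain_def by blast
  have eq: "measure M {\<omega>\<in>space M. \<forall>s\<le>Suc t. X s \<omega> = p s} =
    measure M {\<omega>\<in>space M. \<forall>s\<le>t. X s \<omega> = p s} * pmf (K (p t)) (p (Suc t))" for t p
  proof -
    let ?A = "{\<omega>\<in>space M. \<forall>s\<le>t. X s \<omega> = p s}" and ?B = "{\<omega>\<in>space M. \<forall>s\<le>Suc t. X s \<omega> = p s}"
    have B: "?B = {\<omega>\<in>space M. X (Suc t) \<omega> = p (Suc t) \<and> (\<forall>s\<le>t. X s \<omega> = p s)}"
      by (auto simp: le_Suc_eq)
    show ?thesis
    proof (cases "measure M ?A > 0")
      case True
      from trans[OF this, of "p (Suc t)"] True show ?thesis
        unfolding cond_prob_def B[symmetric] by (subst (asm) divide_eq_eq) (simp_all add: mult.commute)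
    next
      case False
      then have "measure M ?A = 0" by (simp add: zero_less_measure_iff)
      moreover have "measure M ?B \<le> measure M ?A"
        by (rule finite_measure_mono[OF _ sets_path_event[OF rv]]) auto
      ultimately show ?thesis by (simp add: measure_le_0_iff)
    qed
  qed
  show ?thesis
  proof
    show "countable S" using MC by (simp add: markov_chain_def)
    show "emeasure M {\<omega>\<in>space M. \<forall>s\<le>Suc t. X s \<omega> = p s} =
      emeasure M {\<omega>\<in>space M. \<forall>s\<le>t. X s \<omega> = p s} * ennreal (pmf (K (p t)) (p (Suc t)))" for t p
      unfolding emeasure_eq_measure eq by (simp add: ennreal_mult)
  qed (use closed rv in auto)
qed

text \<open>Strong lumpability: the transition law of the image is the same for all histories of
  \<open>X\<close> that are merged into one history of the image, so it survives conditioning on the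
  coarser history.\<close>

lemma (in countable_chain) markov_chain_image:
  assumes "countable S'" and f: "\<And>x. x \<in> S \<Longrightarrow> f x \<in> S'"
    and K': "\<And>x. x \<in> S \<Longrightarrow> map_pmf f (K x) = K' (f x)"
  shows "markov_chain M S' K' (\<lambda>t \<omega>. f (X t \<omega>))"
  unfolding markov_chain_def
proof (intro conjI allI impI)
  show "(\<lambda>\<omega>. f (X t \<omega>)) \<in> measurable M (count_space S')" for t
    by (rule measurable_compose[OF rv]) (use f in auto)
  show "cond_prob M (\<lambda>\<omega>. f (X (Suc t) \<omega>) = y) (\<lambda>\<omega>. \<forall>s\<le>t. f (X s \<omega>) = p s) = pmf (K' (p t)) y"
    if pos: "0 < measure M {\<omega>\<in>space M. \<forall>s\<le>t. f (X s \<omega>) = p s}" for t p y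
  proof -
    let ?A = "{\<omega>\<in>space M. \<forall>s\<le>t. f (X s \<omega>) = p s}"
    let ?B = "{\<omega>\<in>space M. f (X (Suc t) \<omega>) = y \<and> (\<forall>s\<le>t. f (X s \<omega>) = p s)}"
    let ?G = "\<lambda>q z. indicator {q. \<forall>s\<le>t. f (q s) = p s} q * indicator (f -` {y}) z :: ennreal"
    have A: "?A \<in> sets M"
      by (rule sets_history[where t = t and P = "\<lambda>q. \<forall>s\<le>t. f (q s) = p s"]) simp
    have B: "?B \<in> sets M"
      by (rule sets_history[where t = "Suc t" and P = "\<lambda>q. f (q (Suc t)) = y \<and> (\<forall>s\<le>t. f (q s) = p s)"]) simp
    have "emeasure M ?B = (\<integral>\<^sup>+\<omega>. ?G (\<lambda>s. X s \<omega>) (X (Suc t) \<omega>) \<partial>M)"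
      unfolding nn_integral_indicator[OF B, symmetric] by (rule nn_integral_cong) (auto simp: indicator_def)
    also have "\<dots> = (\<integral>\<^sup>+\<omega>. (\<integral>\<^sup>+z. ?G (\<lambda>s. X s \<omega>) z \<partial>measure_pmf (K (X t \<omega>))) \<partial>M)"
      by (rule one_step) (simp add: indicator_def)
    also have "\<dots> = (\<integral>\<^sup>+\<omega>. ennreal (pmf (K' (p t)) y) * indicator ?A \<omega> \<partial>M)"
    proof (rule nn_integral_cong)
      fix \<omega> assume \<omega>: "\<omega> \<in> space M"
      have "(\<integral>\<^sup>+z. ?G (\<lambda>s. X s \<omega>) z \<partial>measure_pmf (K (X t \<omega>))) =
          indicator {q. \<forall>s\<le>t. f (q s) = p s} (\<lambda>s. X s \<omega>) * emeasure (measure_pmf (K (X t \<omega>))) (f -` {y})"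
        by (rule nn_integral_cmult_indicator) simp
      also have "emeasure (measure_pmf (K (X t \<omega>))) (f -` {y}) = ennreal (pmf (K' (f (X t \<omega>))) y)"
        using K'[OF X_in_S[OF \<omega>, of t], symmetric] by (simp add: pmf_map measure_pmf.emeasure_eq_measure)
      finally show "(\<integral>\<^sup>+z. ?G (\<lambda>s. X s \<omega>) z \<partial>measure_pmf (K (X t \<omega>))) = ennreal (pmf (K' (p t)) y) * indicator ?A \<omega>"
        using \<omega> by (simp add: indicator_def)
    qed
    also have "\<dots> = ennreal (pmf (K' (p t)) y) * emeasure M ?A"
      by (rule nn_integral_cmult_indicator[OF A])
    finally have "measure M ?B = pmf (K' (p t)) y * measure M ?A"
      by (simp add: emeasure_eq_measure ennreal_mult[symmetric])
    then show ?thesis using pos by (simp add: cond_prob_def)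
  qed
qed (use assms prob_space_axioms in auto)

section \<open>The path law as a countable chain\<close>

lemma prob_space_path_law: "prob_space (path_law K x)"
proof
  let ?M = "\<lambda>_::nat. count_space UNIV"
  interpret CI: prob_space "path.CI K x {0}" by (rule path.PF.prob_space_P) auto
  \<comment> \<open>The cylinder with full base over coordinate 0 is the whole space, so the total
    mass can be read off a one-dimensional marginal.\<close>
  have "emeasure (path_law K x) (prod_emb UNIV ?M {0} (space (PiM {0} ?M))) =
      emeasure (path.CI K x {0}) (space (PiM {0} ?M))"
    unfolding path_law_def by (rule path.lim) auto
  also have "space (PiM {0} ?M) = space (path.CI K x {0})"
    by (rule sets_eq_imp_space_eq) (simp add: path.PF.sets_P)
  also have "emeasure (path.CI K x {0}) (space (path.CI K x {0})) = 1" by (rule CI.emeasure_space_1)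
  also have "prod_emb UNIV ?M {0} (space (path.CI K x {0})) = space (path_law K x)"
    by (subst sets_eq_imp_space_eq[of _ "PiM {0} ?M"]) (auto simp: path.PF.sets_P prod_emb_def space_PiM space_path_law)
  finally show "emeasure (path_law K x) (space (path_law K x)) = 1" .
qed

lemma sets_path_law_coord: "{\<omega>. \<omega> t \<in> A} \<in> sets (path_law K x)"
proof -
  have "(\<lambda>\<omega>. \<omega> t) \<in> measurable (path_law K x) (count_space UNIV)"
    by (subst measurable_cong_sets[OF sets_path_law refl]) (rule measurable_component_singleton, simp)
  from measurable_sets[OF this, of A] show ?thesis by (simp add: space_path_law vimage_def)
qed

lemma sets_path_law_path: "{\<omega>. \<forall>s\<le>t. \<omega> s = p s} \<in> sets (path_law K x)"
proof -
  have "(\<Inter>s\<in>{..t}. {\<omega>. \<omega> s \<in> {p s}}) \<in> sets (path_law K x)"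
    by (intro sets.finite_INT sets_path_law_coord) auto
  also have "(\<Inter>s\<in>{..t}. {\<omega>. \<omega> s \<in> {p s}}) = {\<omega>. \<forall>s\<le>t. \<omega> s = p s}" by auto
  finally show ?thesis .
qed

lemma emeasure_path_law_Suc:
  "emeasure (path_law K x) {\<omega>. \<forall>s\<le>Suc t. \<omega> s = p s} =
     emeasure (path_law K x) {\<omega>. \<forall>s\<le>t. \<omega> s = p s} * ennreal (pmf (K (p t)) (p (Suc t)))"
  unfolding emeasure_path_law_finite by (simp add: ennreal_mult prod_nonneg mult.assoc)

text \<open>Path space contains all functions into a type that need not be countable. Confinement to
  \<open>S\<close> is obtained history by history: the continuations inside \<open>S\<close> carry
  the full mass of the history.\<close>

lemma AE_path_law_states:
  assumes S: "countable S" "x \<in> S" and closed: "\<And>y. y \<in> S \<Longrightarrow> set_pmf (K y) \<subseteq> S"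
  shows "AE \<omega> in path_law K x. \<forall>t. \<omega> t \<in> S"
proof -
  interpret prob_space "path_law K x" by (rule prob_space_path_law)
  have "AE \<omega> in path_law K x. \<forall>s\<le>t. \<omega> s \<in> S" for t
  proof (induction t)
    case 0
    have "measure (path_law K x) {\<omega>. \<omega> 0 = x} = 1"
      using emeasure_path_law_finite[of K x 0 "\<lambda>_. x"] by (simp add: emeasure_eq_measure)
    then have "AE \<omega> in path_law K x. \<omega> 0 = x"
      using sets_path_law_coord[of 0 "{x}" K x] by (subst (asm) prob_eq_1) (auto simp: space_path_law)
    then show ?case using S by (auto elim: AE_mp)
  next
    case (Suc t)
    let ?P = "PiE {..t} (\<lambda>_. S)"
    have cP: "countable ?P" by (intro countable_PiE S) auto
    have "AE \<omega> in path_law K x. (\<forall>s\<le>t. \<omega> s = p s) \<longrightarrow> \<omega> (Suc t) \<in> S" if p: "p \<in> ?P" for p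
    proof -
      let ?A = "{\<omega>. \<forall>s\<le>t. \<omega> s = p s}"
      have "p t \<in> S" using p by auto
      let ?D = "\<lambda>y. {\<omega>. \<forall>s\<le>Suc t. \<omega> s = (p(Suc t := y)) s}"
      have U: "?A \<inter> {\<omega>. \<omega> (Suc t) \<in> S} = (\<Union>y\<in>S. ?D y)" by (auto simp: le_Suc_eq)
      have "emeasure (path_law K x) (\<Union>y\<in>S. ?D y) = (\<integral>\<^sup>+y. emeasure (path_law K x) (?D y) \<partial>count_space S)"
        using S by (intro emeasure_UN_countable sets_path_law_path) (auto simp: disjoint_family_on_def)
      also have "\<dots> = (\<integral>\<^sup>+y. emeasure (path_law K x) ?A * ennreal (pmf (K (p t)) y) \<partial>count_space S)"
      proof (rule nn_integral_cong)
        fix y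
        have "{\<omega>. \<forall>s\<le>t. \<omega> s = (p(Suc t := y)) s} = ?A" by auto
        then show "emeasure (path_law K x) (?D y) = emeasure (path_law K x) ?A * ennreal (pmf (K (p t)) y)"
          unfolding emeasure_path_law_Suc by simp
      qed
      also have "\<dots> = emeasure (path_law K x) ?A * emeasure (measure_pmf (K (p t))) S"
        by (simp add: nn_integral_cmult nn_integral_pmf)
      also have "emeasure (measure_pmf (K (p t))) S = 1"
        using closed[OF \<open>p t \<in> S\<close>] by (intro measure_pmf.emeasure_eq_1_AE AE_pmfI) auto
      finally have eq: "measure (path_law K x) (?A \<inter> {\<omega>. \<omega> (Suc t) \<in> S}) = measure (path_law K x) ?A"
        by (simp add: U emeasure_eq_measure)
      have "measure (path_law K x) (?A - {\<omega>. \<omega> (Suc t) \<in> S}) = 0"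
        using finite_measure_Diff'[of ?A "{\<omega>. \<omega> (Suc t) \<in> S}"] eq by (simp add: sets_path_law_path sets_path_law_coord)
      then have "?A - {\<omega>. \<omega> (Suc t) \<in> S} \<in> null_sets (path_law K x)"
        by (intro null_setsI) (auto simp: emeasure_eq_measure sets_path_law_path sets_path_law_coord intro!: sets.Diff)
      then show ?thesis by (rule AE_I') auto
    qed
    then have "AE \<omega> in path_law K x. \<forall>p\<in>?P. (\<forall>s\<le>t. \<omega> s = p s) \<longrightarrow> \<omega> (Suc t) \<in> S"
      by (subst AE_ball_countable[OF cP]) blast
    with Suc.IH show ?case
    proof eventually_elim
      fix \<omega> assume *: "\<forall>s\<le>t. \<omega> s \<in> S" "\<forall>p\<in>?P. (\<forall>s\<le>t. \<omega> s = p s) \<longrightarrow> \<omega> (Suc t) \<in> S"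
      have "restrict \<omega> {..t} \<in> ?P" using *(1) by (simp add: restrict_PiE_iff)
      with *(2) have "\<omega> (Suc t) \<in> S" by fastforce
      with *(1) show "\<forall>s\<le>Suc t. \<omega> s \<in> S" by (simp add: le_Suc_eq)
    qed
  qed
  then have "AE \<omega> in path_law K x. \<forall>t. \<forall>s\<le>t. \<omega> s \<in> S" by (simp add: AE_all_countable)
  then show ?thesis by eventually_elim auto
qed

text \<open>Sending coordinates outside \<open>S\<close> to \<open>x\<close> alters paths only on a
  null set and makes every coordinate \<open>S\<close>-valued everywhere, as the locale
  demands.\<close>

lemma countable_chain_path_law:
  assumes S: "countable S" "x \<in> S" and closed: "\<And>y. y \<in> S \<Longrightarrow> set_pmf (K y) \<subseteq> S"
  shows "countable_chain (path_law K x) S K (\<lambda>t \<omega>. if \<omega> t \<in> S then \<omega> t else x)"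
proof -
  interpret prob_space "path_law K x" by (rule prob_space_path_law)
  let ?X = "\<lambda>t (\<omega> :: nat \<Rightarrow> _). if \<omega> t \<in> S then \<omega> t else x"
  have rv: "?X t \<in> measurable (path_law K x) (count_space S)" for t
  proof (rule iffD2[OF measurable_count_space_eq_countable[OF S(1)]], intro conjI ballI)
    show "?X t \<in> space (path_law K x) \<rightarrow> S" using S by auto
    fix y
    have "?X t -` {y} = {\<omega>. \<omega> t \<in> {z. (if z \<in> S then z else x) = y}}" by auto
    then show "?X t -` {y} \<inter> space (path_law K x) \<in> sets (path_law K x)"
      by (simp only: sets_path_law_coord space_path_law Int_UNIV_right)
  qed
  have ae: "AE \<omega> in path_law K x. \<forall>t. \<omega> t \<in> S"
    by (rule AE_path_law_states[OF S]) (rule closed)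
  have eq: "emeasure (path_law K x) {\<omega>\<in>space (path_law K x). \<forall>s\<le>t. ?X s \<omega> = p s} =
      emeasure (path_law K x) {\<omega>. \<forall>s\<le>t. \<omega> s = p s}" for t p
  proof (rule emeasure_eq_AE)
    show "AE \<omega> in path_law K x. \<omega> \<in> {\<omega>\<in>space (path_law K x). \<forall>s\<le>t. ?X s \<omega> = p s} \<longleftrightarrow> \<omega> \<in> {\<omega>. \<forall>s\<le>t. \<omega> s = p s}"
      using ae by eventually_elim (auto simp: space_path_law)
  qed (rule sets_path_event[OF rv], rule sets_path_law_path)
  show ?thesis
    by (unfold_locales, rule S, rule closed, assumption, rule rv, unfold eq, rule emeasure_path_law_Suc)
qed

section \<open>Drift and recurrence\<close>

text \<open>The probability, starting from \<open>z\<close>, of avoiding \<open>x\<close> at all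
  times from 0 to \<open>k\<close>, written as first-step analysis so that only the kernel is
  involved.\<close>

primrec miss_prob :: "('s \<Rightarrow> 's pmf) \<Rightarrow> 's \<Rightarrow> nat \<Rightarrow> 's \<Rightarrow> real" where
  "miss_prob K x 0 z = (if z = x then 0 else 1)"
| "miss_prob K x (Suc k) z = (if z = x then 0 else measure_pmf.expectation (K z) (miss_prob K x k))"

lemma miss_prob_bounds: "0 \<le> miss_prob K x k z" "miss_prob K x k z \<le> 1"
proof (induction k arbitrary: z)
  case (Suc k)
  { case 1 show ?case using Suc by (auto intro!: integral_nonneg_AE) }
  { case 2
    have "measure_pmf.expectation (K z) (miss_prob K x k) \<le> 1"
      by (rule measure_pmf.integral_le_const)
        (use Suc in \<open>auto intro!: measure_pmf.integrable_const_bound[where B = 1]\<close>)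
    then show ?case by simp }
qed auto

lemma integrable_miss_prob: "integrable (measure_pmf p) (miss_prob K x k)"
  by (rule measure_pmf.integrable_const_bound[where B = 1]) (auto simp: miss_prob_bounds)

lemma miss_prob_Suc_le: "miss_prob K x (Suc k) z \<le> miss_prob K x k z"
proof (induction k arbitrary: z)
  case 0
  have "measure_pmf.expectation (K z) (miss_prob K x 0) \<le> 1"
    by (rule measure_pmf.integral_le_const) (auto intro: integrable_miss_prob simp del: miss_prob.simps simp: miss_prob_bounds)
  then show ?case by simp
next
  case (Suc k)
  have "measure_pmf.expectation (K z) (miss_prob K x (Suc k)) \<le> measure_pmf.expectation (K z) (miss_prob K x k)"
    by (intro integral_mono integrable_miss_prob Suc)
  then show ?case by (simp del: miss_prob.simps(2) add: miss_prob.simps(2)[of _ _ "Suc k"] miss_prob.simps(2)[of _ _ k z])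
qed

lemma miss_prob_antimono: "j \<le> k \<Longrightarrow> miss_prob K x k z \<le> miss_prob K x j z"
  by (rule lift_Suc_antimono_le[of "\<lambda>k. miss_prob K x k z"]) (rule miss_prob_Suc_le)

text \<open>Going back along a path to \<open>x\<close>: a step of positive probability to a state
  with value below 1 pulls the average below 1, since no value exceeds 1.\<close>

lemma miss_prob_less_1:
  assumes "(z, x) \<in> {(z, y). y \<in> set_pmf (K z)}\<^sup>*"
  shows "\<exists>k. miss_prob K x k z < 1"
  using assms
proof (induction rule: converse_rtrancl_induct)
  case base
  show ?case by (rule exI[of _ 0]) simp
next
  case (step z y)
  then obtain k where k: "miss_prob K x k y < 1" by auto
  have "measure_pmf.expectation (K z) (miss_prob K x k) \<noteq> 1"
  proof
    assume *: "measure_pmf.expectation (K z) (miss_prob K x k) = 1"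
    have "measure_pmf.expectation (K z) (\<lambda>y. 1 - miss_prob K x k y) = 0"
      by (subst Bochner_Integration.integral_diff) (auto simp: integrable_miss_prob *)
    then have "AE y in K z. 1 - miss_prob K x k y = 0"
      by (subst (asm) integral_nonneg_eq_0_iff_AE) (auto simp: integrable_miss_prob miss_prob_bounds)
    with step(1) k show False by (auto simp: AE_measure_pmf_iff)
  qed
  moreover have "measure_pmf.expectation (K z) (miss_prob K x k) \<le> 1"
    by (rule measure_pmf.integral_le_const) (auto simp: integrable_miss_prob miss_prob_bounds)
  ultimately show ?case by (intro exI[of _ "Suc k"]) auto
qed

text \<open>
  If \<open>x\<close> is reachable from the exceptional set \<open>F\<close>, a multiple of the bounded function
  \<open>\<lambda>z. \<Sum>k<n. miss_prob K x k z\<close> makes up for the missing drift on \<open>F\<close>, because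
  one step changes it by \<open>miss_prob K x n z - 1\<close>.
\<close>

lemma drift_off_point:
  fixes V :: "'s \<Rightarrow> real"
  assumes V0: "\<And>z. 0 \<le> V z" and "finite F" and "0 \<le> b"
    and drift: "\<And>z. z \<in> S \<Longrightarrow> z \<notin> F \<Longrightarrow> (\<integral>\<^sup>+y. V y \<partial>measure_pmf (K z)) + 1 \<le> V z"
    and bound: "\<And>z. z \<in> S \<Longrightarrow> z \<in> F \<Longrightarrow> (\<integral>\<^sup>+y. V y \<partial>measure_pmf (K z)) \<le> V z + b"
    and reach: "\<And>z. z \<in> F \<Longrightarrow> (z, x) \<in> {(z, y). y \<in> set_pmf (K z)}\<^sup>*"
  obtains U :: "'s \<Rightarrow> real" where "\<And>z. 0 \<le> U z"
    and "\<And>z. z \<in> S \<Longrightarrow> z \<noteq> x \<Longrightarrow> (\<integral>\<^sup>+y. U y \<partial>measure_pmf (K z)) + 1 \<le> U z"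
    and "\<And>z. z \<in> S \<Longrightarrow> (\<integral>\<^sup>+y. U y \<partial>measure_pmf (K z)) < \<top>"
proof -
  obtain h where h: "miss_prob K x (h z) z < 1" if "z \<in> F" for z
    using miss_prob_less_1[OF reach] by metis
  define n where "n = Max (insert 0 (h ` F))"
  have n: "miss_prob K x n z < 1" if "z \<in> F" for z
  proof -
    have "h z \<le> n" unfolding n_def using that \<open>finite F\<close> by (intro Max_ge) auto
    from miss_prob_antimono[OF this, of K x z] h[OF that] show ?thesis by simp
  qed
  define m where "m = Max (insert 0 (miss_prob K x n ` F))"
  have m: "m < 1" "0 \<le> m" "\<And>z. z \<in> F \<Longrightarrow> miss_prob K x n z \<le> m"
    unfolding m_def using \<open>finite F\<close> n by auto
  \<comment> \<open>\<open>C * (1 - m)\<close> has to pay for the growth \<open>b\<close> allowed on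
    \<open>F\<close> and for the unit drift demanded there.\<close>
  define C where "C = (b + 1) / (1 - m)"
  have C: "0 \<le> C" "C * (1 - m) = b + 1" unfolding C_def using m \<open>0 \<le> b\<close> by auto
  define W where "W z = (\<Sum>k<n. miss_prob K x k z)" for z
  define U where "U z = V z + C * W z" for z
  have W0: "0 \<le> W z" for z unfolding W_def by (intro sum_nonneg miss_prob_bounds)
  have iW: "integrable (measure_pmf p) W" for p
    unfolding W_def by (intro Bochner_Integration.integrable_sum integrable_miss_prob)
  have KU: "(\<integral>\<^sup>+y. U y \<partial>measure_pmf (K z)) = (\<integral>\<^sup>+y. V y \<partial>measure_pmf (K z)) + ennreal (C * measure_pmf.expectation (K z) W)" for z
  proof -
    have "(\<integral>\<^sup>+y. ennreal (U y) \<partial>measure_pmf (K z)) = (\<integral>\<^sup>+y. ennreal (V y) + ennreal (C * W y) \<partial>measure_pmf (K z))"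
      unfolding U_def using V0 W0 C(1) by (intro nn_integral_cong ennreal_plus) auto
    also have "\<dots> = (\<integral>\<^sup>+y. V y \<partial>measure_pmf (K z)) + (\<integral>\<^sup>+y. ennreal (C * W y) \<partial>measure_pmf (K z))"
      by (rule nn_integral_add) auto
    also have "(\<integral>\<^sup>+y. ennreal (C * W y) \<partial>measure_pmf (K z)) = ennreal (measure_pmf.expectation (K z) (\<lambda>y. C * W y))"
      using W0 C(1) iW by (intro nn_integral_eq_integral) auto
    finally show ?thesis by simp
  qed
  \<comment> \<open>Away from \<open>x\<close> one step shifts every index \<open>k\<close> by one,
    and the sum telescopes.\<close>
  have KW: "measure_pmf.expectation (K z) W = W z - 1 + miss_prob K x n z" if "z \<noteq> x" for z
  proof -
    have "measure_pmf.expectation (K z) W = (\<Sum>k<n. miss_prob K x (Suc k) z)"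
      unfolding W_def using that by (subst Bochner_Integration.integral_sum) (auto intro: integrable_miss_prob)
    moreover have "(\<Sum>k<n. miss_prob K x (Suc k) z - miss_prob K x k z) = miss_prob K x n z - miss_prob K x 0 z"
      by (rule sum_lessThan_telescope)
    ultimately show ?thesis using that by (simp add: W_def sum_subtractf del: miss_prob.simps(2))
  qed
  show thesis
  proof (rule that)
    show "0 \<le> U z" for z unfolding U_def using V0 W0 C(1) by simp
    show "(\<integral>\<^sup>+y. U y \<partial>measure_pmf (K z)) < \<top>" if z: "z \<in> S" for z
    proof (cases "z \<in> F")
      case True
      show ?thesis using bound[OF z True] by (auto simp: KU less_top[symmetric] top_unique)
    next
      case False
      show ?thesis using drift[OF z False] by (auto simp: KU less_top[symmetric] top_unique)
    qed
    show "(\<integral>\<^sup>+y. U y \<partial>measure_pmf (K z)) + 1 \<le> U z" if z: "z \<in> S" "z \<noteq> x" for z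
    proof (cases "z \<in> F")
      case True
      have EW: "0 \<le> C * (W z - 1 + miss_prob K x n z)"
        unfolding KW[OF z(2), symmetric] using C(1) W0 by (intro mult_nonneg_nonneg integral_nonneg_AE) auto
      have "(\<integral>\<^sup>+y. U y \<partial>measure_pmf (K z)) + 1 \<le> ennreal (V z + b) + ennreal (C * (W z - 1 + miss_prob K x n z)) + ennreal 1"
        unfolding KU KW[OF z(2)] using bound[OF z(1) True] by (intro add_mono) auto
      also have "\<dots> = ennreal (V z + b + C * (W z - 1 + miss_prob K x n z) + 1)"
        using V0[of z] \<open>0 \<le> b\<close> EW by (simp add: ennreal_plus[symmetric] del: ennreal_plus ennreal_1)
      also have "\<dots> \<le> ennreal (U z)"
      proof (rule ennreal_leI)
        have "C * miss_prob K x n z \<le> C * m" by (intro mult_left_mono m True C)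
        then show "V z + b + C * (W z - 1 + miss_prob K x n z) + 1 \<le> U z"
          using C(2) by (simp add: U_def algebra_simps)
      qed
      finally show ?thesis .
    next
      case False
      have "(\<integral>\<^sup>+y. U y \<partial>measure_pmf (K z)) + 1 = ((\<integral>\<^sup>+y. V y \<partial>measure_pmf (K z)) + 1) + ennreal (C * (W z - 1 + miss_prob K x n z))"
        unfolding KU KW[OF z(2)] by (simp add: ac_simps)
      also have "\<dots> \<le> ennreal (V z) + ennreal (C * W z)"
        using C(1) miss_prob_bounds(2)[of K x n z] by (intro add_mono drift z False ennreal_leI mult_left_mono) auto
      also have "\<dots> = ennreal (U z)" unfolding U_def using V0 W0 C(1) by simp
      finally show ?thesis .
    qed
  qed
qed

lemma (in countable_chain) AE_visits_point:
  fixes U :: "'s \<Rightarrow> real"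
  assumes "\<And>z. z \<in> S \<Longrightarrow> z \<noteq> x \<Longrightarrow> (\<integral>\<^sup>+y. U y \<partial>measure_pmf (K z)) + 1 \<le> U z"
  shows "AE \<omega> in M. \<forall>t. \<exists>s\<ge>t. X s \<omega> = x"
proof -
  have "AE \<omega> in M. \<forall>t. \<exists>s\<ge>t. \<not> (X s \<omega> \<in> - {x} \<and> True)"
  proof (rule AE_not_stay[where V = "\<lambda>z. ennreal (U z)" and \<epsilon> = 1])
    fix z assume "z \<in> S" "z \<in> - {x}"
    then have "(\<integral>\<^sup>+y. U y \<partial>measure_pmf (K z)) + 1 \<le> U z" using assms by simp
    moreover have "(\<integral>\<^sup>+y. ennreal (U y) * indicator {y\<in>- {x}. True} y \<partial>measure_pmf (K z)) \<le> (\<integral>\<^sup>+y. U y \<partial>measure_pmf (K z))"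
      by (intro nn_integral_mono) (auto simp: indicator_def)
    ultimately show "(\<integral>\<^sup>+y. ennreal (U y) * indicator {y\<in>- {x}. True} y \<partial>measure_pmf (K z)) + 1 \<le> U z"
      by (meson add_right_mono order_trans)
  qed auto
  then show ?thesis by simp
qed

text \<open>The return time exceeds 1 by the number of \<open>k\<close> for which \<open>x\<close>
  is avoided at times 1 to \<open>k + 1\<close>; if there is no return, the sum is infinite as well.
  This turns the mean return time into a sum of survival probabilities.\<close>

lemma return_time_le: "return_time x \<omega> \<le> 1 + (\<Sum>k. indicator {p. stay (- {x}) (\<lambda>_ _. True) 1 k p} \<omega>)"
proof (cases "\<exists>t\<ge>1. \<omega> t = x")
  case True
  define \<tau> where "\<tau> = (LEAST t. 1 \<le> t \<and> \<omega> t = x)"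
  have \<tau>: "1 \<le> \<tau>" "\<omega> \<tau> = x" unfolding \<tau>_def using LeastI_ex[of "\<lambda>t. 1 \<le> t \<and> \<omega> t = x"] True by auto
  have before: "\<omega> t \<noteq> x" if "1 \<le> t" "t < \<tau>" for t
    using not_less_Least[of t "\<lambda>t. 1 \<le> t \<and> \<omega> t = x"] that unfolding \<tau>_def by auto
  have "return_time x \<omega> \<le> of_nat \<tau>"
    unfolding return_time_def using \<tau> by (intro INF_lower) auto
  also have "\<dots> = 1 + of_nat (\<tau> - 1)" using \<tau>(1) by (metis of_nat_1 of_nat_add le_add_diff_inverse)
  also have "(of_nat (\<tau> - 1) :: ennreal) = (\<Sum>k<\<tau> - 1. indicator {p. stay (- {x}) (\<lambda>_ _. True) 1 k p} \<omega>)"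
  proof -
    have "stay (- {x}) (\<lambda>_ _. True) 1 k \<omega>" if "k < \<tau> - 1" for k
      using before that by (fastforce simp: stay_def)
    then have "(\<Sum>k<\<tau> - 1. indicator {p. stay (- {x}) (\<lambda>_ _. True) 1 k p} \<omega>) = (\<Sum>k<\<tau> - 1. 1 :: ennreal)"
      by (intro sum.cong refl) simp
    then show ?thesis by (simp only: sum_constant card_lessThan mult_1_right)
  qed
  also have "\<dots> \<le> (\<Sum>k. indicator {p. stay (- {x}) (\<lambda>_ _. True) 1 k p} \<omega>)"
    by (rule sum_le_suminf) auto
  finally show ?thesis by (simp add: add_left_mono)
next
  case False
  then have "(\<Sum>k. indicator {p. stay (- {x}) (\<lambda>_ _. True) 1 k p} \<omega>) = (\<Sum>k::nat. 1::ennreal)"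
    by (intro suminf_cong) (auto simp: indicator_def stay_def)
  also have "\<dots> = \<top>"
  proof -
    have "of_nat n \<le> (\<Sum>k::nat. 1::ennreal)" for n
      using sum_le_suminf[of "\<lambda>_. 1 :: ennreal" "{..<n}"] by simp
    then have "(SUP n. of_nat n :: ennreal) \<le> (\<Sum>k::nat. 1)" by (rule SUP_least)
    then show ?thesis by (simp add: ennreal_SUP_of_nat_eq_top top_unique)
  qed
  finally show ?thesis by simp
qed

text \<open>From time 1 on, each time spent away from \<open>x\<close> costs 1 in the mean of
  \<open>U\<close>, and at time 1 this mean is the one-step mean from \<open>x\<close>. So the mean
  return time is at most 1 plus that.\<close>

lemma return_time_finite_mean:
  fixes U :: "'s \<Rightarrow> real"
  assumes S: "countable S" "x \<in> S" and closed: "\<And>y. y \<in> S \<Longrightarrow> set_pmf (K y) \<subseteq> S"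
    and drift: "\<And>z. z \<in> S \<Longrightarrow> z \<noteq> x \<Longrightarrow> (\<integral>\<^sup>+y. U y \<partial>measure_pmf (K z)) + 1 \<le> U z"
    and fin: "(\<integral>\<^sup>+y. U y \<partial>measure_pmf (K x)) < \<top>"
  shows "(\<integral>\<^sup>+\<omega>. return_time x \<omega> \<partial>path_law K x) < \<infinity>"
proof -
  let ?X = "\<lambda>t (\<omega> :: nat \<Rightarrow> 's). if \<omega> t \<in> S then \<omega> t else x"
  let ?st = "stay (- {x}) (\<lambda>_ _. True) 1"
  interpret countable_chain "path_law K x" S K ?X
    by (rule countable_chain_path_law[OF S]) (rule closed)
  have X: "AE \<omega> in path_law K x. \<forall>t. \<omega> t \<in> S"
    by (rule AE_path_law_states[OF S]) (rule closed)
  have X0: "AE \<omega> in path_law K x. \<omega> 0 = x"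
  proof -
    have "measure (path_law K x) {\<omega>. \<omega> 0 = x} = 1"
      using emeasure_path_law_finite[of K x 0 "\<lambda>_. x"] by (simp add: emeasure_eq_measure)
    then show ?thesis
      using sets_path_law_coord[of 0 "{x}" K x] by (subst (asm) prob_eq_1) (auto simp: space_path_law)
  qed
  have sets: "{\<omega>\<in>space (path_law K x). ?st k (\<lambda>s. ?X s \<omega>)} \<in> sets (path_law K x)" for k
    by (rule sets_history[where t = "1 + k" and P = "?st k"]) (rule stay_cong)
  have ae: "AE \<omega> in path_law K x. \<forall>k. indicator {p. ?st k p} \<omega> =
     (indicator {\<omega>\<in>space (path_law K x). ?st k (\<lambda>s. ?X s \<omega>)} \<omega> :: ennreal)"
    using X by eventually_elim (auto simp: indicator_def space_path_law)
  have "(\<Sum>k<n. emeasure (path_law K x) {\<omega>\<in>space (path_law K x). ?st k (\<lambda>s. ?X s \<omega>)}) \<le>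
      (\<integral>\<^sup>+y. U y \<partial>measure_pmf (K x))" for n
  proof -
    have "(\<integral>\<^sup>+y. ennreal (U y) * indicator {y\<in>- {x}. True} y \<partial>measure_pmf (K z)) + 1 \<le> ennreal (U z)"
      if "z \<in> S" "z \<in> - {x}" for z
    proof -
      have "(\<integral>\<^sup>+y. U y \<partial>measure_pmf (K z)) + 1 \<le> U z" using drift that by simp
      moreover have "(\<integral>\<^sup>+y. ennreal (U y) * indicator {y\<in>- {x}. True} y \<partial>measure_pmf (K z)) \<le> (\<integral>\<^sup>+y. U y \<partial>measure_pmf (K z))"
        by (intro nn_integral_mono) (auto simp: indicator_def)
      ultimately show ?thesis by (meson add_right_mono order_trans)
    qed
    from stay_bound[where V = "\<lambda>z. ennreal (U z)" and A = "- {x}" and R = "\<lambda>_ _. True" and \<epsilon> = 1 and Q = "\<lambda>_. True" and t = 1 and n = n, OF this]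
    have "(\<Sum>k<n. emeasure (path_law K x) {\<omega>\<in>space (path_law K x). ?st k (\<lambda>s. ?X s \<omega>)}) \<le>
        (\<integral>\<^sup>+\<omega>. ennreal (U (?X 1 \<omega>)) * indicator {z\<in>- {x}. True} (?X 1 \<omega>) \<partial>path_law K x)"
      by (simp only: mult_1 simp_thms) (meson add_increasing order_refl order_trans zero_le)
    also have "\<dots> \<le> (\<integral>\<^sup>+\<omega>. U (?X (Suc 0) \<omega>) \<partial>path_law K x)"
      by (intro nn_integral_mono) (auto simp: indicator_def)
    also have "\<dots> = (\<integral>\<^sup>+\<omega>. (\<integral>\<^sup>+y. U y \<partial>measure_pmf (K (?X 0 \<omega>))) \<partial>path_law K x)"
      by (rule one_step[of 0 "\<lambda>_ y. ennreal (U y)"]) simp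
    also have "\<dots> = (\<integral>\<^sup>+\<omega>. (\<integral>\<^sup>+y. U y \<partial>measure_pmf (K x)) \<partial>path_law K x)"
      by (rule nn_integral_cong_AE) (use X0 in eventually_elim, simp)
    also have "\<dots> = (\<integral>\<^sup>+y. U y \<partial>measure_pmf (K x))" by (simp add: emeasure_space_1)
    finally show ?thesis .
  qed
  then have sum: "(\<Sum>k. emeasure (path_law K x) {\<omega>\<in>space (path_law K x). ?st k (\<lambda>s. ?X s \<omega>)}) \<le>
      (\<integral>\<^sup>+y. U y \<partial>measure_pmf (K x))"
    by (intro suminf_le_const summableI)
  have "(\<integral>\<^sup>+\<omega>. return_time x \<omega> \<partial>path_law K x) \<le>
      (\<integral>\<^sup>+\<omega>. 1 + (\<Sum>k. indicator {p. ?st k p} \<omega>) \<partial>path_law K x)"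
    by (intro nn_integral_mono return_time_le)
  also have "\<dots> = (\<integral>\<^sup>+\<omega>. 1 + (\<Sum>k. indicator {\<omega>\<in>space (path_law K x). ?st k (\<lambda>s. ?X s \<omega>)} \<omega>) \<partial>path_law K x)"
    by (rule nn_integral_cong_AE) (use ae in eventually_elim, simp)
  also have "\<dots> = 1 + (\<Sum>k. emeasure (path_law K x) {\<omega>\<in>space (path_law K x). ?st k (\<lambda>s. ?X s \<omega>)})"
    using sets by (subst nn_integral_add) (auto simp: emeasure_space_1 nn_integral_suminf)
  also have "\<dots> \<le> 1 + (\<integral>\<^sup>+y. U y \<partial>measure_pmf (K x))" by (intro add_left_mono sum)
  also have "\<dots> < \<infinity>" using fin by simp
  finally show ?thesis .
qed

section \<open>Lumping to the process of differences\<close>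

lemma set_pmf_normalized_pmf:
  assumes "finite A" "A \<noteq> {}" "\<And>i. i \<in> A \<Longrightarrow> w i > 0"
  shows "set_pmf (normalized_pmf A w) = A"
proof -
  have "(\<Sum>j\<in>A. w j) > 0" using assms by (intro sum_pos) auto
  then show ?thesis
    using assms(3) by (auto simp: set_pmf_eq pmf_normalized_pmf[OF assms] less_imp_neq[symmetric] dest: less_imp_neq)
qed

lemma nn_integral_map_normalized_pmf:
  assumes A: "finite A" "A \<noteq> {}" "\<And>i. i \<in> A \<Longrightarrow> w i > 0" and h: "\<And>y. 0 \<le> h y"
  shows "(\<integral>\<^sup>+y. ennreal (h y) \<partial>measure_pmf (map_pmf g (normalized_pmf A w))) =
    ennreal (\<Sum>i\<in>A. w i / (\<Sum>j\<in>A. w j) * h (g i))"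
proof -
  have pos: "(\<Sum>j\<in>A. w j) > 0" using A by (intro sum_pos) auto
  have "(\<integral>\<^sup>+y. ennreal (h y) \<partial>measure_pmf (map_pmf g (normalized_pmf A w))) =
    (\<Sum>i\<in>A. ennreal (h (g i)) * ennreal (pmf (normalized_pmf A w) i))"
    using A(1) by (simp add: nn_integral_measure_pmf_finite set_pmf_normalized_pmf[OF A])
  also have "\<dots> = (\<Sum>i\<in>A. ennreal (w i / (\<Sum>j\<in>A. w j) * h (g i)))"
  proof (rule sum.cong[OF refl])
    fix i assume "i \<in> A"
    then show "ennreal (h (g i)) * ennreal (pmf (normalized_pmf A w) i) = ennreal (w i / (\<Sum>j\<in>A. w j) * h (g i))"
      using h[of "g i"] A(3)[of i] pos
      by (subst pmf_normalized_pmf[OF A]) (auto simp: ennreal_mult'[symmetric] mult.commute)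
  qed
  also have "\<dots> = ennreal (\<Sum>i\<in>A. w i / (\<Sum>j\<in>A. w j) * h (g i))"
    using h pos A(3) by (intro sum_ennreal mult_nonneg_nonneg divide_nonneg_nonneg) (simp_all add: less_imp_le)
  finally show ?thesis .
qed

lemma normalized_pmf_scale:
  assumes "c \<noteq> 0" "\<And>i. i \<in> A \<Longrightarrow> w i = c * w' i"
  shows "normalized_pmf A w = normalized_pmf A w'"
proof -
  have "(\<Sum>j\<in>A. w j) = c * (\<Sum>j\<in>A. w' j)"
    using assms(2) by (simp add: sum_distrib_left)
  then have "(\<lambda>i. if i \<in> A then w i / (\<Sum>j\<in>A. w j) else 0) = (\<lambda>i. if i \<in> A then w' i / (\<Sum>j\<in>A. w' j) else 0)"
    using assms by (auto simp: fun_eq_iff)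
  then show ?thesis unfolding normalized_pmf_def by simp
qed

lemma countable_supported_functions:
  fixes c :: "'b :: countable"
  assumes "finite I"
  shows "countable {x. \<forall>i. i \<notin> I \<longrightarrow> x i = c}"
proof -
  have "inj_on (\<lambda>x. restrict x I) {x. \<forall>i. i \<notin> I \<longrightarrow> x i = c}"
  proof (rule inj_onI, rule ext)
    fix x y i assume "x \<in> {x. \<forall>i. i \<notin> I \<longrightarrow> x i = c}" "y \<in> {x. \<forall>i. i \<notin> I \<longrightarrow> x i = c}" "restrict x I = restrict y I"
    then show "x i = y i" by (cases "i \<in> I") (auto dest: fun_cong[of _ _ i])
  qed
  moreover have "countable ((\<lambda>x. restrict x I) ` {x. \<forall>i. i \<notin> I \<longrightarrow> x i = c})"
    by (rule countable_subset[of _ "PiE I (\<lambda>_. UNIV)"]) (auto intro!: countable_PiE assms)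
  ultimately show ?thesis by (rule countable_image_inj_on[rotated])
qed

lemma countable_diff_states: "countable (diff_states N)"
  unfolding diff_states_def by (rule countable_supported_functions) simp

lemma growth_kernel_closed:
  assumes "\<beta> > 0" "x \<in> growth_states N"
  shows "set_pmf (growth_kernel N U \<beta> x) \<subseteq> growth_states N"
  unfolding growth_kernel_def using assms
  by (subst set_map_pmf, subst set_pmf_normalized_pmf) (auto simp: growth_states_def)

lemma diff_kernel_closed:
  assumes "\<beta> > 0" "z \<in> diff_states N"
  shows "set_pmf (diff_kernel N U \<beta> z) \<subseteq> diff_states N"
  unfolding diff_kernel_def using assms
  by (subst set_map_pmf, subst set_pmf_normalized_pmf)
    (auto simp: diff_states_def diff_step_def zero_less_power_int split: if_splits)

definition diff_map :: "nat \<Rightarrow> (nat \<Rightarrow> nat) \<Rightarrow> nat \<Rightarrow> int" where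
  "diff_map N x i = (if i \<in> {1..N} then int (x i) - int (x (N + 1)) else 0)"

lemma differences_eq: "differences N \<xi> = (\<lambda>t \<omega>. diff_map N (\<xi> t \<omega>))"
  by (simp add: fun_eq_iff differences_def diff_map_def)

lemma diff_map_states: "diff_map N x \<in> diff_states N"
  by (auto simp: diff_map_def diff_states_def)

lemma diff_map_step: "i \<in> {1..N+1} \<Longrightarrow> diff_map N (x(i := x i + 1)) = diff_step N i (diff_map N x)"
  by (rule ext) (auto simp: diff_map_def diff_step_def)

text \<open>Every neighbourhood has exactly two sites, so passing to differences divides all weights
  by the common factor \<open>\<beta> ^ (2 * x (N + 1))\<close>, which normalisation
  cancels.\<close>

lemma diff_map_growth_kernel:
  assumes "\<beta> > 0" "N \<ge> 1"
  shows "map_pmf (diff_map N) (growth_kernel N (asymmetric_nbhd N) \<beta> x) = diff_kernel N (asymmetric_nbhd N) \<beta> (diff_map N x)"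
proof -
  let ?U = "asymmetric_nbhd N"
  have "normalized_pmf {1..N+1} (\<lambda>i. \<beta> ^ (\<Sum>j\<in>?U i. x j)) =
      normalized_pmf {1..N+1} (\<lambda>k. \<beta> powi (\<Sum>j\<in>?U k. diff_map N x j))"
  proof (rule normalized_pmf_scale[of "\<beta> ^ (2 * x (N + 1))"])
    fix k assume "k \<in> {1..N+1}"
    \<comment> \<open>Site \<open>N\<close> is singled out because its neighbourhood contains
      \<open>N + 1\<close>, where the difference is 0 by convention.\<close>
    then consider "k = N + 1" | "k = N" | "1 \<le> k" "k < N" by force
    then have "int (\<Sum>j\<in>?U k. x j) = int (2 * x (N + 1)) + (\<Sum>j\<in>?U k. diff_map N x j)"
      using assms by cases (auto simp: asymmetric_nbhd_def diff_map_def)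
    then have "\<beta> powi int (\<Sum>j\<in>?U k. x j) = \<beta> powi int (2 * x (N + 1)) * \<beta> powi (\<Sum>j\<in>?U k. diff_map N x j)"
      using assms(1) by (simp only: power_int_add[symmetric] less_imp_neq[symmetric] simp_thms)
    then show "\<beta> ^ (\<Sum>j\<in>?U k. x j) = \<beta> ^ (2 * x (N + 1)) * \<beta> powi (\<Sum>j\<in>?U k. diff_map N x j)"
      by (simp only: power_int_of_nat)
  qed (use assms in simp)
  then have "map_pmf (diff_map N) (growth_kernel N ?U \<beta> x) =
    map_pmf (\<lambda>i. diff_map N (x(i := x i + 1))) (normalized_pmf {1..N+1} (\<lambda>k. \<beta> powi (\<Sum>j\<in>?U k. diff_map N x j)))"
    unfolding growth_kernel_def by (simp add: pmf.map_comp comp_def)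
  also have "\<dots> = diff_kernel N ?U \<beta> (diff_map N x)"
    unfolding diff_kernel_def using assms
    by (intro map_pmf_cong refl diff_map_step) (subst (asm) set_pmf_normalized_pmf; auto simp: zero_less_power_int)
  finally show ?thesis .
qed

lemma growth_process_countable_chain:
  assumes "growth_process M N U \<beta> \<xi>" "\<beta> > 0"
  shows "countable_chain M (growth_states N) (growth_kernel N U \<beta>) \<xi>"
  using assms growth_kernel_closed unfolding growth_process_def
  by (intro markov_chain_countable_chain) auto

lemma differences_markov_chain:
  assumes "growth_process M N (asymmetric_nbhd N) \<beta> \<xi>" "\<beta> > 0" "N \<ge> 1"
  shows "markov_chain M (diff_states N) (diff_kernel N (asymmetric_nbhd N) \<beta>) (differences N \<xi>)"
proof -
  interpret countable_chain M "growth_states N" "growth_kernel N (asymmetric_nbhd N) \<beta>" \<xi>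
    by (rule growth_process_countable_chain[OF assms(1,2)])
  show ?thesis
    unfolding differences_eq
    by (rule markov_chain_image) (use assms in \<open>auto simp: countable_diff_states diff_map_states diff_map_growth_kernel\<close>)
qed

section \<open>Positive recurrence for three sites and \<open>\<beta> < 1\<close>\<close>

definition plane :: "int \<Rightarrow> int \<Rightarrow> nat \<Rightarrow> int" where
  "plane a b i = (if i = 1 then a else if i = 2 then b else 0)"

lemma plane_eq: "(z :: nat \<Rightarrow> int) \<in> diff_states 2 \<Longrightarrow> z = plane (z 1) (z 2)"
proof (rule ext)
  fix i :: nat assume z: "z \<in> diff_states 2"
  consider "i = 1" | "i = 2" | "i \<notin> {1..2}" by force
  then show "z i = plane (z 1) (z 2) i"
    using z by cases (auto simp: plane_def diff_states_def)
qed

lemma plane_states: "plane a b \<in> diff_states 2"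
  by (auto simp: plane_def diff_states_def)

lemma three_sites: "{1..2+1} = {1, 2, 3::nat}"
  by auto

lemma diff_step_plane:
  "diff_step 2 1 (plane a b) = plane (a + 1) b"
  "diff_step 2 2 (plane a b) = plane a (b + 1)"
  "diff_step 2 3 (plane a b) = plane (a - 1) (b - 1)"
  by (auto simp: diff_step_def plane_def fun_eq_iff)

lemma weight_plane:
  "(\<Sum>j\<in>asymmetric_nbhd 2 1. plane a b j) = a + b"
  "(\<Sum>j\<in>asymmetric_nbhd 2 2. plane a b j) = b"
  "(\<Sum>j\<in>asymmetric_nbhd 2 3. plane a b j) = a"
  by (auto simp: asymmetric_nbhd_def plane_def)

lemma nn_integral_diff_kernel_plane:
  assumes "\<beta> > 0" "\<And>y. 0 \<le> h y"
  shows "(\<integral>\<^sup>+y. ennreal (h y) \<partial>measure_pmf (diff_kernel 2 (asymmetric_nbhd 2) \<beta> (plane a b))) =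
    ennreal ((\<beta> powi (a + b) * h (plane (a + 1) b) + \<beta> powi b * h (plane a (b + 1)) + \<beta> powi a * h (plane (a - 1) (b - 1)))
       / (\<beta> powi (a + b) + \<beta> powi b + \<beta> powi a))"
  unfolding diff_kernel_def three_sites using assms
  by (subst nn_integral_map_normalized_pmf)
    (simp_all add: zero_less_power_int weight_plane diff_step_plane[unfolded One_nat_def] diff_step_plane weight_plane[unfolded One_nat_def] add_divide_distrib add.assoc)

text \<open>Only the diagonal step lowers coordinates, and it lowers both. It is repeated until
  neither coordinate exceeds its target; then each is raised separately.\<close>

lemma diff_kernel_plane_reach:
  assumes "\<beta> > 0"
  shows "(plane a b, plane c d) \<in> {(z, y). y \<in> set_pmf (diff_kernel 2 (asymmetric_nbhd 2) \<beta> z)}\<^sup>*"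
proof -
  let ?R = "{(z, y). y \<in> set_pmf (diff_kernel 2 (asymmetric_nbhd 2) \<beta> z)}"
  have step: "(z, diff_step 2 k z) \<in> ?R" if "k \<in> {1..2+1}" for z k
    unfolding diff_kernel_def using that assms
    by (simp only: mem_Collect_eq case_prod_conv set_map_pmf, subst set_pmf_normalized_pmf) (auto simp: zero_less_power_int)
  have s1: "(plane a b, plane (a + int n) b) \<in> ?R\<^sup>*" for a b n
  proof (induction n)
    case (Suc n)
    have "(plane (a + int n) b, plane (a + int n + 1) b) \<in> ?R"
      using step[of 1 "plane (a + int n) b"] unfolding diff_step_plane by fastforce
    with Suc show ?case by (simp add: rtrancl_into_rtrancl algebra_simps)
  qed simp
  have s2: "(plane a b, plane a (b + int n)) \<in> ?R\<^sup>*" for a b n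
  proof (induction n)
    case (Suc n)
    have "(plane a (b + int n), plane a (b + int n + 1)) \<in> ?R"
      using step[of 2 "plane a (b + int n)"] unfolding diff_step_plane by fastforce
    with Suc show ?case by (simp add: rtrancl_into_rtrancl algebra_simps)
  qed simp
  have s3: "(plane a b, plane (a - int n) (b - int n)) \<in> ?R\<^sup>*" for a b n
  proof (induction n)
    case (Suc n)
    have "(plane (a - int n) (b - int n), plane (a - int n - 1) (b - int n - 1)) \<in> ?R"
      using step[of 3 "plane (a - int n) (b - int n)"] unfolding diff_step_plane by fastforce
    with Suc show ?case by (simp add: rtrancl_into_rtrancl algebra_simps)
  qed simp
  define n where "n = nat (max (a - c) (b - d))"
  have n: "a - int n \<le> c" "b - int n \<le> d" unfolding n_def by auto
  have "(plane a b, plane (a - int n) (b - int n)) \<in> ?R\<^sup>*" by (rule s3)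
  also have "(plane (a - int n) (b - int n), plane c (b - int n)) \<in> ?R\<^sup>*"
    using s1[of "a - int n" "b - int n" "nat (c - (a - int n))"] n by simp
  also have "(plane c (b - int n), plane c d) \<in> ?R\<^sup>*"
    using s2[of c "b - int n" "nat (d - (b - int n))"] n by simp
  finally show ?thesis .
qed

text \<open>
  For \<open>\<beta> < 1\<close> the process spirals inwards. The sides of the triangle \<open>lyap a b \<le> r\<close> are
  tilted so that, away from the origin, the jump that increases the form realising the maximum
  always has small probability.
\<close>

definition lyap :: "int \<Rightarrow> int \<Rightarrow> int" where
  "lyap a b = max (3 * a - b) (max (3 * b - 2 * a) (- 2 * b - a))"

lemma lyap_nonneg: "0 \<le> lyap a b"
  unfolding lyap_def by linarith

lemma lyap_step_le:
  "lyap (a + 1) b \<le> lyap a b + 3" "lyap a (b + 1) \<le> lyap a b + 3" "lyap (a - 1) (b - 1) \<le> lyap a b + 3"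
  unfolding lyap_def max_def by (auto split: if_splits)

lemma lyap_bounded: "lyap a b \<le> r \<Longrightarrow> \<bar>a\<bar> \<le> r \<and> \<bar>b\<bar> \<le> r"
  unfolding lyap_def by linarith

text \<open>The constants fit a sum over three jumps of total weight \<open>T\<close>. Since
  \<open>3 * w = - w + 4 * w\<close>, a weight of at most \<open>T / 24\<close> leaves an error of
  at most \<open>T / 6\<close>, and three such bounds add up to
  \<open>- T + T / 2 = - T / 2\<close>.\<close>

lemma weighted_drift_bound:
  fixes w T d :: real
  assumes "0 < w" "w \<le> T" "d \<le> 3" "d \<le> - 1 \<or> w \<le> T / 24"
  shows "w * d \<le> - w + T / 6"
proof (cases "d \<le> - 1")
  case True
  then have "w * d \<le> w * (- 1)" using assms(1) by (intro mult_left_mono) auto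
  then show ?thesis using assms by simp
next
  case False
  have "w * d \<le> w * 3" using assms(1,3) by (intro mult_left_mono) auto
  then show ?thesis using False assms(4) by simp
qed

lemma lyap_drift:
  fixes \<beta> :: real
  assumes "0 < \<beta>" "\<beta> < 1"
  obtains r :: int where "\<And>a b. r < lyap a b \<Longrightarrow>
    (\<beta> powi (a + b) * lyap (a + 1) b + \<beta> powi b * lyap a (b + 1) + \<beta> powi a * lyap (a - 1) (b - 1))
       / (\<beta> powi (a + b) + \<beta> powi b + \<beta> powi a) + 1 / 2 \<le> lyap a b"
proof -
  obtain C :: nat where C: "\<beta> ^ C < 1 / 24"
    using real_arch_pow_inv[of "1/24" \<beta>] assms by auto
  have small: "\<beta> powi k \<le> 1 / 24" if "int C \<le> k" for k
  proof -
    have "\<beta> powi k \<le> \<beta> powi int C"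
      using assms that by (intro power_int_decreasing) auto
    then show ?thesis using C by simp
  qed
  show thesis
  \<comment> \<open>Each jump raises one of the three forms by 3 and lowers the others by at least
    1. If it fails to lower the maximum, its form is at least \<open>lyap a b - 3\<close>. Twice
    this form minus a suitable other one is \<open>7 * a\<close>, \<open>7 * (b - a)\<close> or
    \<open>- 7 * b\<close> respectively, hence at least \<open>lyap a b - 6\<close>. So this
    exponent gap to a competing weight is at least \<open>C\<close>.\<close>
  proof (rule that[of "7 * int C + 8"])
    fix a b assume r: "7 * int C + 8 < lyap a b"
    let ?w1 = "\<beta> powi (a + b)" and ?w2 = "\<beta> powi b" and ?w3 = "\<beta> powi a"
    let ?T = "?w1 + ?w2 + ?w3"
    have w: "0 < ?w1" "0 < ?w2" "0 < ?w3" using assms by (auto simp: zero_less_power_int)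
    then have T: "0 < ?T" by simp
    have pi: "\<beta> powi (k + l) = \<beta> powi k * \<beta> powi l" for k l using assms by (simp add: power_int_add)
    have *: "w * (real_of_int l - lyap a b) \<le> - w + ?T / 6"
      if "0 < w" "w \<le> ?T" "l \<le> lyap a b + 3" "l \<le> lyap a b - 1 \<or> w \<le> ?T / 24" for w l
      by (rule weighted_drift_bound) (use that in auto)
    have "lyap (a + 1) b \<le> lyap a b - 1 \<or> ?w1 \<le> ?T / 24"
    proof (cases "lyap (a + 1) b \<le> lyap a b - 1")
      case False
      then have "int C \<le> a" using r unfolding lyap_def max_def by (simp split: if_splits)
      then have "?w2 * \<beta> powi a \<le> ?w2 * (1 / 24)" using w by (intro mult_left_mono small) auto
      then have "?w1 \<le> ?w2 / 24" by (simp add: pi mult.commute)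
      then show ?thesis using w by simp
    qed simp
    from *[OF w(1) _ lyap_step_le(1) this] have 1: "?w1 * (real_of_int (lyap (a + 1) b) - lyap a b) \<le> - ?w1 + ?T / 6" using w by simp
    have "lyap a (b + 1) \<le> lyap a b - 1 \<or> ?w2 \<le> ?T / 24"
    proof (cases "lyap a (b + 1) \<le> lyap a b - 1")
      case False
      then have "int C \<le> b - a" using r unfolding lyap_def max_def by (simp split: if_splits)
      then have "?w3 * \<beta> powi (b - a) \<le> ?w3 * (1 / 24)" using w by (intro mult_left_mono small) auto
      then have "?w2 \<le> ?w3 / 24" using pi[of a "b - a"] by simp
      then show ?thesis using w by simp
    qed simp
    from *[OF w(2) _ lyap_step_le(2) this] have 2: "?w2 * (real_of_int (lyap a (b + 1)) - lyap a b) \<le> - ?w2 + ?T / 6" using w by simp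
    have "lyap (a - 1) (b - 1) \<le> lyap a b - 1 \<or> ?w3 \<le> ?T / 24"
    proof (cases "lyap (a - 1) (b - 1) \<le> lyap a b - 1")
      case False
      then have "int C \<le> - b" using r unfolding lyap_def max_def by (simp split: if_splits)
      then have "?w1 * \<beta> powi (- b) \<le> ?w1 * (1 / 24)" using w by (intro mult_left_mono small) auto
      then have "?w3 \<le> ?w1 / 24" using pi[of "a + b" "- b"] by simp
      then show ?thesis using w by simp
    qed simp
    from *[OF w(3) _ lyap_step_le(3) this] have 3: "?w3 * (real_of_int (lyap (a - 1) (b - 1)) - lyap a b) \<le> - ?w3 + ?T / 6" using w by simp
    have "?w1 * lyap (a + 1) b + ?w2 * lyap a (b + 1) + ?w3 * lyap (a - 1) (b - 1) \<le> (lyap a b - 1 / 2) * ?T"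
      using 1 2 3 by (simp add: algebra_simps)
    then have "(?w1 * lyap (a + 1) b + ?w2 * lyap a (b + 1) + ?w3 * lyap (a - 1) (b - 1)) / ?T \<le> lyap a b - 1 / 2"
      using T by (simp only: pos_divide_le_eq)
    then show "(?w1 * lyap (a + 1) b + ?w2 * lyap a (b + 1) + ?w3 * lyap (a - 1) (b - 1)) / ?T + 1 / 2 \<le> lyap a b"
      by simp
  qed
qed

text \<open>The point \<open>x\<close> is arbitrary because positive recurrence concerns every
  state; for coincidences of the three heights it is the origin.\<close>

lemma diff_chain_drift:
  assumes \<beta>: "0 < \<beta>" "\<beta> < 1" and x: "x \<in> diff_states 2"
  shows "\<exists>U :: (nat \<Rightarrow> int) \<Rightarrow> real.
    (\<forall>z\<in>diff_states 2. z \<noteq> x \<longrightarrow>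
      (\<integral>\<^sup>+y. U y \<partial>measure_pmf (diff_kernel 2 (asymmetric_nbhd 2) \<beta> z)) + 1 \<le> U z) \<and>
    (\<integral>\<^sup>+y. U y \<partial>measure_pmf (diff_kernel 2 (asymmetric_nbhd 2) \<beta> x)) < \<top>"
proof -
  let ?K = "diff_kernel 2 (asymmetric_nbhd 2) \<beta>"
  obtain r where r: "\<And>a b. r < lyap a b \<Longrightarrow>
    (\<beta> powi (a + b) * lyap (a + 1) b + \<beta> powi b * lyap a (b + 1) + \<beta> powi a * lyap (a - 1) (b - 1))
       / (\<beta> powi (a + b) + \<beta> powi b + \<beta> powi a) + 1 / 2 \<le> lyap a b"
    using lyap_drift[OF \<beta>] by blast
  \<comment> \<open>Doubling turns the drift 1 / 2 of \<open>lyap\<close> into the unit drift wanted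
    by \<open>drift_off_point\<close>; the growth 3 per jump becomes the bound 6 on
    \<open>F\<close>.\<close>
  define V where "V z = 2 * real_of_int (lyap (z 1) (z 2))" for z :: "nat \<Rightarrow> int"
  have V_plane: "V (plane a b) = 2 * real_of_int (lyap a b)" for a b by (simp add: V_def plane_def)
  have V0: "0 \<le> V z" for z using lyap_nonneg by (simp add: V_def)
  define F where "F = (\<lambda>(a, b). plane a b) ` {(a, b). lyap a b \<le> r}"
  have "{(a, b). lyap a b \<le> r} \<subseteq> {- r..r} \<times> {- r..r}"
    by (auto simp: abs_le_iff dest!: lyap_bounded)
  then have "finite {(a, b). lyap a b \<le> r}" by (rule finite_subset) simp
  then have "finite F" unfolding F_def by (rule finite_imageI)
  define m where "m a b = (\<beta> powi (a + b) * lyap (a + 1) b + \<beta> powi b * lyap a (b + 1) + \<beta> powi a * lyap (a - 1) (b - 1))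
       / (\<beta> powi (a + b) + \<beta> powi b + \<beta> powi a)" for a b
  have m0: "0 \<le> m a b" for a b
    unfolding m_def using \<beta> lyap_nonneg
    by (intro divide_nonneg_nonneg add_nonneg_nonneg mult_nonneg_nonneg) (simp_all add: zero_le_power_int)
  have KV: "(\<integral>\<^sup>+y. V y \<partial>measure_pmf (?K (plane a b))) = ennreal (2 * m a b)" for a b
  proof -
    have "(\<integral>\<^sup>+y. V y \<partial>measure_pmf (?K (plane a b))) = ennreal ((\<beta> powi (a + b) * V (plane (a + 1) b) + \<beta> powi b * V (plane a (b + 1)) + \<beta> powi a * V (plane (a - 1) (b - 1)))
       / (\<beta> powi (a + b) + \<beta> powi b + \<beta> powi a))"
      by (rule nn_integral_diff_kernel_plane[OF \<beta>(1) V0])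
    also have "\<dots> = ennreal (2 * m a b)"
      unfolding V_plane m_def by (simp add: distrib_left mult_ac)
    finally show ?thesis .
  qed
  have drift: "(\<integral>\<^sup>+y. V y \<partial>measure_pmf (?K z)) + 1 \<le> V z" if "z \<in> diff_states 2" "z \<notin> F" for z
  proof -
    define a b where "a = z 1" and "b = z 2"
    have z: "z = plane a b" unfolding a_def b_def by (rule plane_eq[OF that(1)])
    have "r < lyap a b" using that(2) unfolding F_def z by force
    from r[OF this] have "2 * m a b + 1 \<le> V z"
      unfolding z V_plane m_def[symmetric] by simp
    then have "ennreal (2 * m a b + 1) \<le> V z" by (rule ennreal_leI)
    then show ?thesis
      unfolding z KV using m0[of a b] by simp
  qed
  have bound: "(\<integral>\<^sup>+y. V y \<partial>measure_pmf (?K z)) \<le> V z + 6" if "z \<in> diff_states 2" "z \<in> F" for z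
  proof -
    define a b where "a = z 1" and "b = z 2"
    have z: "z = plane a b" unfolding a_def b_def by (rule plane_eq[OF that(1)])
    let ?w1 = "\<beta> powi (a + b)" and ?w2 = "\<beta> powi b" and ?w3 = "\<beta> powi a"
    have w: "0 < ?w1" "0 < ?w2" "0 < ?w3" using \<beta> by (auto simp: zero_less_power_int)
    have "?w1 * lyap (a + 1) b + ?w2 * lyap a (b + 1) + ?w3 * lyap (a - 1) (b - 1) \<le>
      ?w1 * (lyap a b + 3) + ?w2 * (lyap a b + 3) + ?w3 * (lyap a b + 3)"
      using w lyap_step_le[of a b] by (intro add_mono mult_left_mono) linarith+
    also have "\<dots> = (lyap a b + 3) * (?w1 + ?w2 + ?w3)" by (simp add: algebra_simps)
    finally have "(?w1 * lyap (a + 1) b + ?w2 * lyap a (b + 1) + ?w3 * lyap (a - 1) (b - 1)) / (?w1 + ?w2 + ?w3) \<le> lyap a b + 3"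
      using w by (simp only: pos_divide_le_eq add_pos_pos)
    then show ?thesis
      unfolding z KV V_plane m_def[symmetric] by (intro ennreal_leI) simp
  qed
  have reach: "(z, x) \<in> {(z, y). y \<in> set_pmf (?K z)}\<^sup>*" if "z \<in> F" for z
    using that plane_eq[OF x] diff_kernel_plane_reach[OF \<beta>(1)] unfolding F_def by (metis (no_types, lifting) case_prod_conv imageE surj_pair)
  show ?thesis
  proof (rule drift_off_point[of V F 6 "diff_states 2" ?K x])
    fix U :: "(nat \<Rightarrow> int) \<Rightarrow> real"
    assume U: "\<And>z. z \<in> diff_states 2 \<Longrightarrow> z \<noteq> x \<Longrightarrow> (\<integral>\<^sup>+y. ennreal (U y) \<partial>measure_pmf (?K z)) + 1 \<le> ennreal (U z)"
      "\<And>z. z \<in> diff_states 2 \<Longrightarrow> (\<integral>\<^sup>+y. ennreal (U y) \<partial>measure_pmf (?K z)) < \<top>"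
    show ?thesis using U x by blast
  qed (fact V0 \<open>finite F\<close> drift bound reach | simp)+
qed

lemma diff_chain_positive_recurrent:
  assumes "0 < \<beta>" "\<beta> < 1"
  shows "positive_recurrent (diff_states 2) (diff_kernel 2 (asymmetric_nbhd 2) \<beta>)"
  unfolding positive_recurrent_def
proof
  fix x assume x: "x \<in> diff_states 2"
  obtain U :: "(nat \<Rightarrow> int) \<Rightarrow> real" where
    U: "\<forall>z\<in>diff_states 2. z \<noteq> x \<longrightarrow>
      (\<integral>\<^sup>+y. U y \<partial>measure_pmf (diff_kernel 2 (asymmetric_nbhd 2) \<beta> z)) + 1 \<le> U z"
    "(\<integral>\<^sup>+y. U y \<partial>measure_pmf (diff_kernel 2 (asymmetric_nbhd 2) \<beta> x)) < \<top>"
    using diff_chain_drift[OF assms x] by blast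
  show "(\<integral>\<^sup>+\<omega>. return_time x \<omega> \<partial>path_law (diff_kernel 2 (asymmetric_nbhd 2) \<beta>) x) < \<infinity>"
  proof (rule return_time_finite_mean[where S = "diff_states 2" and U = U])
    show "set_pmf (diff_kernel 2 (asymmetric_nbhd 2) \<beta> y) \<subseteq> diff_states 2" if "y \<in> diff_states 2" for y
      using assms(1) that by (rule diff_kernel_closed)
  qed (use U x countable_diff_states in blast)+
qed

lemma coincidence_iff: "diff_map 2 x = plane 0 0 \<longleftrightarrow> x 1 = x 2 \<and> x 2 = x 3"
proof
  assume "diff_map 2 x = plane 0 0"
  then have "diff_map 2 x 1 = 0" "diff_map 2 x 2 = 0" by (simp_all add: plane_def)
  then show "x 1 = x 2 \<and> x 2 = x 3" by (simp add: diff_map_def)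
next
  assume x: "x 1 = x 2 \<and> x 2 = x 3"
  have "diff_map 2 x 1 = 0" "diff_map 2 x 2 = 0" using x by (simp_all add: diff_map_def)
  with plane_eq[OF diff_map_states[of 2 x]] show "diff_map 2 x = plane 0 0" by simp
qed

lemma coincidence_infinitely_often:
  assumes \<beta>: "0 < \<beta>" "\<beta> < 1" and \<xi>: "growth_process M 2 (asymmetric_nbhd 2) \<beta> \<xi>"
  shows "AE \<omega> in M. infinite {t. \<xi> t \<omega> 1 = \<xi> t \<omega> 2 \<and> \<xi> t \<omega> 2 = \<xi> t \<omega> 3}"
proof -
  interpret countable_chain M "diff_states 2" "diff_kernel 2 (asymmetric_nbhd 2) \<beta>" "differences 2 \<xi>"
  proof (rule markov_chain_countable_chain)
    show "markov_chain M (diff_states 2) (diff_kernel 2 (asymmetric_nbhd 2) \<beta>) (differences 2 \<xi>)"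
      using \<xi> \<beta>(1) by (rule differences_markov_chain) simp
  qed (rule diff_kernel_closed[OF \<beta>(1)])
  obtain U :: "(nat \<Rightarrow> int) \<Rightarrow> real" where
    U: "\<forall>z\<in>diff_states 2. z \<noteq> plane 0 0 \<longrightarrow>
      (\<integral>\<^sup>+y. U y \<partial>measure_pmf (diff_kernel 2 (asymmetric_nbhd 2) \<beta> z)) + 1 \<le> U z"
    using diff_chain_drift[OF \<beta> plane_states[of 0 0]] by blast
  have "AE \<omega> in M. \<forall>t. \<exists>s\<ge>t. differences 2 \<xi> s \<omega> = plane 0 0"
    by (rule AE_visits_point[of "plane 0 0" U]) (use U in blast)
  then show ?thesis
    by eventually_elim (simp add: differences_eq coincidence_iff infinite_nat_iff_unbounded_le conj_commute)
qed

section \<open>Transience for \<open>\<beta> > 1\<close>\<close>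

lemma exp_minus_le_quadratic:
  fixes y :: real
  assumes "\<bar>y\<bar> \<le> 1"
  shows "exp (- y) \<le> 1 - y + y\<^sup>2"
proof (cases "y \<le> 0")
  case True
  then show ?thesis using exp_bound[of "- y"] assms by simp
next
  case False
  have "0 < 1 - y + y\<^sup>2"
    using sum_squares_bound[of y 1] False assms by (auto simp: power2_eq_square)
  \<comment> \<open>For positive \<open>y\<close> the factorisation of 1 + y^3 reduces the claim to
    \<open>1 + y \<le> exp y\<close>.\<close>
  have "1 = (1 + y) * (1 - y + y\<^sup>2) - y ^ 3" by (simp add: algebra_simps power2_eq_square power3_eq_cube)
  then have "1 \<le> (1 + y) * (1 - y + y\<^sup>2)" using False by (smt (verit) zero_le_power)
  also have "\<dots> \<le> exp y * (1 - y + y\<^sup>2)"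
    using \<open>0 < 1 - y + y\<^sup>2\<close> by (intro mult_right_mono exp_ge_add_one_self) auto
  finally show ?thesis by (simp add: exp_minus field_simps)
qed

text \<open>Strict concavity of the logarithm on the chord from 1 to \<open>b\<close>. With
  \<open>w\<close> the point of the chord at parameter \<open>s\<close>, the bound
  \<open>ln x < x - 1\<close> at \<open>b / w\<close> and \<open>1 / w\<close> is averaged with
  weights \<open>s\<close> and \<open>1 - s\<close>; the right-hand sides average to 0.\<close>

lemma mult_ln_less_ln_chord:
  fixes b s :: real
  assumes "1 < b" "0 < s" "s < 1"
  shows "s * ln b < ln (1 + (b - 1) * s)"
proof -
  define w where "w = 1 + (b - 1) * s"
  have w: "1 < w" "w < b"
  proof -
    show "1 < w" unfolding w_def using assms by simp
    have "(b - 1) * s < (b - 1) * 1" using assms by (intro mult_strict_left_mono) auto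
    then show "w < b" unfolding w_def by simp
  qed
  have l: "ln x < x - 1" if "0 < x" "x \<noteq> 1" for x :: real
    using ln_le_minus_one[OF that(1)] ln_eq_minus_one[OF that(1)] that(2) by fastforce
  have "s * ln (b / w) < s * (b / w - 1)" using w assms by (intro mult_strict_left_mono l) auto
  moreover have "(1 - s) * ln (1 / w) < (1 - s) * (1 / w - 1)" using w assms by (intro mult_strict_left_mono l) auto
  moreover have "s * (b / w - 1) + (1 - s) * (1 / w - 1) = (1 + (b - 1) * s) / w - 1"
    using w by (simp add: field_simps)
  then have "s * (b / w - 1) + (1 - s) * (1 / w - 1) = 0" using w unfolding w_def[symmetric] by simp
  moreover have "ln (b / w) = ln b - ln w" "ln (1 / w) = - ln w"
    using w assms by (simp_all add: ln_div)
  ultimately have "s * (ln b - ln w) + (1 - s) * (- ln w) < 0" by simp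
  then show ?thesis unfolding w_def[symmetric] by (simp add: algebra_simps)
qed

lemma mult_ln_le_ln_chord:
  fixes b s :: real
  assumes "1 < b" "0 \<le> s" "s \<le> 1"
  shows "s * ln b \<le> ln (1 + (b - 1) * s)"
  using mult_ln_less_ln_chord[of b s] assms by (cases "s = 0"; cases "s = 1") auto

text \<open>The cyclic predecessor. Site \<open>k\<close> lies in the neighbourhoods of
  \<open>k\<close> and of its predecessor only, so incrementing \<open>k\<close> raises exactly
  these two exponents.\<close>

definition pred_site :: "nat \<Rightarrow> nat \<Rightarrow> nat" where
  "pred_site N k = (if k = 1 then N + 1 else k - 1)"

lemma bij_pred_site: "bij_betw (pred_site N) {1..N+1} {1..N+1}"
  by (rule bij_betw_byWitness[where f' = "\<lambda>k. if k = N + 1 then 1 else k + 1"])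
    (auto simp: pred_site_def)

lemma pred_site_sum: "(\<Sum>k\<in>{1..N+1}. f (pred_site N k)) = (\<Sum>k\<in>{1..N+1}. f k)"
  by (rule sum.reindex_bij_betw[OF bij_pred_site])

lemma pred_site_in: "k \<in> {1..N+1} \<Longrightarrow> pred_site N k \<in> {1..N+1}"
  by (auto simp: pred_site_def)

lemma pred_site_neq: "N \<ge> 1 \<Longrightarrow> k \<in> {1..N+1} \<Longrightarrow> pred_site N k \<noteq> k"
  by (auto simp: pred_site_def)

lemma mem_asymmetric_nbhd:
  "j \<in> {1..N+1} \<Longrightarrow> k \<in> {1..N+1} \<Longrightarrow> k \<in> asymmetric_nbhd N j \<longleftrightarrow> j = k \<or> j = pred_site N k"
  by (auto simp: asymmetric_nbhd_def pred_site_def)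

lemma sum_square_deviation:
  fixes s :: "'a \<Rightarrow> real"
  shows "(\<Sum>k\<in>A. (s k - a)\<^sup>2) = (\<Sum>k\<in>A. (s k)\<^sup>2) + real (card A) * a\<^sup>2 - 2 * a * (\<Sum>k\<in>A. s k)"
  by (simp add: power2_diff sum.distrib sum_subtractf sum_distrib_left sum_distrib_right mult_ac)

text \<open>
  By concavity of the logarithm, the left-hand side is at least
  \<open>ln \<beta> * (\<Sum>k. q k * s k)\<close> with \<open>s k = q k + q (pred_site N k)\<close>, and
  \<open>(\<Sum>k. q k * s k) = (\<Sum>k. (s k)\<^sup>2) / 2 \<ge> 2 / (N + 1)\<close> by Cauchy-Schwarz. The first
  inequality is strict when all \<open>s k\<close> are close to \<open>2 / (N + 1)\<close>, the second one otherwise.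
\<close>

lemma entropy_gain:
  fixes \<beta> :: real
  assumes N: "N \<ge> 2" and \<beta>: "\<beta> > 1"
  shows "\<exists>\<epsilon>>0. \<forall>q. (\<forall>k\<in>{1..N+1}. 0 \<le> q k) \<longrightarrow> (\<Sum>k\<in>{1..N+1}. q k) = 1 \<longrightarrow>
    2 / (real N + 1) * ln \<beta> + \<epsilon> \<le> (\<Sum>k\<in>{1..N+1}. q k * ln (1 + (\<beta> - 1) * (q k + q (pred_site N k))))"
proof -
  define a where "a = 2 / (real N + 1)"
  define h where "h s = ln (1 + (\<beta> - 1) * s) - s * ln \<beta>" for s
  have a: "0 < a" "a \<le> 2 / 3" using N by (auto simp: a_def field_simps)
  \<comment> \<open>As \<open>N \<ge> 2\<close> gives \<open>a \<le> 2 / 3\<close>, the window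
    around the mean \<open>a\<close> ends at 5 / 6 at the latest. It lies inside the open unit
    interval, where \<open>h\<close> is positive, so compactness yields a positive minimum.\<close>
  have "continuous_on {3/4 * a..5/4 * a} h"
    unfolding h_def using a \<beta> by (intro continuous_intros) (auto simp: add_pos_nonneg less_imp_neq[symmetric])
  then obtain s0 where s0: "s0 \<in> {3/4 * a..5/4 * a}" "\<And>s. s \<in> {3/4 * a..5/4 * a} \<Longrightarrow> h s0 \<le> h s"
    using continuous_attains_inf[of "{3/4 * a..5/4 * a}" h] a by auto
  have \<delta>: "0 < h s0"
    using mult_ln_less_ln_chord[OF \<beta>, of s0] s0(1) a by (simp add: h_def)
  define \<epsilon> where "\<epsilon> = min (h s0) (ln \<beta> * ((a / 4)\<^sup>2 / 2))"
  have "0 < \<epsilon>" unfolding \<epsilon>_def using \<delta> a \<beta> by simp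
  moreover have "a * ln \<beta> + \<epsilon> \<le> (\<Sum>k\<in>{1..N+1}. q k * ln (1 + (\<beta> - 1) * (q k + q (pred_site N k))))"
    if q0: "\<And>k. k \<in> {1..N+1} \<Longrightarrow> 0 \<le> q k" and q1: "(\<Sum>k\<in>{1..N+1}. q k) = 1" for q
  proof -
    define s where "s k = q k + q (pred_site N k)" for k
    have s: "0 \<le> s k" "s k \<le> 1" if k: "k \<in> {1..N+1}" for k
    proof -
      note p = pred_site_in[OF k] pred_site_neq[of N, OF _ k]
      show "0 \<le> s k" unfolding s_def using q0 k p by simp
      have "s k = (\<Sum>j\<in>{k, pred_site N k}. q j)" unfolding s_def using p N by (subst sum.insert) auto
      also have "\<dots> \<le> (\<Sum>j\<in>{1..N+1}. q j)" using q0 k p by (intro sum_mono2) auto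
      finally show "s k \<le> 1" using q1 by simp
    qed
    have sum_s: "(\<Sum>k\<in>{1..N+1}. s k) = 2"
      unfolding s_def sum.distrib pred_site_sum using q1 by simp
    have "(\<Sum>k\<in>{1..N+1}. (s k)\<^sup>2) = (\<Sum>k\<in>{1..N+1}. (q k)\<^sup>2) + (\<Sum>k\<in>{1..N+1}. (q (pred_site N k))\<^sup>2) + 2 * (\<Sum>k\<in>{1..N+1}. q k * q (pred_site N k))"
      unfolding s_def by (simp add: power2_sum sum.distrib sum_distrib_left mult.assoc)
    also have "(\<Sum>k\<in>{1..N+1}. (q (pred_site N k))\<^sup>2) = (\<Sum>k\<in>{1..N+1}. (q k)\<^sup>2)"
      by (rule pred_site_sum[of "\<lambda>k. (q k)\<^sup>2"])
    finally have qs: "(\<Sum>k\<in>{1..N+1}. q k * s k) = (\<Sum>k\<in>{1..N+1}. (s k)\<^sup>2) / 2"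
      unfolding s_def by (simp add: distrib_left sum.distrib power2_eq_square)
    have "(\<Sum>k\<in>{1..N+1}. (s k - a)\<^sup>2) = (\<Sum>k\<in>{1..N+1}. (s k)\<^sup>2) + (real N + 1) * a\<^sup>2 - 2 * a * (\<Sum>k\<in>{1..N+1}. s k)"
      unfolding sum_square_deviation by simp
    also have "(real N + 1) * a\<^sup>2 = ((real N + 1) * a) * a" by (simp add: power2_eq_square)
    also have "(real N + 1) * a = 2"
      unfolding a_def times_divide_eq_right by (rule nonzero_mult_div_cancel_left) simp
    \<comment> \<open>Cauchy-Schwarz together with its defect: the excess over \<open>a\<close> is
      half the sum of squared deviations of \<open>s\<close> from its mean \<open>a\<close>.\<close>
    finally have var: "(\<Sum>k\<in>{1..N+1}. q k * s k) = a + (\<Sum>k\<in>{1..N+1}. (s k - a)\<^sup>2) / 2"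
      unfolding qs sum_s by linarith
    have h0: "0 \<le> h (s k)" if "k \<in> {1..N+1}" for k
      using mult_ln_le_ln_chord[OF \<beta> s[OF that]] by (simp add: h_def)
    have eq: "(\<Sum>k\<in>{1..N+1}. q k * ln (1 + (\<beta> - 1) * s k)) = (\<Sum>k\<in>{1..N+1}. q k * h (s k)) + ln \<beta> * (\<Sum>k\<in>{1..N+1}. q k * s k)"
      by (simp add: h_def algebra_simps sum.distrib[symmetric] sum_subtractf sum_distrib_left)
    have "a * ln \<beta> + \<epsilon> \<le> (\<Sum>k\<in>{1..N+1}. q k * h (s k)) + ln \<beta> * (\<Sum>k\<in>{1..N+1}. q k * s k)"
    proof (cases "\<forall>k\<in>{1..N+1}. s k \<in> {3/4 * a..5/4 * a}")
      case True
      have "h s0 = (\<Sum>k\<in>{1..N+1}. q k * h s0)" unfolding sum_distrib_right[symmetric] q1 by simp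
      also have "\<dots> \<le> (\<Sum>k\<in>{1..N+1}. q k * h (s k))"
        using True s0(2) q0 by (intro sum_mono mult_left_mono) auto
      finally have "\<epsilon> \<le> (\<Sum>k\<in>{1..N+1}. q k * h (s k))" unfolding \<epsilon>_def by simp
      moreover have "ln \<beta> * a \<le> ln \<beta> * (\<Sum>k\<in>{1..N+1}. q k * s k)"
        unfolding var using \<beta> sum_nonneg[of "{1..N+1}" "\<lambda>k. (s k - a)\<^sup>2"]
        by (intro mult_left_mono) (simp_all only: zero_le_power2 ln_ge_zero, auto)
      ultimately show ?thesis by (simp add: mult.commute)
    next
      case False
      then obtain j where j: "j \<in> {1..N+1}" "s j \<notin> {3/4 * a..5/4 * a}" by blast
      have "(a / 4)\<^sup>2 \<le> (s j - a)\<^sup>2"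
        using j(2) a by (subst abs_le_square_iff[symmetric]) (auto simp: abs_if)
      also have "\<dots> \<le> (\<Sum>k\<in>{1..N+1}. (s k - a)\<^sup>2)"
        using j(1) by (intro member_le_sum) auto
      finally have "ln \<beta> * (a + (a / 4)\<^sup>2 / 2) \<le> ln \<beta> * (\<Sum>k\<in>{1..N+1}. q k * s k)"
        unfolding var using \<beta> by (intro mult_left_mono) auto
      moreover have "0 \<le> (\<Sum>k\<in>{1..N+1}. q k * h (s k))"
        using q0 h0 by (intro sum_nonneg mult_nonneg_nonneg) auto
      ultimately show ?thesis unfolding \<epsilon>_def by (simp add: algebra_simps)
    qed
    then have "a * ln \<beta> + \<epsilon> \<le> (\<Sum>k\<in>{1..N+1}. q k * ln (1 + (\<beta> - 1) * s k))" unfolding eq .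
    then show ?thesis unfolding s_def .
  qed
  ultimately show ?thesis unfolding a_def by blast
qed

section \<open>The free energy and its exponential moment\<close>

abbreviation rate_exp :: "nat \<Rightarrow> (nat \<Rightarrow> nat) \<Rightarrow> nat \<Rightarrow> nat" where
  "rate_exp N x k \<equiv> \<Sum>j\<in>asymmetric_nbhd N k. x j"

definition total_rate :: "nat \<Rightarrow> real \<Rightarrow> (nat \<Rightarrow> nat) \<Rightarrow> real" where
  "total_rate N \<beta> x = (\<Sum>k\<in>{1..N+1}. \<beta> ^ rate_exp N x k)"

text \<open>Raising all heights by 1 multiplies \<open>total_rate\<close> by \<beta> squared and
  raises the sum of heights by \<open>N + 1\<close>; the coefficient \<open>2 / (N + 1)\<close>
  makes the two effects cancel.\<close>

definition free_energy :: "nat \<Rightarrow> real \<Rightarrow> (nat \<Rightarrow> nat) \<Rightarrow> real" where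
  "free_energy N \<beta> x = ln (total_rate N \<beta> x) - 2 / (real N + 1) * ln \<beta> * (\<Sum>k\<in>{1..N+1}. real (x k))"

lemma total_rate_pos: "\<beta> > 0 \<Longrightarrow> 0 < total_rate N \<beta> x"
  unfolding total_rate_def by (intro sum_pos) auto

lemma finite_asymmetric_nbhd: "finite (asymmetric_nbhd N k)"
  by (simp add: asymmetric_nbhd_def)

lemma rate_exp_step:
  assumes "j \<in> {1..N+1}" "k \<in> {1..N+1}"
  shows "rate_exp N (x(k := x k + 1)) j = rate_exp N x j + (if j = k \<or> j = pred_site N k then 1 else 0)"
proof (cases "k \<in> asymmetric_nbhd N j")
  case True
  have "rate_exp N (x(k := x k + 1)) j = (x k + 1) + (\<Sum>i\<in>asymmetric_nbhd N j - {k}. x i)"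
    using True by (subst sum.remove[OF finite_asymmetric_nbhd True]) auto
  also have "\<dots> = rate_exp N x j + 1"
    using sum.remove[OF finite_asymmetric_nbhd True, of x] by simp
  finally show ?thesis using True mem_asymmetric_nbhd[OF assms] by simp
next
  case False
  then have "rate_exp N (x(k := x k + 1)) j = rate_exp N x j" by (intro sum.cong) auto
  then show ?thesis using False mem_asymmetric_nbhd[OF assms] by simp
qed

lemma total_rate_step:
  assumes k: "k \<in> {1..N+1}" and "N \<ge> 1"
  shows "total_rate N \<beta> (x(k := x k + 1)) =
    total_rate N \<beta> x + (\<beta> - 1) * (\<beta> ^ rate_exp N x k + \<beta> ^ rate_exp N x (pred_site N k))"
proof -
  note p = pred_site_in[OF k] pred_site_neq[OF \<open>N \<ge> 1\<close> k]
  have "total_rate N \<beta> (x(k := x k + 1)) =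
      (\<Sum>j\<in>{1..N+1}. \<beta> ^ rate_exp N x j + (if j \<in> {k, pred_site N k} then (\<beta> - 1) * \<beta> ^ rate_exp N x j else 0))"
    unfolding total_rate_def
    by (intro sum.cong refl, subst rate_exp_step[OF _ k]) (auto simp: algebra_simps)
  also have "\<dots> = total_rate N \<beta> x + (\<Sum>j\<in>{1..N+1} \<inter> {k, pred_site N k}. (\<beta> - 1) * \<beta> ^ rate_exp N x j)"
    unfolding total_rate_def sum.distrib by (subst sum.inter_restrict) auto
  also have "{1..N+1} \<inter> {k, pred_site N k} = {k, pred_site N k}" using k p by auto
  also have "(\<Sum>j\<in>{k, pred_site N k}. (\<beta> - 1) * \<beta> ^ rate_exp N x j) =
      (\<beta> - 1) * (\<beta> ^ rate_exp N x k + \<beta> ^ rate_exp N x (pred_site N k))"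
    using p(2) by (subst sum.insert) (auto simp: distrib_left)
  finally show ?thesis .
qed

text \<open>Some exponent is at least the mean of all of them, and its term alone already makes
  \<open>total_rate\<close> large enough.\<close>

lemma free_energy_nonneg:
  assumes "N \<ge> 1" "\<beta> > 1"
  shows "0 \<le> free_energy N \<beta> x"
proof -
  have "(\<Sum>k\<in>{1..N+1}. rate_exp N x k) = (\<Sum>k\<in>{1..N+1}. rate_exp N x (pred_site N k))"
    by (rule pred_site_sum[symmetric])
  also have "\<dots> = (\<Sum>k\<in>{1..N+1}. x k + x (pred_site N k))"
  proof (rule sum.cong[OF refl])
    fix k assume k: "k \<in> {1..N+1}"
    have "asymmetric_nbhd N (pred_site N k) = {k, pred_site N k}"
      using k assms by (auto simp: asymmetric_nbhd_def pred_site_def)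
    then show "rate_exp N x (pred_site N k) = x k + x (pred_site N k)"
      using pred_site_neq[OF assms(1) k] by simp
  qed
  also have "\<dots> = 2 * (\<Sum>k\<in>{1..N+1}. x k)" unfolding sum.distrib pred_site_sum by simp
  finally have sum: "(\<Sum>k\<in>{1..N+1}. rate_exp N x k) = 2 * (\<Sum>k\<in>{1..N+1}. x k)" .
  define c where "c = 2 * (\<Sum>k\<in>{1..N+1}. real (x k)) / (real N + 1)"
  have "\<exists>k\<in>{1..N+1}. c \<le> real (rate_exp N x k)"
  proof (rule ccontr)
    assume "\<not> ?thesis"
    then have less: "\<And>k. k \<in> {1..N+1} \<Longrightarrow> real (rate_exp N x k) < c" by (meson not_le)
    have "(\<Sum>k\<in>{1..N+1}. real (rate_exp N x k)) < (\<Sum>k\<in>{1..N+1}. c)"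
      by (rule sum_strict_mono) (simp, simp, rule less)
    also have "\<dots> = (real N + 1) * c" by simp
    also have "\<dots> = 2 * (\<Sum>k\<in>{1..N+1}. real (x k))"
      unfolding c_def times_divide_eq_right by (rule nonzero_mult_div_cancel_left) simp
    also have "\<dots> = real (\<Sum>k\<in>{1..N+1}. rate_exp N x k)" unfolding sum by simp
    finally show False by simp
  qed
  then obtain k where k: "k \<in> {1..N+1}" "c \<le> real (rate_exp N x k)" by blast
  have "c * ln \<beta> \<le> real (rate_exp N x k) * ln \<beta>" using k assms by (intro mult_right_mono) auto
  also have "\<dots> = ln (\<beta> ^ rate_exp N x k)" using assms by (simp add: ln_realpow)
  also have "\<dots> \<le> ln (total_rate N \<beta> x)"
  proof (subst ln_le_cancel_iff)
    show "\<beta> ^ rate_exp N x k \<le> total_rate N \<beta> x"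
      unfolding total_rate_def using k assms by (intro member_le_sum) auto
  qed (use assms total_rate_pos in auto)
  finally show ?thesis unfolding free_energy_def c_def by (simp add: mult_ac)
qed

lemma free_energy_contraction:
  assumes N: "N \<ge> 2" and \<beta>: "\<beta> > 1"
  shows "\<exists>\<theta>>0. \<theta> \<le> 1 \<and> (\<exists>c. 0 \<le> c \<and> c < 1 \<and> (\<forall>x.
    (\<Sum>k\<in>{1..N+1}. \<beta> ^ rate_exp N x k / total_rate N \<beta> x * exp (- (\<theta> * free_energy N \<beta> (x(k := x k + 1)))))
      \<le> c * exp (- (\<theta> * free_energy N \<beta> x))))"
proof -
  obtain \<epsilon> where \<epsilon>: "0 < \<epsilon>" and gain: "\<And>q. (\<And>k. k \<in> {1..N+1} \<Longrightarrow> 0 \<le> q k) \<Longrightarrow> (\<Sum>k\<in>{1..N+1}. q k) = 1 \<Longrightarrow>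
    2 / (real N + 1) * ln \<beta> + \<epsilon> \<le> (\<Sum>k\<in>{1..N+1}. q k * ln (1 + (\<beta> - 1) * (q k + q (pred_site N k))))"
    using entropy_gain[OF N \<beta>] by blast
  define B where "B = max 1 (ln \<beta>)"
  have B: "1 \<le> B" "ln \<beta> \<le> B" unfolding B_def by auto
  \<comment> \<open>\<open>B\<close> will bound the increments \<open>D k\<close>. The bound
    \<open>1 / B\<close> keeps \<open>\<theta> * D k\<close> in the range of the quadratic estimate,
    and the second bound lets the quadratic term consume at most half of the gain
    \<epsilon>.\<close>
  define \<theta> where "\<theta> = min (1 / B) (\<epsilon> / (2 * B\<^sup>2))"
  have \<theta>: "0 < \<theta>" "\<theta> * B \<le> 1" "2 * \<theta> * B\<^sup>2 \<le> \<epsilon>"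
  proof -
    show "0 < \<theta>" unfolding \<theta>_def using \<epsilon> B by simp
    have "\<theta> * B \<le> 1 / B * B" unfolding \<theta>_def using B by (intro mult_right_mono) auto
    then show "\<theta> * B \<le> 1" using B by simp
    have "\<theta> * (2 * B\<^sup>2) \<le> \<epsilon> / (2 * B\<^sup>2) * (2 * B\<^sup>2)" unfolding \<theta>_def using B by (intro mult_right_mono) auto
    then show "2 * \<theta> * B\<^sup>2 \<le> \<epsilon>" using B by (simp add: mult_ac)
  qed
  \<comment> \<open>Needed for unlikely steps, where \<open>exp (- free_energy)\<close> is dominated
    by the exponential with factor \<theta>.\<close>
  have \<theta>1: "\<theta> \<le> 1" using \<theta>(1,2) mult_left_mono[OF B(1), of \<theta>] by linarith
  define c where "c = max 0 (1 - \<theta> * \<epsilon> / 2)"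
  have c: "0 \<le> c" "c < 1" "1 - \<theta> * \<epsilon> / 2 \<le> c" unfolding c_def using \<theta> \<epsilon> by auto
  have "(\<Sum>k\<in>{1..N+1}. \<beta> ^ rate_exp N x k / total_rate N \<beta> x * exp (- (\<theta> * free_energy N \<beta> (x(k := x k + 1)))))
      \<le> c * exp (- (\<theta> * free_energy N \<beta> x))" for x
  proof -
    have Z: "0 < total_rate N \<beta> x" using \<beta> by (intro total_rate_pos) simp
    define q where "q k = \<beta> ^ rate_exp N x k / total_rate N \<beta> x" for k
    have q0: "0 \<le> q k" for k unfolding q_def using Z \<beta> by simp
    have q1: "(\<Sum>k\<in>{1..N+1}. q k) = 1"
      unfolding q_def sum_divide_distrib[symmetric] total_rate_def[symmetric] using Z by simp
    define s where "s k = q k + q (pred_site N k)" for k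
    have s: "0 \<le> s k" "s k \<le> 1" if k: "k \<in> {1..N+1}" for k
    proof -
      note p = pred_site_in[OF k] pred_site_neq[of N, OF _ k]
      show "0 \<le> s k" unfolding s_def using q0[of k] q0[of "pred_site N k"] by simp
      have "s k = (\<Sum>j\<in>{k, pred_site N k}. q j)" unfolding s_def using p N by (subst sum.insert) auto
      also have "\<dots> \<le> (\<Sum>j\<in>{1..N+1}. q j)" using q0 k p by (intro sum_mono2) auto
      finally show "s k \<le> 1" using q1 by simp
    qed
    define a where "a = 2 / (real N + 1) * ln \<beta>"
    have a: "0 \<le> a" "a \<le> ln \<beta>"
    proof -
      show "0 \<le> a" unfolding a_def using \<beta> by simp
      have "2 / (real N + 1) * ln \<beta> \<le> 1 * ln \<beta>" using N \<beta> by (intro mult_right_mono) (auto simp: field_simps)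
      then show "a \<le> ln \<beta>" unfolding a_def by simp
    qed
    define D where "D k = ln (1 + (\<beta> - 1) * s k) - a" for k
    have step: "free_energy N \<beta> (x(k := x k + 1)) = free_energy N \<beta> x + D k" if k: "k \<in> {1..N+1}" for k
    proof -
      have pos: "0 < 1 + (\<beta> - 1) * s k" using s[OF k] \<beta> by (intro add_pos_nonneg) auto
      have "total_rate N \<beta> (x(k := x k + 1)) = total_rate N \<beta> x * (1 + (\<beta> - 1) * s k)"
        using N Z by (subst total_rate_step[OF k]) (auto simp: s_def q_def field_simps)
      then have "ln (total_rate N \<beta> (x(k := x k + 1))) = ln (total_rate N \<beta> x) + ln (1 + (\<beta> - 1) * s k)"
        using Z pos by (simp add: ln_mult)
      moreover have "(\<Sum>j\<in>{1..N+1}. real ((x(k := x k + 1)) j)) = (\<Sum>j\<in>{1..N+1}. real (x j)) + 1"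
      proof -
        have "(\<Sum>j\<in>{1..N+1}. real ((x(k := x k + 1)) j)) = (\<Sum>j\<in>{1..N+1}. real (x j) + (if j = k then 1 else 0))"
          by (intro sum.cong) auto
        also have "\<dots> = (\<Sum>j\<in>{1..N+1}. real (x j)) + 1" unfolding sum.distrib using k by (subst sum.delta) auto
        finally show ?thesis .
      qed
      ultimately show ?thesis unfolding free_energy_def D_def a_def by (simp add: distrib_left)
    qed
    have D: "\<bar>D k\<bar> \<le> B" if k: "k \<in> {1..N+1}" for k
    proof -
      have "(\<beta> - 1) * s k \<le> (\<beta> - 1) * 1" using s[OF k] \<beta> by (intro mult_left_mono) auto
      then have "1 + (\<beta> - 1) * s k \<le> \<beta>" by simp
      then have "ln (1 + (\<beta> - 1) * s k) \<le> ln \<beta>"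
        using s[OF k] \<beta> by (subst ln_le_cancel_iff) (auto intro!: add_pos_nonneg)
      moreover have "0 \<le> ln (1 + (\<beta> - 1) * s k)" using s[OF k] \<beta> by (intro ln_ge_zero) auto
      ultimately show ?thesis unfolding D_def using a B by linarith
    qed
    have e: "exp (- (\<theta> * D k)) \<le> 1 - \<theta> * D k + \<theta>\<^sup>2 * B\<^sup>2" if k: "k \<in> {1..N+1}" for k
    proof -
      have "\<bar>\<theta> * D k\<bar> \<le> \<theta> * B" unfolding abs_mult using \<theta>(1) D[OF k] by (simp add: mult_left_mono)
      then have "\<bar>\<theta> * D k\<bar> \<le> 1" using \<theta>(2) by simp
      from exp_minus_le_quadratic[OF this] have "exp (- (\<theta> * D k)) \<le> 1 - \<theta> * D k + \<theta>\<^sup>2 * (D k)\<^sup>2"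
        by (simp add: power_mult_distrib)
      moreover have "\<theta>\<^sup>2 * (D k)\<^sup>2 \<le> \<theta>\<^sup>2 * B\<^sup>2"
        using D[OF k] B by (intro mult_left_mono) (auto simp: abs_le_square_iff[symmetric])
      ultimately show ?thesis by simp
    qed
    have "(\<Sum>k\<in>{1..N+1}. q k * exp (- (\<theta> * free_energy N \<beta> (x(k := x k + 1))))) =
        exp (- (\<theta> * free_energy N \<beta> x)) * (\<Sum>k\<in>{1..N+1}. q k * exp (- (\<theta> * D k)))"
      unfolding sum_distrib_left by (intro sum.cong refl) (simp only: step distrib_left minus_add_distrib exp_add mult_ac)
    also have "\<dots> \<le> exp (- (\<theta> * free_energy N \<beta> x)) * c"
    proof (rule mult_left_mono)
      have "(\<Sum>k\<in>{1..N+1}. q k * exp (- (\<theta> * D k))) \<le> (\<Sum>k\<in>{1..N+1}. q k * (1 - \<theta> * D k + \<theta>\<^sup>2 * B\<^sup>2))"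
        using e q0 by (intro sum_mono mult_left_mono) auto
      also have "\<dots> = (\<Sum>k\<in>{1..N+1}. q k * (1 + \<theta>\<^sup>2 * B\<^sup>2 + \<theta> * a)) - (\<Sum>k\<in>{1..N+1}. \<theta> * (q k * ln (1 + (\<beta> - 1) * s k)))"
        unfolding sum_subtractf[symmetric] D_def by (intro sum.cong refl) (simp add: algebra_simps)
      also have "\<dots> = 1 + \<theta>\<^sup>2 * B\<^sup>2 + \<theta> * a - \<theta> * (\<Sum>k\<in>{1..N+1}. q k * ln (1 + (\<beta> - 1) * s k))"
        unfolding sum_distrib_right[symmetric] sum_distrib_left[symmetric] q1 by simp
      also have "\<dots> \<le> 1 + \<theta>\<^sup>2 * B\<^sup>2 + \<theta> * a - \<theta> * (a + \<epsilon>)"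
        using gain[OF q0 q1] \<theta>(1) unfolding s_def[symmetric] a_def[symmetric]
        by (intro diff_left_mono mult_left_mono) auto
      also have "\<dots> = 1 + \<theta> * (\<theta> * B\<^sup>2) - \<theta> * \<epsilon>" by (simp add: algebra_simps power2_eq_square)
      also have "\<dots> \<le> 1 + \<theta> * (\<epsilon> / 2) - \<theta> * \<epsilon>"
        using \<theta> by (intro diff_right_mono add_left_mono mult_left_mono) auto
      also have "\<dots> \<le> c" using c(3) by (simp add: algebra_simps)
      finally show "(\<Sum>k\<in>{1..N+1}. q k * exp (- (\<theta> * D k))) \<le> c" .
    qed simp
    finally show ?thesis unfolding q_def by (simp add: mult.commute)
  qed
  then show ?thesis using \<theta>(1) \<theta>1 c(1,2) by blast
qed

lemma nn_integral_growth_kernel: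
  assumes "\<beta> > 0" "\<And>y. 0 \<le> h y"
  shows "(\<integral>\<^sup>+y. ennreal (h y) \<partial>measure_pmf (growth_kernel N (asymmetric_nbhd N) \<beta> x)) =
    ennreal (\<Sum>k\<in>{1..N+1}. \<beta> ^ rate_exp N x k / total_rate N \<beta> x * h (x(k := x k + 1)))"
  unfolding growth_kernel_def total_rate_def using assms
  by (intro nn_integral_map_normalized_pmf) auto

text \<open>The mean at time \<open>t\<close> is at most \<open>c ^ t\<close> for every initial law,
  because \<open>f \<le> 1\<close> bounds it at time 0.\<close>

lemma (in countable_chain) AE_summable_of_contraction:
  fixes f :: "'s \<Rightarrow> real"
  assumes f: "\<And>z. 0 \<le> f z" "\<And>z. f z \<le> 1" and c: "0 \<le> c" "c < 1"
    and K: "\<And>z. z \<in> S \<Longrightarrow> (\<integral>\<^sup>+y. f y \<partial>measure_pmf (K z)) \<le> ennreal (c * f z)"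
  shows "(\<Sum>t. \<integral>\<^sup>+\<omega>. f (X t \<omega>) \<partial>M) < \<top>"
    and "AE \<omega> in M. summable (\<lambda>t. f (X t \<omega>))"
proof -
  have meas: "(\<lambda>\<omega>. ennreal (f (X t \<omega>))) \<in> borel_measurable M" for t
    by (rule measurable_compose[OF rv]) simp
  have E: "(\<integral>\<^sup>+\<omega>. f (X t \<omega>) \<partial>M) \<le> ennreal (c ^ t)" for t
  proof (induction t)
    case 0
    have "(\<integral>\<^sup>+\<omega>. f (X 0 \<omega>) \<partial>M) \<le> (\<integral>\<^sup>+\<omega>. 1 \<partial>M)"
      using f by (intro nn_integral_mono) (simp add: ennreal_le_1)
    then show ?case by (simp add: emeasure_space_1)
  next
    case (Suc t)
    have "(\<integral>\<^sup>+\<omega>. f (X (Suc t) \<omega>) \<partial>M) = (\<integral>\<^sup>+\<omega>. (\<integral>\<^sup>+y. f y \<partial>measure_pmf (K (X t \<omega>))) \<partial>M)"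
      by (rule one_step[of t "\<lambda>_ y. ennreal (f y)"]) simp
    also have "\<dots> \<le> (\<integral>\<^sup>+\<omega>. ennreal c * f (X t \<omega>) \<partial>M)"
      using K X_in_S f c by (intro nn_integral_mono) (simp add: ennreal_mult)
    also have "\<dots> = ennreal c * (\<integral>\<^sup>+\<omega>. f (X t \<omega>) \<partial>M)" by (rule nn_integral_cmult[OF meas])
    also have "\<dots> \<le> ennreal c * ennreal (c ^ t)" by (intro mult_left_mono Suc) auto
    also have "\<dots> = ennreal (c ^ Suc t)" using c by (simp add: ennreal_mult)
    finally show ?case .
  qed
  have "(\<Sum>t. \<integral>\<^sup>+\<omega>. f (X t \<omega>) \<partial>M) \<le> (\<Sum>t. ennreal (c ^ t))"
    by (intro suminf_le E summableI)
  also have "\<dots> = ennreal (\<Sum>t. c ^ t)"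
    using c by (intro suminf_ennreal2 summable_geometric) auto
  finally show fin: "(\<Sum>t. \<integral>\<^sup>+\<omega>. f (X t \<omega>) \<partial>M) < \<top>" by (simp add: le_less_trans)
  have "(\<integral>\<^sup>+\<omega>. (\<Sum>t. ennreal (f (X t \<omega>))) \<partial>M) \<noteq> \<infinity>"
    using fin by (subst nn_integral_suminf[OF meas]) auto
  then have "AE \<omega> in M. (\<Sum>t. ennreal (f (X t \<omega>))) \<noteq> \<infinity>"
    by (rule nn_integral_PInf_AE[rotated]) (intro borel_measurable_suminf_order meas)
  then show "AE \<omega> in M. summable (\<lambda>t. f (X t \<omega>))"
    by eventually_elim (intro summable_suminf_not_top f, simp)
qed

text \<open>All heights are within \<open>R\<close> of the last one, \<open>y\<close>: exponents are
  at most \<open>2 * y + 2 * R\<close>, and the sum of heights is at least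
  \<open>(N + 1) * (y - R)\<close>. In the free energy \<open>y\<close> cancels and
  \<open>4 * R\<close> remains. Hence large free energy forces a large norm.\<close>

lemma free_energy_le_L2_set:
  assumes N: "N \<ge> 1" and \<beta>: "\<beta> > 1"
  shows "free_energy N \<beta> x \<le> ln (real N + 1) + 4 * ln \<beta> * L2_set (\<lambda>i. real_of_int (diff_map N x i)) {1..N}"
proof -
  define R where "R = L2_set (\<lambda>i. real_of_int (diff_map N x i)) {1..N}"
  define y where "y = real (x (N + 1))"
  have R0: "0 \<le> R" unfolding R_def by (rule L2_set_nonneg)
  have d: "\<bar>real (x i) - y\<bar> \<le> R" if "i \<in> {1..N+1}" for i
  proof (cases "i = N + 1")
    case True
    then show ?thesis using R0 by (simp add: y_def)
  next
    case False
    then have i: "i \<in> {1..N}" using that by auto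
    have "\<bar>real_of_int (diff_map N x i)\<bar> \<le> L2_set (\<lambda>i. \<bar>real_of_int (diff_map N x i)\<bar>) {1..N}"
      using i by (intro member_le_L2_set) auto
    also have "\<dots> = R" unfolding R_def L2_set_def by simp
    finally show ?thesis using i by (simp add: diff_map_def y_def)
  qed
  have "\<beta> ^ rate_exp N x k \<le> \<beta> powr (2 * y + 2 * R)" if k: "k \<in> {1..N+1}" for k
  proof -
    have sub: "asymmetric_nbhd N k \<subseteq> {1..N+1}" using k by (auto simp: asymmetric_nbhd_def)
    have "real (rate_exp N x k) \<le> (\<Sum>j\<in>asymmetric_nbhd N k. y + R)"
      unfolding of_nat_sum
    proof (rule sum_mono)
      fix j assume "j \<in> asymmetric_nbhd N k"
      then have "j \<in> {1..N+1}" using sub by blast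
      from d[OF this] show "real (x j) \<le> y + R" by (simp add: abs_le_iff)
    qed
    also have "\<dots> = 2 * y + 2 * R" using N by (auto simp: asymmetric_nbhd_def card_insert_if)
    finally show ?thesis using \<beta> by (simp add: powr_realpow[symmetric])
  qed
  then have "total_rate N \<beta> x \<le> (\<Sum>k\<in>{1..N+1}. \<beta> powr (2 * y + 2 * R))"
    unfolding total_rate_def by (intro sum_mono)
  also have "\<dots> = (real N + 1) * \<beta> powr (2 * y + 2 * R)" by (simp add: add.commute)
  finally have "ln (total_rate N \<beta> x) \<le> ln ((real N + 1) * \<beta> powr (2 * y + 2 * R))"
    using total_rate_pos[of \<beta> N x] \<beta> by (intro ln_mono) auto
  also have "\<dots> = ln (real N + 1) + (2 * y + 2 * R) * ln \<beta>"
    using \<beta> by (subst ln_mult) (auto simp: ln_powr)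
  finally have 1: "ln (total_rate N \<beta> x) \<le> ln (real N + 1) + (2 * y + 2 * R) * ln \<beta>" .
  have "(real N + 1) * (y - R) = (\<Sum>k\<in>{1..N+1}. y - R)" by (simp add: add.commute)
  also have "\<dots> \<le> (\<Sum>k\<in>{1..N+1}. real (x k))"
  proof (rule sum_mono)
    fix k assume "k \<in> {1..N+1}"
    from d[OF this] show "y - R \<le> real (x k)" by (simp add: abs_le_iff)
  qed
  finally have "2 / (real N + 1) * ln \<beta> * ((real N + 1) * (y - R)) \<le> 2 / (real N + 1) * ln \<beta> * (\<Sum>k\<in>{1..N+1}. real (x k))"
    using \<beta> by (intro mult_left_mono) simp_all
  moreover have "2 / m * l * (m * v) = 2 * l * v" if "m \<noteq> 0" for m l v :: real using that by simp
  then have "2 / (real N + 1) * ln \<beta> * ((real N + 1) * (y - R)) = 2 * ln \<beta> * (y - R)" by simp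
  ultimately have "2 * ln \<beta> * (y - R) \<le> 2 / (real N + 1) * ln \<beta> * (\<Sum>k\<in>{1..N+1}. real (x k))" by simp
  moreover have "(2 * y + 2 * R) * ln \<beta> = 2 * ln \<beta> * (y - R) + 4 * ln \<beta> * R" by (simp add: algebra_simps)
  ultimately show ?thesis using 1 unfolding free_energy_def R_def[symmetric] by linarith
qed

text \<open>Summability along paths drives the free energy to infinity; summability of the means
  controls the probabilities of unlikely steps.\<close>

lemma AE_free_energy:
  assumes N: "N \<ge> 2" and \<beta>: "\<beta> > 1" and \<xi>: "growth_process M N (asymmetric_nbhd N) \<beta> \<xi>"
  obtains \<theta> where "0 < \<theta>" "\<theta> \<le> 1" "(\<Sum>t. \<integral>\<^sup>+\<omega>. exp (- (\<theta> * free_energy N \<beta> (\<xi> t \<omega>))) \<partial>M) < \<top>"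
    "AE \<omega> in M. summable (\<lambda>t. exp (- (\<theta> * free_energy N \<beta> (\<xi> t \<omega>))))"
proof -
  have \<beta>0: "\<beta> > 0" using \<beta> by simp
  interpret countable_chain M "growth_states N" "growth_kernel N (asymmetric_nbhd N) \<beta>" \<xi>
    by (rule growth_process_countable_chain[OF \<xi> \<beta>0])
  obtain \<theta> c where \<theta>: "0 < \<theta>" "\<theta> \<le> 1" and c: "0 \<le> c" "c < 1" and con: "\<And>x.
    (\<Sum>k\<in>{1..N+1}. \<beta> ^ rate_exp N x k / total_rate N \<beta> x * exp (- (\<theta> * free_energy N \<beta> (x(k := x k + 1)))))
      \<le> c * exp (- (\<theta> * free_energy N \<beta> x))"
    using free_energy_contraction[OF N \<beta>] by blast
  let ?f = "\<lambda>x. exp (- (\<theta> * free_energy N \<beta> x))"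
  have f: "0 \<le> ?f x" "?f x \<le> 1" for x
    using \<theta>(1) free_energy_nonneg[of N \<beta> x] N \<beta> by simp_all
  have K: "(\<integral>\<^sup>+y. ?f y \<partial>measure_pmf (growth_kernel N (asymmetric_nbhd N) \<beta> x)) \<le> ennreal (c * ?f x)" for x
    by (subst nn_integral_growth_kernel[OF \<beta>0]) (simp, intro ennreal_leI con)
  show thesis
    by (rule that[OF \<theta> AE_summable_of_contraction(1)[OF f c K] AE_summable_of_contraction(2)[OF f c K]])
qed

lemma growth_transient:
  assumes N: "N \<ge> 2" and \<beta>: "\<beta> > 1" and \<xi>: "growth_process M N (asymmetric_nbhd N) \<beta> \<xi>"
  shows "AE \<omega> in M. filterlim (\<lambda>t. L2_set (\<lambda>i. real_of_int (differences N \<xi> t \<omega> i)) {1..N}) at_top sequentially"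
proof -
  obtain \<theta> where \<theta>: "0 < \<theta>" and ae: "AE \<omega> in M. summable (\<lambda>t. exp (- (\<theta> * free_energy N \<beta> (\<xi> t \<omega>))))"
    by (rule AE_free_energy[OF assms])
  from ae show ?thesis
  proof eventually_elim
    fix \<omega> assume "summable (\<lambda>t. exp (- (\<theta> * free_energy N \<beta> (\<xi> t \<omega>))))"
    then have lim: "(\<lambda>t. exp (- (\<theta> * free_energy N \<beta> (\<xi> t \<omega>)))) \<longlonglongrightarrow> 0" by (rule summable_LIMSEQ_zero)
    show "filterlim (\<lambda>t. L2_set (\<lambda>i. real_of_int (differences N \<xi> t \<omega> i)) {1..N}) at_top sequentially"
      unfolding filterlim_at_top
    proof
      fix C :: real
      have "\<forall>\<^sub>F t in sequentially. exp (- (\<theta> * free_energy N \<beta> (\<xi> t \<omega>))) < exp (- (\<theta> * (ln (real N + 1) + 4 * ln \<beta> * C)))"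
        using lim by (rule order_tendstoD) simp
      then show "\<forall>\<^sub>F t in sequentially. C \<le> L2_set (\<lambda>i. real_of_int (differences N \<xi> t \<omega> i)) {1..N}"
      proof eventually_elim
        fix t assume "exp (- (\<theta> * free_energy N \<beta> (\<xi> t \<omega>))) < exp (- (\<theta> * (ln (real N + 1) + 4 * ln \<beta> * C)))"
        then have "ln (real N + 1) + 4 * ln \<beta> * C < free_energy N \<beta> (\<xi> t \<omega>)" using \<theta> by simp
        also have "\<dots> \<le> ln (real N + 1) + 4 * ln \<beta> * L2_set (\<lambda>i. real_of_int (differences N \<xi> t \<omega> i)) {1..N}"
          using free_energy_le_L2_set[of N \<beta> "\<xi> t \<omega>"] N \<beta> by (simp add: differences_eq)
        finally show "C \<le> L2_set (\<lambda>i. real_of_int (differences N \<xi> t \<omega> i)) {1..N}" using \<beta> by simp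
      qed
    qed
  qed
qed

section \<open>Clockwise spirals\<close>

text \<open>
  Cells are the half-axes (\<open>n\<close> even) and open quadrants (\<open>n\<close> odd) in clockwise order, starting
  with the positive first half-axis; \<open>cell n\<close> depends only on \<open>n mod 8\<close>.
\<close>

fun cell :: "nat \<Rightarrow> int \<Rightarrow> int \<Rightarrow> bool" where
  "cell 0 a b \<longleftrightarrow> 0 < a \<and> b = 0"
| "cell (Suc 0) a b \<longleftrightarrow> 0 < a \<and> b < 0"
| "cell (Suc (Suc n)) a b \<longleftrightarrow> cell n (- b) a"

text \<open>Not reduced modulo a full turn: \<open>n\<close> and \<open>n + 8\<close> name the same
  cell, but their angles differ by \<open>2 * pi\<close>, so \<open>n\<close> also records
  revolutions.\<close>

definition cell_angles :: "nat \<Rightarrow> real set" where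
  "cell_angles n = (if even n then {pi * real n / 4} else {pi * (real n - 1) / 4 <..< pi * (real n + 1) / 4})"

lemma cell_add_8: "cell (n + 8) a b = cell n a b"
  by (simp add: numeral_eq_Suc)

lemma cell_mod_8: "cell (n mod 8) a b = cell n a b"
proof -
  have "cell (m + 8 * k) a b = cell m a b" for m k
  proof (induction k)
    case (Suc k)
    have e: "m + 8 * Suc k = (m + 8 * k) + 8" by simp
    show ?case unfolding e cell_add_8 by (rule Suc)
  qed simp
  from this[of "n mod 8" "n div 8"] show ?thesis by simp
qed

lemma cell_cover: "a \<noteq> 0 \<or> b \<noteq> 0 \<Longrightarrow> \<exists>n<8. cell n a b"
proof -
  assume "a \<noteq> 0 \<or> b \<noteq> 0"
  then have "cell 0 a b \<or> cell 1 a b \<or> cell 2 a b \<or> cell 3 a b \<or> cell 4 a b \<or> cell 5 a b \<or> cell 6 a b \<or> cell 7 a b"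
    by (simp add: numeral_eq_Suc) linarith
  then show ?thesis by (elim disjE) (rule exI, erule conjI[rotated], simp)+
qed

lemma cell_nonzero: "cell n a b \<Longrightarrow> Complex (of_int a) (of_int b) \<noteq> 0"
  by (induction n a b rule: cell.induct) (auto simp: complex_eq_iff)

text \<open>Only the first two cells are computed. Multiplication by the imaginary unit is a
  counterclockwise quarter turn; it carries cell \<open>n + 2\<close> to cell \<open>n\<close> and
  lowers the clockwise angle by \<open>pi / 2\<close>.\<close>

lemma cell_angle:
  assumes "cell n a b"
  shows "\<exists>\<alpha>\<in>cell_angles n. Complex (of_int a) (of_int b) = of_real (cmod (Complex (of_int a) (of_int b))) * cis (- \<alpha>)"
  using assms
proof (induction n a b rule: cell.induct)
  case (1 a b)
  then have "Complex (of_int a) (of_int b) = of_real (of_int a)" "0 < a" by (auto simp: complex_eq_iff)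
  then show ?case by (simp add: cell_angles_def)
next
  case (2 a b)
  define z where "z = Complex (of_int a) (of_int b)"
  have z: "z \<noteq> 0" "0 < Re z" "Im z < 0" unfolding z_def using 2 by (auto simp: complex_eq_iff)
  have "\<bar>Im (Ln z)\<bar> < pi / 2" using Re_Ln_pos_lt[OF z(1)] z(2) by simp
  moreover have "Im (Ln z) < 0" using Im_Ln_pos_le[OF z(1)] z(3) Im_Ln_le_pi[OF z(1)] by auto
  ultimately have "- Arg z \<in> cell_angles (Suc 0)"
    unfolding Arg_eq_Im_Ln[OF z(1)] cell_angles_def by auto
  moreover have "z = of_real (cmod z) * cis (- (- Arg z))"
    using Arg_eq[OF z(1)] by (simp add: cis_conv_exp mult.commute)
  ultimately show ?case unfolding z_def by blast
next
  case (3 n a b)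
  then obtain \<alpha> where \<alpha>: "\<alpha> \<in> cell_angles n"
    and eq: "Complex (of_int (- b)) (of_int a) = of_real (cmod (Complex (of_int (- b)) (of_int a))) * cis (- \<alpha>)" by auto
  have rot: "Complex (of_int (- b)) (of_int a) = \<i> * Complex (of_int a) (of_int b)" by (simp add: complex_eq_iff)
  have "\<alpha> + pi / 2 \<in> cell_angles (Suc (Suc n))"
    using \<alpha> by (auto simp: cell_angles_def field_simps split: if_splits)
  moreover have "cis (- (\<alpha> + pi / 2)) = - \<i> * cis (- \<alpha>)"
  proof -
    have "cis (- (\<alpha> + pi / 2)) = cis (- (pi / 2)) * cis (- \<alpha>)"
      unfolding cis_mult by (rule arg_cong[where f = cis]) simp
    moreover have "cis (- (pi / 2)) = - \<i>" by (simp add: complex_eq_iff)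
    ultimately show ?thesis by (simp only:)
  qed
  moreover have "Complex (of_int a) (of_int b) = - \<i> * (\<i> * Complex (of_int a) (of_int b))"
    by (simp add: complex_eq_iff)
  moreover have "cmod (\<i> * Complex (of_int a) (of_int b)) = cmod (Complex (of_int a) (of_int b))"
    by (simp add: norm_mult)
  ultimately show ?case using eq unfolding rot
    by (intro bexI[of _ "\<alpha> + pi / 2"]) (metis mult.left_commute)
qed

lemma ex_clockwise_angle: "\<exists>\<phi>. clockwise_angle z \<phi>"
proof -
  let ?P = "\<lambda>t x. z t = of_real (cmod (z t)) * cis (- x)"
  have arg: "?P t (- Arg (z t))" for t
    by (cases "z t = 0") (auto simp: cis_conv_exp mult.commute dest: Arg_eq)
  have "\<exists>\<phi>. \<forall>t. ?P t (\<phi> t) \<and> \<bar>\<phi> (Suc t) - \<phi> t\<bar> \<le> pi"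
  proof (rule dependent_nat_choice)
    show "\<exists>x. ?P 0 x" using arg by blast
    fix x :: real and t
    \<comment> \<open>Rounding selects the multiple of \<open>2 * pi\<close> that puts the next
      angle within half a turn of the previous one.\<close>
    define k where "k = round ((x + Arg (z (Suc t))) / (2 * pi))"
    define y where "y = - Arg (z (Suc t)) + 2 * pi * of_int k"
    have "cis (- y) = cis (- (- Arg (z (Suc t))))"
      unfolding y_def using sin_cos_eq_iff[of "- (- Arg (z (Suc t)) + 2 * pi * of_int k)" "Arg (z (Suc t))"]
      by (auto simp: complex_eq_iff intro!: exI[of _ "- k"])
    then have "?P (Suc t) y" using arg[of "Suc t"] by simp
    moreover have "\<bar>y - x\<bar> \<le> pi"
    proof -
      have "\<bar>of_int k - (x + Arg (z (Suc t))) / (2 * pi)\<bar> \<le> 1 / 2"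
        unfolding k_def by (rule of_int_round_abs_le)
      then have "\<bar>2 * pi * (of_int k - (x + Arg (z (Suc t))) / (2 * pi))\<bar> \<le> 2 * pi * (1 / 2)"
        unfolding abs_mult by (intro mult_mono) auto
      moreover have "2 * pi * (of_int k - (x + Arg (z (Suc t))) / (2 * pi)) = y - x"
        unfolding y_def by (simp add: right_diff_distrib)
      ultimately show ?thesis by simp
    qed
    ultimately show "\<exists>y. ?P (Suc t) y \<and> \<bar>y - x\<bar> \<le> pi" by blast
  qed
  then show ?thesis unfolding clockwise_angle_def by blast
qed

lemma multiple_of_half_pi_iff:
  assumes "\<alpha> \<in> cell_angles n"
  shows "(\<exists>k::int. 2 * pi * of_int k0 + \<alpha> = pi * of_int k / 2) \<longleftrightarrow> even n"
proof
  assume "even n"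
  then obtain m where "n = 2 * m" by blast
  then have "2 * pi * of_int k0 + \<alpha> = pi * of_int (4 * k0 + int m) / 2"
    using assms by (simp add: cell_angles_def algebra_simps)
  then show "\<exists>k::int. 2 * pi * of_int k0 + \<alpha> = pi * of_int k / 2" by blast
next
  assume "\<exists>k::int. 2 * pi * of_int k0 + \<alpha> = pi * of_int k / 2"
  then obtain k :: int where k: "\<alpha> = pi * of_int (k - 4 * k0) / 2" by (auto simp: algebra_simps)
  show "even n"
  proof (rule ccontr)
    assume "odd n"
    then obtain m where m: "n = 2 * m + 1" by (blast elim: oddE)
    have "pi * real m / 2 < \<alpha>" "\<alpha> < pi * (real m + 1) / 2"
      using assms by (auto simp: cell_angles_def m algebra_simps)
    then have "pi * real m < pi * of_int (k - 4 * k0)" "pi * of_int (k - 4 * k0) < pi * (real m + 1)"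
      unfolding k by auto
    then have "real m < of_int (k - 4 * k0)" "of_int (k - 4 * k0) < real m + 1"
      using pi_gt_zero by (simp_all only: mult_less_cancel_left_pos)
    then have "int m < k - 4 * k0" "k - 4 * k0 < int m + 1" by linarith+
    then show False by simp
  qed
qed

text \<open>In one step the angle prescribed by the counter \<open>n\<close> changes by at most
  \<open>pi / 2\<close> and the true angle by at most \<open>pi\<close>. Their difference is a
  multiple of \<open>2 * pi\<close>, so it stays constant and the true angle follows the counter.
  The axis time with index \<open>j\<close> is then the first time from \<open>T\<close> on at which
  the counter is \<open>2 * j\<close>.\<close>

lemma spiral_of_cell_count:
  fixes a b :: "nat \<Rightarrow> int" and n :: "nat \<Rightarrow> nat"
  defines "z \<equiv> \<lambda>t. Complex (of_int (a t)) (of_int (b t))"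
  assumes lim: "filterlim (\<lambda>t. cmod (z t)) at_top sequentially"
    and cell: "\<And>t. T \<le> t \<Longrightarrow> cell (n t) (a t) (b t)"
    and step: "\<And>t. T \<le> t \<Longrightarrow> n (Suc t) = n t \<or> n (Suc t) = Suc (n t)"
    and unbounded: "\<And>k. \<exists>t\<ge>T. k \<le> n t"
    and start: "n T = 0"
  shows "essentially_clockwise_spiral z"
proof -
  obtain \<phi> where \<phi>: "clockwise_angle z \<phi>" using ex_clockwise_angle by blast
  have polar: "z t = of_real (cmod (z t)) * cis (- \<phi> t)" for t using \<phi> by (simp add: clockwise_angle_def)
  have nz: "z t \<noteq> 0" if "T \<le> t" for t unfolding z_def by (rule cell_nonzero[OF cell[OF that]])
  have jump: "\<bar>\<phi> (Suc t) - \<phi> t\<bar> \<le> pi" if "T \<le> t" for t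
    using \<phi> nz[OF that] nz[of "Suc t"] that unfolding clockwise_angle_def by simp
  have ang: "\<exists>\<alpha>\<in>cell_angles (n t). \<exists>l::int. \<phi> t = 2 * pi * of_int l + \<alpha>" if t: "T \<le> t" for t
  proof -
    obtain \<alpha> where \<alpha>: "\<alpha> \<in> cell_angles (n t)" "z t = of_real (cmod (z t)) * cis (- \<alpha>)"
      using cell_angle[OF cell[OF t]] unfolding z_def by blast
    have "of_real (cmod (z t)) * cis (- \<phi> t) = of_real (cmod (z t)) * cis (- \<alpha>)"
      using polar[of t] \<alpha>(2) by simp
    then have "cis (- \<phi> t) = cis (- \<alpha>)" using nz[OF t] by simp
    then have "sin (\<phi> t) = sin \<alpha> \<and> cos (\<phi> t) = cos \<alpha>" by (simp add: complex_eq_iff)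
    then obtain l :: int where "\<phi> t = \<alpha> + 2 * pi * of_int l" unfolding sin_cos_eq_iff by blast
    then show ?thesis using \<alpha>(1) by (intro bexI[of _ \<alpha>] exI[of _ l]) auto
  qed
  obtain k0 :: int where k0: "\<phi> T = 2 * pi * of_int k0"
    using ang[of T] start by (auto simp: cell_angles_def)
  have main: "\<exists>\<alpha>\<in>cell_angles (n t). \<phi> t = 2 * pi * of_int k0 + \<alpha>" if "T \<le> t" for t
    using that
  proof (induction t rule: dec_induct)
    case base
    show ?case using k0 start by (simp add: cell_angles_def)
  next
    case (step t)
    obtain \<alpha> where \<alpha>: "\<alpha> \<in> cell_angles (n t)" "\<phi> t = 2 * pi * of_int k0 + \<alpha>" using step.IH by blast
    obtain \<alpha>' and l :: int where \<alpha>': "\<alpha>' \<in> cell_angles (n (Suc t))" "\<phi> (Suc t) = 2 * pi * of_int l + \<alpha>'"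
      using ang[of "Suc t"] step.hyps by force
    have "\<alpha>' - \<alpha> \<le> pi / 2 \<and> \<alpha> - \<alpha>' \<le> pi / 2"
      using assms(4)[OF step.hyps(1)] \<alpha>(1) \<alpha>'(1)
      by (auto simp: cell_angles_def field_simps split: if_splits)
    then have "\<bar>\<alpha>' - \<alpha>\<bar> \<le> pi / 2" by (intro abs_leI) simp_all
    moreover have "\<bar>(2 * pi * of_int l + \<alpha>') - (2 * pi * of_int k0 + \<alpha>)\<bar> \<le> pi"
      using jump[OF step.hyps(1)] \<alpha>(2) \<alpha>'(2) by simp
    ultimately have "\<bar>2 * pi * of_int l - 2 * pi * of_int k0\<bar> \<le> 3 / 2 * pi" by linarith
    also have "2 * pi * of_int l - 2 * pi * of_int k0 = pi * of_int (2 * (l - k0))" by (simp add: algebra_simps)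
    also have "\<bar>pi * of_int (2 * (l - k0))\<bar> = pi * of_int \<bar>2 * (l - k0)\<bar>" by (simp add: abs_mult)
    finally have "of_int \<bar>2 * (l - k0)\<bar> \<le> (3 / 2 :: real)" using pi_gt_zero by (simp add: mult.commute)
    then have "\<bar>2 * (l - k0)\<bar> \<le> 1" by linarith
    then have "l = k0" by arith
    then show ?case using \<alpha>' by blast
  qed
  have mono: "n s \<le> n t" if "T \<le> s" "s \<le> t" for s t
    using that(2)
  proof (induction t rule: dec_induct)
    case (step t)
    then show ?case using assms(4)[of t] that(1) by force
  qed simp
  have axis: "(\<exists>k::int. \<phi> t = pi * of_int k / 2) \<longleftrightarrow> even (n t)" if t: "T \<le> t" for t
  proof -
    obtain \<alpha> where "\<alpha> \<in> cell_angles (n t)" "\<phi> t = 2 * pi * of_int k0 + \<alpha>" using main[OF t] by blast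
    then show ?thesis using multiple_of_half_pi_iff[of \<alpha> "n t" k0] by (simp only:)
  qed
  have even: "\<phi> t = 2 * pi * of_int k0 + pi * real (n t) / 4" if "T \<le> t" "even (n t)" for t
    using main[OF that(1)] that(2) by (auto simp: cell_angles_def)
  have times: "T \<le> axis_time \<phi> T j \<and> n (axis_time \<phi> T j) = 2 * j \<and> new_axis_times \<phi> (axis_time \<phi> T j) \<noteq> {}" for j
  proof -
    have next_axis: "T \<le> Inf (new_axis_times \<phi> s) \<and> n (Inf (new_axis_times \<phi> s)) = 2 * j + 2 \<and> new_axis_times \<phi> s \<noteq> {}"
      if s: "T \<le> s" "n s = 2 * j" for s j
    proof -
      \<comment> \<open>The counter grows by at most 1, so when it first reaches
        \<open>2 * j + 2\<close> it equals it. Before that it is \<open>2 * j\<close>, the half-axis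
        already met, or odd, an open quadrant.\<close>
      define u where "u = (LEAST t. s \<le> t \<and> 2 * j + 2 \<le> n t)"
      obtain t where "T \<le> t" "2 * j + 2 \<le> n t" using unbounded by blast
      then have "s \<le> max s t \<and> 2 * j + 2 \<le> n (max s t)"
        using mono[of t "max s t"] by simp
      then have u: "s \<le> u" "2 * j + 2 \<le> n u" unfolding u_def by (metis (mono_tags, lifting) LeastI)+
      have least: "u \<le> t" if "s \<le> t" "2 * j + 2 \<le> n t" for t unfolding u_def using that by (intro Least_le) simp
      have "s < u" using u s by (cases "s = u") auto
      then obtain v where v: "u = Suc v" "s \<le> v" by (metis less_eq_Suc_le Suc_le_D Suc_le_mono)
      have "n v < 2 * j + 2" using least[of v] v by (cases "2 * j + 2 \<le> n v") auto
      then have nu: "n u = 2 * j + 2" using u assms(4)[of v] s v by auto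
      have mem: "t \<in> new_axis_times \<phi> s \<longleftrightarrow> s < t \<and> even (n t) \<and> n t \<noteq> 2 * j" if "s \<le> t" for t
      proof -
        have "T \<le> t" using s that by simp
        show ?thesis
        proof (cases "even (n t)")
          case True
          then show ?thesis using even[OF \<open>T \<le> t\<close>] even[OF s(1)] s(2) axis[OF \<open>T \<le> t\<close>]
            by (auto simp: new_axis_times_def)
        next
          case False
          then show ?thesis using axis[OF \<open>T \<le> t\<close>] by (auto simp: new_axis_times_def)
        qed
      qed
      have "u \<in> new_axis_times \<phi> s" using mem[OF u(1)] nu \<open>s < u\<close> by simp
      moreover have "u \<le> t" if t: "t \<in> new_axis_times \<phi> s" for t
      proof -
        have "s \<le> t" using t by (simp add: new_axis_times_def)
        then have "even (n t)" "n t \<noteq> 2 * j" "2 * j \<le> n t" using t mem[of t] mono[OF s(1), of t] s(2) by auto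
        then have "2 * j + 2 \<le> n t" by presburger
        then show ?thesis by (rule least[OF \<open>s \<le> t\<close>])
      qed
      ultimately have "Inf (new_axis_times \<phi> s) = u" by (rule cInf_eq_minimum)
      then show ?thesis using \<open>u \<in> new_axis_times \<phi> s\<close> nu u(1) s(1) by auto
    qed
    have "T \<le> axis_time \<phi> T j \<and> n (axis_time \<phi> T j) = 2 * j"
    proof (induction j)
      case 0
      show ?case using start by simp
    next
      case (Suc j)
      then show ?case using next_axis[of "axis_time \<phi> T j" j] by simp
    qed
    then show ?thesis using next_axis by blast
  qed
  have "\<phi> (axis_time \<phi> T j) = 2 * pi * of_int k0 + pi * real j / 2" for j
    using times[of j] even[of "axis_time \<phi> T j"] by simp
  then show ?thesis
    unfolding essentially_clockwise_spiral_def using lim \<phi> nz k0 times by blast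
qed

text \<open>Local information about eight cells is lifted to an unreduced counter, which never
  decreases and is unbounded because no cell is kept forever.\<close>

lemma spiral_criterion:
  fixes a b :: "nat \<Rightarrow> int"
  defines "z \<equiv> \<lambda>t. Complex (of_int (a t)) (of_int (b t))"
  assumes lim: "filterlim (\<lambda>t. cmod (z t)) at_top sequentially"
    and nz: "\<And>t. T \<le> t \<Longrightarrow> a t \<noteq> 0 \<or> b t \<noteq> 0"
    and step: "\<And>t r. T \<le> t \<Longrightarrow> r < 8 \<Longrightarrow> cell r (a t) (b t) \<Longrightarrow>
      cell r (a (Suc t)) (b (Suc t)) \<or> cell (Suc r) (a (Suc t)) (b (Suc t))"
    and leave: "\<And>r t. r < 8 \<Longrightarrow> \<exists>s\<ge>t. \<not> cell r (a s) (b s)"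
  shows "essentially_clockwise_spiral z"
proof -
  have step': "cell r (a (Suc t)) (b (Suc t)) \<or> cell (Suc r) (a (Suc t)) (b (Suc t))"
    if "T \<le> t" "cell r (a t) (b t)" for t r
  proof -
    have "cell (Suc (r mod 8)) (a (Suc t)) (b (Suc t)) = cell (Suc r) (a (Suc t)) (b (Suc t))"
      by (subst (1 2) cell_mod_8[symmetric]) (simp add: mod_Suc_eq)
    then show ?thesis using step[of t "r mod 8"] that by (simp add: cell_mod_8)
  qed
  have "\<exists>f. \<forall>k. cell (f k) (a (T + k)) (b (T + k)) \<and> (f (Suc k) = f k \<or> f (Suc k) = Suc (f k))"
  proof (rule dependent_nat_choice)
    show "\<exists>r. cell r (a (T + 0)) (b (T + 0))" using cell_cover nz[of T] by fastforce
    show "\<exists>r'. cell r' (a (T + Suc k)) (b (T + Suc k)) \<and> (r' = r \<or> r' = Suc r)"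
      if "cell r (a (T + k)) (b (T + k))" for r k
      using step'[of "T + k" r] that by auto
  qed
  then obtain f where f: "\<And>k. cell (f k) (a (T + k)) (b (T + k))"
    and fs: "\<And>k. f (Suc k) = f k \<or> f (Suc k) = Suc (f k)" by blast
  have mono: "f j \<le> f k" if "j \<le> k" for j k
    using that by (rule lift_Suc_mono_le[rotated]) (metis fs le_refl le_SucI)
  have inc: "\<exists>k\<ge>j. f j < f k" for j
  proof (rule ccontr)
    assume "\<not> ?thesis"
    then have const: "f k = f j" if "j \<le> k" for k using mono[OF that] that by (meson le_antisym not_less)
    have cell: "cell (f j) (a (T + k)) (b (T + k))" if "j \<le> k" for k
      using f[of k] unfolding const[OF that] .
    have "f j mod 8 < 8" by simp
    from leave[OF this, of "T + j", unfolded cell_mod_8] obtain s where s: "T + j \<le> s" "\<not> cell (f j) (a s) (b s)" by blast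
    have "j \<le> s - T" "T + (s - T) = s" using s(1) by simp_all
    then show False using cell[of "s - T"] s(2) by metis
  qed
  have unb: "\<exists>k\<ge>j. m \<le> f k" for j m
  proof (induction m)
    case (Suc m)
    then obtain k where "j \<le> k" "m \<le> f k" by blast
    moreover obtain k' where "k \<le> k'" "f k < f k'" using inc by blast
    ultimately show ?case by (intro exI[of _ k']) auto
  qed auto
  have hit: "\<exists>k. f k = m" if "f 0 \<le> m" for m
  proof -
    define k where "k = (LEAST k. m \<le> f k)"
    have k: "m \<le> f k" unfolding k_def using unb[of 0 m] by (metis (mono_tags, lifting) LeastI)
    show ?thesis
    proof (cases k)
      case 0
      then show ?thesis using k that by (intro exI[of _ 0]) auto
    next
      case (Suc i)
      then have "f i < m" using not_less_Least[of i "\<lambda>k. m \<le> f k"] unfolding k_def by auto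
      then show ?thesis using k fs[of i] Suc by (intro exI[of _ k]) auto
    qed
  qed
  \<comment> \<open>The counter attains every value from \<open>f 0\<close> on, so also this
    multiple of 8. There the path is on the positive first half-axis and counting can restart from
    0.\<close>
  obtain k where k: "f k = 8 * f 0" using hit[of "8 * f 0"] by auto
  show ?thesis
    unfolding z_def
  proof (rule spiral_of_cell_count[where T = "T + k" and n = "\<lambda>t. f (t - T) - 8 * f 0"])
    show "filterlim (\<lambda>t. cmod (Complex (of_int (a t)) (of_int (b t)))) at_top sequentially"
      using lim unfolding z_def .
    fix t assume t: "T + k \<le> t"
    then have ge: "8 * f 0 \<le> f (t - T)" using mono[of k "t - T"] k by simp
    have "cell (f (t - T) - 8 * f 0) (a t) (b t) = cell (f (t - T)) (a t) (b t)"
    proof -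
      have "(f (t - T) - 8 * f 0) mod 8 = f (t - T) mod 8"
        using ge by (metis le_add_diff_inverse2 mod_mult_self2)
      then show ?thesis by (metis cell_mod_8)
    qed
    then show "cell (f (t - T) - 8 * f 0) (a t) (b t)" using f[of "t - T"] t by simp
    show "f (Suc t - T) - 8 * f 0 = f (t - T) - 8 * f 0 \<or> f (Suc t - T) - 8 * f 0 = Suc (f (t - T) - 8 * f 0)"
      using fs[of "t - T"] ge t by (auto simp: Suc_diff_le)
  next
    fix m
    obtain i where "k \<le> i" "m + 8 * f 0 \<le> f i" using unb by blast
    then show "\<exists>t\<ge>T + k. m \<le> f (t - T) - 8 * f 0" by (intro exI[of _ "T + i"]) auto
  qed (simp add: k)
qed

section \<open>Unlikely and remaining steps for three sites\<close>

lemma three_sites_nbhd: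
  "asymmetric_nbhd 2 1 = {1, 2}" "asymmetric_nbhd 2 2 = {2, 3}" "asymmetric_nbhd 2 3 = {3, 1}"
  "pred_site 2 1 = 3" "pred_site 2 2 = 1" "pred_site 2 3 = 2"
  by (auto simp: asymmetric_nbhd_def pred_site_def)

text \<open>
  For three sites the exponent \<open>u\<^sub>k\<close> is the total height minus the height of the predecessor
  of \<open>k\<close>, which makes the steps defined here unlikely.
\<close>

definition wild_step :: "(nat \<Rightarrow> nat) \<Rightarrow> (nat \<Rightarrow> nat) \<Rightarrow> bool" where
  "wild_step x y \<longleftrightarrow> (\<exists>k\<in>{1..3}. y = x(k := x k + 1) \<and> (\<forall>j\<in>{1..3}. x j \<le> x (pred_site 2 k)))"

text \<open>A maximal predecessor has at least a third of the total height, leaving an exponent of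
  at most two thirds of it. The factor 3 counts the sites.\<close>

lemma wild_step_prob:
  assumes \<beta>: "\<beta> > 1"
  shows "(\<integral>\<^sup>+y. indicator {y. wild_step x y} y \<partial>measure_pmf (growth_kernel 2 (asymmetric_nbhd 2) \<beta> x)) \<le>
    ennreal (3 * exp (- free_energy 2 \<beta> x))"
proof -
  let ?h = "\<lambda>y. indicator {y. wild_step x y} y :: real"
  let ?S = "\<Sum>k\<in>{1..2+1}. real (x k)"
  have Z: "0 < total_rate 2 \<beta> x" using \<beta> by (intro total_rate_pos) simp
  have E: "exp (- free_energy 2 \<beta> x) = \<beta> powr (2 / 3 * ?S) / total_rate 2 \<beta> x"
    using Z \<beta> by (simp add: free_energy_def exp_diff powr_def mult_ac)
  have "(\<integral>\<^sup>+y. indicator {y. wild_step x y} y \<partial>measure_pmf (growth_kernel 2 (asymmetric_nbhd 2) \<beta> x)) =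
      (\<integral>\<^sup>+y. ennreal (?h y) \<partial>measure_pmf (growth_kernel 2 (asymmetric_nbhd 2) \<beta> x))"
    by (intro nn_integral_cong) (simp add: indicator_def)
  also have "\<dots> = ennreal (\<Sum>k\<in>{1..2+1}. \<beta> ^ rate_exp 2 x k / total_rate 2 \<beta> x * ?h (x(k := x k + 1)))"
    using \<beta> by (intro nn_integral_growth_kernel) auto
  also have "\<dots> \<le> ennreal (\<Sum>k\<in>{1..2+1::nat}. exp (- free_energy 2 \<beta> x))"
  proof (intro ennreal_leI sum_mono)
    fix k :: nat assume k: "k \<in> {1..2+1}"
    show "\<beta> ^ rate_exp 2 x k / total_rate 2 \<beta> x * ?h (x(k := x k + 1)) \<le> exp (- free_energy 2 \<beta> x)"
    proof (cases "wild_step x (x(k := x k + 1))")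
      case True
      then obtain k' where k': "x(k := x k + 1) = x(k' := x k' + 1)" "\<And>j. j \<in> {1..3} \<Longrightarrow> x j \<le> x (pred_site 2 k')"
        unfolding wild_step_def by blast
      have "k = k'" using fun_cong[OF k'(1), of k] by (auto split: if_splits)
      then have max: "x 1 \<le> x (pred_site 2 k)" "x 2 \<le> x (pred_site 2 k)" "x 3 \<le> x (pred_site 2 k)"
        using k'(2)[of 1] k'(2)[of 2] k'(2)[of 3] by auto
      have S: "?S = real (x 1) + real (x 2) + real (x 3)"
        unfolding three_sites by simp
      have "real (rate_exp 2 x k) \<le> 2 / 3 * ?S"
      proof -
        from k consider "k = 1" | "k = 2" | "k = 3" unfolding three_sites by blast
        then show ?thesis
          using max unfolding S by cases (simp_all only: three_sites_nbhd, simp_all)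
      qed
      then have "\<beta> ^ rate_exp 2 x k \<le> \<beta> powr (2 / 3 * ?S)"
        using \<beta> by (simp add: powr_realpow[symmetric])
      then show ?thesis unfolding E using True Z by (simp add: divide_right_mono)
    qed simp
  qed
  finally show ?thesis by simp
qed

text \<open>Borel-Cantelli by first moments: a summable series of indicators has only finitely many
  terms equal to 1.\<close>

lemma (in countable_chain) AE_eventually_not:
  assumes K: "\<And>z. z \<in> S \<Longrightarrow> (\<integral>\<^sup>+y. indicator {y. B z y} y \<partial>measure_pmf (K z)) \<le> g z"
    and fin: "(\<Sum>t. \<integral>\<^sup>+\<omega>. g (X t \<omega>) \<partial>M) < \<top>"
  shows "AE \<omega> in M. \<forall>\<^sub>F t in sequentially. \<not> B (X t \<omega>) (X (Suc t) \<omega>)"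
proof -
  let ?I = "\<lambda>t \<omega>. indicator {(x, y). B x y} (X t \<omega>, X (Suc t) \<omega>) :: ennreal"
  have meas: "?I t \<in> borel_measurable M" for t
    by (rule measurable_history[where t = "Suc t" and G = "\<lambda>p. indicator {(x, y). B x y} (p t, p (Suc t))"]) auto
  have "(\<integral>\<^sup>+\<omega>. ?I t \<omega> \<partial>M) \<le> (\<integral>\<^sup>+\<omega>. g (X t \<omega>) \<partial>M)" for t
  proof -
    have "(\<integral>\<^sup>+\<omega>. ?I t \<omega> \<partial>M) = (\<integral>\<^sup>+\<omega>. (\<integral>\<^sup>+y. indicator {(x, y). B x y} (X t \<omega>, y) \<partial>measure_pmf (K (X t \<omega>))) \<partial>M)"
      by (rule one_step[of t "\<lambda>p y. indicator {(x, y). B x y} (p t, y)"]) simp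
    also have "\<dots> \<le> (\<integral>\<^sup>+\<omega>. g (X t \<omega>) \<partial>M)"
    proof (rule nn_integral_mono)
      fix \<omega> assume "\<omega> \<in> space M"
      then have "(\<integral>\<^sup>+y. indicator {y. B (X t \<omega>) y} y \<partial>measure_pmf (K (X t \<omega>))) \<le> g (X t \<omega>)"
        by (intro K X_in_S)
      moreover have "indicator {(x, y). B x y} (X t \<omega>, y) = (indicator {y. B (X t \<omega>) y} y :: ennreal)" for y
        by (simp add: indicator_def)
      ultimately show "(\<integral>\<^sup>+y. indicator {(x, y). B x y} (X t \<omega>, y) \<partial>measure_pmf (K (X t \<omega>))) \<le> g (X t \<omega>)"
        by simp
    qed
    finally show ?thesis .
  qed
  then have "(\<Sum>t. \<integral>\<^sup>+\<omega>. ?I t \<omega> \<partial>M) \<le> (\<Sum>t. \<integral>\<^sup>+\<omega>. g (X t \<omega>) \<partial>M)"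
    by (intro suminf_le summableI)
  then have "(\<integral>\<^sup>+\<omega>. (\<Sum>t. ?I t \<omega>) \<partial>M) \<noteq> \<infinity>"
    using fin by (subst nn_integral_suminf[OF meas]) (auto simp: top_unique)
  then have "AE \<omega> in M. (\<Sum>t. ?I t \<omega>) \<noteq> \<infinity>"
    by (rule nn_integral_PInf_AE[rotated]) (intro borel_measurable_suminf_order meas)
  then show ?thesis
  proof eventually_elim
    fix \<omega> assume fin: "(\<Sum>t. ?I t \<omega>) \<noteq> \<infinity>"
    have eq: "?I t \<omega> = ennreal (indicator {(x, y). B x y} (X t \<omega>, X (Suc t) \<omega>))" for t
      by (simp add: indicator_def)
    have "summable (\<lambda>t. indicator {(x, y). B x y} (X t \<omega>, X (Suc t) \<omega>) :: real)"
      using fin unfolding eq by (intro summable_suminf_not_top) auto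
    then have "(\<lambda>t. indicator {(x, y). B x y} (X t \<omega>, X (Suc t) \<omega>) :: real) \<longlonglongrightarrow> 0"
      by (rule summable_LIMSEQ_zero)
    then have "\<forall>\<^sub>F t in sequentially. indicator {(x, y). B x y} (X t \<omega>, X (Suc t) \<omega>) < (1 :: real)"
      by (rule order_tendstoD) simp
    then show "\<forall>\<^sub>F t in sequentially. \<not> B (X t \<omega>) (X (Suc t) \<omega>)"
      by eventually_elim (auto simp: indicator_def)
  qed
qed

text \<open>The complement of \<open>wild_step\<close> in the coordinates
  \<open>a = x 1 - x 3\<close> and \<open>b = x 2 - x 3\<close>: each bracket says that some height
  exceeds that of the predecessor, which is site 3, 1 and 2 in turn.\<close>

definition tame_step :: "int \<Rightarrow> int \<Rightarrow> int \<Rightarrow> int \<Rightarrow> bool" where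
  "tame_step a b a' b' \<longleftrightarrow>
     a' = a + 1 \<and> b' = b \<and> (0 < a \<or> 0 < b) \<or>
     a' = a \<and> b' = b + 1 \<and> (a < b \<or> a < 0) \<or>
     a' = a - 1 \<and> b' = b - 1 \<and> (b < a \<or> b < 0)"

lemma tame_step_diff_map:
  assumes y: "y \<in> set_pmf (growth_kernel 2 (asymmetric_nbhd 2) \<beta> x)" and "\<beta> > 0" and "\<not> wild_step x y"
  shows "tame_step (diff_map 2 x 1) (diff_map 2 x 2) (diff_map 2 y 1) (diff_map 2 y 2)"
proof -
  obtain k where k: "k \<in> {1..2+1}" "y = x(k := x k + 1)"
    using y assms(2) unfolding growth_kernel_def set_map_pmf by (subst (asm) set_pmf_normalized_pmf) auto
  with assms(3) have nw: "\<not> (x 1 \<le> x (pred_site 2 k) \<and> x 2 \<le> x (pred_site 2 k) \<and> x 3 \<le> x (pred_site 2 k))"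
    unfolding wild_step_def by (force simp: numeral_eq_Suc le_Suc_eq)
  from k(1) consider "k = 1" | "k = 2" | "k = 3" unfolding three_sites by blast
  then show ?thesis
    using nw unfolding k(2) by cases (auto simp: tame_step_def diff_map_def pred_site_def)
qed

text \<open>At the excluded point (1, 0) the diagonal step is tame and lands on (0, -1), skipping
  the quadrant in between.\<close>

lemma tame_step_cell:
  assumes "r < 8" "cell r a b" "tame_step a b a' b'" "a \<noteq> 1 \<or> b \<noteq> 0"
  shows "cell r a' b' \<or> cell (Suc r) a' b'"
proof -
  from \<open>r < 8\<close> consider "r = 0" | "r = 1" | "r = 2" | "r = 3" | "r = 4" | "r = 5" | "r = 6" | "r = 7" by linarith
  then show ?thesis
    using assms(2-) by cases (auto simp: numeral_eq_Suc tame_step_def)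
qed

text \<open>
  For each piece of a cell there is a function with negative drift along the tame steps that stay in
  the piece. The last cell is split because \<open>b - a\<close> decreases on average only as long as \<open>a < b\<close>.
\<close>

definition tame_drift :: "real \<Rightarrow> (int \<Rightarrow> int \<Rightarrow> bool) \<Rightarrow> (int \<Rightarrow> int \<Rightarrow> real) \<Rightarrow> real \<Rightarrow> bool" where
  "tame_drift \<beta> P V \<epsilon> \<longleftrightarrow> (\<forall>a b. P a b \<longrightarrow>
     \<beta> powi (a + b) * (if P (a + 1) b \<and> (0 < a \<or> 0 < b) then V (a + 1) b else 0) +
     \<beta> powi b * (if P a (b + 1) \<and> (a < b \<or> a < 0) then V a (b + 1) else 0) +
     \<beta> powi a * (if P (a - 1) (b - 1) \<and> (b < a \<or> b < 0) then V (a - 1) (b - 1) else 0)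
     \<le> (V a b - \<epsilon>) * (\<beta> powi (a + b) + \<beta> powi b + \<beta> powi a))"

lemma tame_drift_leaves:
  assumes \<zeta>: "countable_chain M (diff_states 2) (diff_kernel 2 (asymmetric_nbhd 2) \<beta>) \<zeta>" and \<beta>: "\<beta> > 0"
    and drift: "tame_drift \<beta> P V \<epsilon>" and V: "\<And>a b. P a b \<Longrightarrow> 0 \<le> V a b" and \<epsilon>: "0 < \<epsilon>"
  shows "AE \<omega> in M. \<forall>t. \<exists>s\<ge>t. \<not> (P (\<zeta> s \<omega> 1) (\<zeta> s \<omega> 2) \<and>
    tame_step (\<zeta> s \<omega> 1) (\<zeta> s \<omega> 2) (\<zeta> (Suc s) \<omega> 1) (\<zeta> (Suc s) \<omega> 2))"
proof -
  interpret countable_chain M "diff_states 2" "diff_kernel 2 (asymmetric_nbhd 2) \<beta>" \<zeta> by (rule \<zeta>)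
  let ?A = "{z. P (z 1) (z 2)}"
  let ?R = "\<lambda>z y. tame_step (z 1) (z 2) (y 1) (y 2)"
  let ?V = "\<lambda>z :: nat \<Rightarrow> int. ennreal (V (z 1) (z 2))"
  have "AE \<omega> in M. \<forall>t. \<exists>s\<ge>t. \<not> (\<zeta> s \<omega> \<in> ?A \<and> ?R (\<zeta> s \<omega>) (\<zeta> (Suc s) \<omega>))"
  proof (rule AE_not_stay[where V = ?V and \<epsilon> = "ennreal \<epsilon>"])
    fix z assume z: "z \<in> diff_states 2" "z \<in> ?A"
    define a b where "a = z 1" and "b = z 2"
    have zab: "z = plane a b" unfolding a_def b_def by (rule plane_eq[OF z(1)])
    have P: "P a b" using z(2) by (simp add: a_def b_def)
    let ?T = "\<beta> powi (a + b) + \<beta> powi b + \<beta> powi a"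
    have T: "0 < ?T" using \<beta> by (intro add_pos_pos) (simp_all add: zero_less_power_int)
    \<comment> \<open>\<open>h\<close> is \<open>V\<close> for the killed chain: it is 0 after jumps
      that leave \<open>P\<close> or are not tame.\<close>
    define h where "h y = (if P (y 1) (y 2) \<and> tame_step a b (y 1) (y 2) then V (y 1) (y 2) else 0)" for y :: "nat \<Rightarrow> int"
    have h0: "0 \<le> h y" for y unfolding h_def using V by simp
    have h: "h (plane (a + 1) b) = (if P (a + 1) b \<and> (0 < a \<or> 0 < b) then V (a + 1) b else 0)"
      "h (plane a (b + 1)) = (if P a (b + 1) \<and> (a < b \<or> a < 0) then V a (b + 1) else 0)"
      "h (plane (a - 1) (b - 1)) = (if P (a - 1) (b - 1) \<and> (b < a \<or> b < 0) then V (a - 1) (b - 1) else 0)"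
      by (auto simp: h_def plane_def tame_step_def)
    let ?m = "(\<beta> powi (a + b) * h (plane (a + 1) b) + \<beta> powi b * h (plane a (b + 1)) + \<beta> powi a * h (plane (a - 1) (b - 1))) / ?T"
    have "(\<integral>\<^sup>+y. ?V y * indicator {y \<in> ?A. ?R z y} y \<partial>measure_pmf (diff_kernel 2 (asymmetric_nbhd 2) \<beta> z)) =
        (\<integral>\<^sup>+y. ennreal (h y) \<partial>measure_pmf (diff_kernel 2 (asymmetric_nbhd 2) \<beta> (plane a b)))"
      unfolding zab[symmetric] by (intro nn_integral_cong) (auto simp: h_def a_def b_def indicator_def)
    also have "\<dots> = ennreal ?m" by (rule nn_integral_diff_kernel_plane[OF \<beta> h0])
    finally have eq: "(\<integral>\<^sup>+y. ?V y * indicator {y \<in> ?A. ?R z y} y \<partial>measure_pmf (diff_kernel 2 (asymmetric_nbhd 2) \<beta> z)) = ennreal ?m" .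
    have m0: "0 \<le> ?m"
      using T \<beta> h0 by (intro divide_nonneg_nonneg add_nonneg_nonneg mult_nonneg_nonneg) (simp_all add: zero_le_power_int)
    have "?m \<le> V a b - \<epsilon>"
      using drift P T unfolding tame_drift_def h by (simp only: pos_divide_le_eq)
    then have "ennreal (?m + \<epsilon>) \<le> ennreal (V a b)" by (intro ennreal_leI) simp
    then show "(\<integral>\<^sup>+y. ?V y * indicator {y \<in> ?A. ?R z y} y \<partial>measure_pmf (diff_kernel 2 (asymmetric_nbhd 2) \<beta> z)) + ennreal \<epsilon> \<le> ?V z"
      unfolding eq using m0 \<epsilon> by (simp add: a_def b_def)
  qed (use \<epsilon> in auto)
  then show ?thesis by simp
qed

text \<open>With \<open>A\<close> and \<open>B\<close> for the two powers the jump weights become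
  \<open>A * B\<close>, \<open>B\<close> and \<open>A\<close>, which leaves algebra in two positive
  reals.\<close>

lemma tame_driftI:
  fixes \<beta> :: real
  assumes "\<beta> > 1"
    and "\<And>a b A B. P a b \<Longrightarrow> A = \<beta> powi a \<Longrightarrow> B = \<beta> powi b \<Longrightarrow> 0 < A \<Longrightarrow> 0 < B \<Longrightarrow>
     A * B * (if P (a + 1) b \<and> (0 < a \<or> 0 < b) then V (a + 1) b else 0) +
     B * (if P a (b + 1) \<and> (a < b \<or> a < 0) then V a (b + 1) else 0) +
     A * (if P (a - 1) (b - 1) \<and> (b < a \<or> b < 0) then V (a - 1) (b - 1) else 0)
     \<le> (V a b - \<epsilon>) * (A * B + B + A)"
  shows "tame_drift \<beta> P V \<epsilon>"
  unfolding tame_drift_def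
proof (intro allI impI)
  fix a b assume "P a b"
  have "\<beta> powi (a + b) = \<beta> powi a * \<beta> powi b" using assms(1) by (simp add: power_int_add)
  then show "\<beta> powi (a + b) * (if P (a + 1) b \<and> (0 < a \<or> 0 < b) then V (a + 1) b else 0) +
     \<beta> powi b * (if P a (b + 1) \<and> (a < b \<or> a < 0) then V a (b + 1) else 0) +
     \<beta> powi a * (if P (a - 1) (b - 1) \<and> (b < a \<or> b < 0) then V (a - 1) (b - 1) else 0)
     \<le> (V a b - \<epsilon>) * (\<beta> powi (a + b) + \<beta> powi b + \<beta> powi a)"
    using assms(2)[OF \<open>P a b\<close> refl refl] assms(1) by (simp only: zero_less_power_int)
qed

text \<open>On the two positive half-axes the staying tame step has the same weight as one that
  leaves; on the negative ones no tame step stays. So survival has probability at most 1 / 2 and a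
  constant \<open>V\<close> suffices.\<close>

lemma tame_drift_axes:
  fixes \<beta> :: real
  assumes "\<beta> > 1"
  shows "tame_drift \<beta> (\<lambda>a b. 0 < a \<and> b = 0) (\<lambda>_ _. 1) (1 / 2)"
    and "tame_drift \<beta> (\<lambda>a b. a = 0 \<and> b < 0) (\<lambda>_ _. 1) (1 / 2)"
    and "tame_drift \<beta> (\<lambda>a b. a < 0 \<and> b = 0) (\<lambda>_ _. 1) (1 / 2)"
    and "tame_drift \<beta> (\<lambda>a b. a = 0 \<and> 0 < b) (\<lambda>_ _. 1) (1 / 2)"
  by (rule tame_driftI[OF assms]; auto simp: field_simps)+

text \<open>The diagonal step lowers \<open>a\<close> with weight \<open>A\<close>, while raising
  \<open>a\<close> has weight at most \<open>A / \<beta>\<close> because \<open>b \<le> - 1\<close>.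
  Raising \<open>b\<close> is not tame here, and the total weight is at most
  \<open>3 * A\<close>.\<close>

lemma tame_drift_quadrant_1:
  fixes \<beta> :: real
  assumes \<beta>: "\<beta> > 1"
  shows "tame_drift \<beta> (\<lambda>a b. 0 < a \<and> b < 0) (\<lambda>a _. real_of_int a) ((1 - 1 / \<beta>) / 3)"
proof (rule tame_driftI[OF \<beta>])
  fix a b :: int and A B :: real
  assume P: "0 < a \<and> b < 0" and A: "A = \<beta> powi a" and B: "B = \<beta> powi b" and pos: "0 < A" "0 < B"
  have B1: "B \<le> 1 / \<beta>" using power_int_increasing[of b "- 1" \<beta>] \<beta> P B by (simp add: power_int_minus field_simps)
  have BA: "B \<le> A" unfolding A B using \<beta> P by (intro power_int_increasing) auto
  have AB: "A * B \<le> A * (1 / \<beta>)" "A * (1 / \<beta>) \<le> A * 1" using B1 pos \<beta> by (intro mult_left_mono; simp)+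
  have "(1 - 1 / \<beta>) / 3 * (A * B + B + A) \<le> (1 - 1 / \<beta>) / 3 * (3 * A)"
    using AB BA \<beta> by (intro mult_left_mono) auto
  also have "\<dots> = (1 - 1 / \<beta>) * A" by simp
  also have "\<dots> = A - A * (1 / \<beta>)" by (simp only: left_diff_distrib mult_1_left mult_1_right times_divide_eq_left times_divide_eq_right)
  also have "\<dots> \<le> A - A * B" using AB by simp
  finally have *: "(1 - 1 / \<beta>) / 3 * (A * B + B + A) \<le> A - A * B" .
  have aB: "0 \<le> real_of_int a * B" using P pos by simp
  have "A * B * (real_of_int a + 1) + A * (real_of_int a - 1) \<le> (real_of_int a - (1 - 1 / \<beta>) / 3) * (A * B + B + A)"
    using * aB unfolding left_diff_distrib[of "real_of_int a"] by (simp only: algebra_simps)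
  then show "A * B * (if (0 < a + 1 \<and> b < 0) \<and> (0 < a \<or> 0 < b) then real_of_int (a + 1) else 0) +
     B * (if (0 < a \<and> b + 1 < 0) \<and> (a < b \<or> a < 0) then real_of_int a else 0) +
     A * (if (0 < a - 1 \<and> b - 1 < 0) \<and> (b < a \<or> b < 0) then real_of_int (a - 1) else 0)
     \<le> (real_of_int a - (1 - 1 / \<beta>) / 3) * (A * B + B + A)"
    using P by (cases "a = 1") auto
qed

text \<open>The tame steps raise \<open>b\<close> (weight \<open>B\<close>) or go down the diagonal
  (weight \<open>A\<close>), and the latter dominates when \<open>b\<close> is far below
  \<open>a\<close>. The exponential term corrects this: the diagonal step keeps it, raising
  \<open>b\<close> divides it by \<beta>, and its coefficient makes the weighted drop exactly
  \<open>2 * A\<close>. In total the weighted change is \<open>- B + A - 2 * A\<close>.\<close>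

lemma tame_drift_quadrant_3:
  fixes \<beta> :: real
  assumes \<beta>: "\<beta> > 1"
  shows "tame_drift \<beta> (\<lambda>a b. a < 0 \<and> b < 0) (\<lambda>a b. - real_of_int b + 2 * \<beta> / (\<beta> - 1) * \<beta> powi (a - b)) (1 / 2)"
proof (rule tame_driftI[OF \<beta>])
  fix a b :: int and A B :: real
  assume P: "a < 0 \<and> b < 0" and A: "A = \<beta> powi a" and B: "B = \<beta> powi b" and pos: "0 < A" "0 < B"
  let ?V = "\<lambda>a b. - real_of_int b + 2 * \<beta> / (\<beta> - 1) * \<beta> powi (a - b)"
  define G where "G = 2 * \<beta> / (\<beta> - 1) * \<beta> powi (a - b)"
  have G0: "0 \<le> G" unfolding G_def using \<beta> by (simp add: zero_le_power_int)
  have A1: "A \<le> 1" using power_int_increasing[of a 0 \<beta>] \<beta> P A by simp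
  have BG: "B * G = 2 * \<beta> / (\<beta> - 1) * A"
    unfolding G_def A B using \<beta> by (simp add: power_int_diff)
  have V2: "?V a (b + 1) = - real_of_int b - 1 + G / \<beta>"
    unfolding G_def using \<beta> by (simp add: power_int_diff power_int_add field_simps)
  have V3: "?V (a - 1) (b - 1) = - real_of_int b + 1 + G"
    unfolding G_def by simp
  have V20: "0 \<le> ?V a (b + 1)" using P \<beta> by (simp add: zero_le_power_int)
  have "B * G - B * (G / \<beta>) = B * G * (1 - 1 / \<beta>)" by (simp add: algebra_simps)
  also have "\<dots> = 2 * A" unfolding BG using \<beta> by (simp add: field_simps)
  finally have drop: "B * (G / \<beta>) = B * G - 2 * A" by simp
  have "A * B \<le> 1 * B" using A1 pos by (intro mult_right_mono) auto
  also have "\<dots> \<le> A + B" using pos by simp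
  finally have "1 / 2 * (A * B + B + A) \<le> B + A" by simp
  moreover have "0 \<le> (- real_of_int b) * (A * B)" "0 \<le> G * (A * B)"
    by (intro mult_nonneg_nonneg; use P pos G0 in simp)+
  ultimately have "B * (- real_of_int b - 1 + G / \<beta>) + A * (- real_of_int b + 1 + G) \<le>
      (- real_of_int b + G - 1 / 2) * (A * B + B + A)"
    using drop by (simp add: algebra_simps)
  moreover have "B * (if (a < 0 \<and> b + 1 < 0) \<and> (a < b \<or> a < 0) then ?V a (b + 1) else 0) \<le> B * ?V a (b + 1)"
    using V20 pos by (intro mult_left_mono) auto
  ultimately show "A * B * (if (a + 1 < 0 \<and> b < 0) \<and> (0 < a \<or> 0 < b) then ?V (a + 1) b else 0) +
     B * (if (a < 0 \<and> b + 1 < 0) \<and> (a < b \<or> a < 0) then ?V a (b + 1) else 0) +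
     A * (if (a - 1 < 0 \<and> b - 1 < 0) \<and> (b < a \<or> b < 0) then ?V (a - 1) (b - 1) else 0)
     \<le> (?V a b - 1 / 2) * (A * B + B + A)"
    using P unfolding V2 V3 G_def[symmetric] by simp
qed

text \<open>Progress comes only from raising \<open>a\<close>, whose probability may be tiny. Taking
  \<open>V\<close> proportional to \<open>1 / A\<close> compensates: the weighted drop is exactly
  \<open>3 * B\<close>, at least the total weight. Raising \<open>b\<close> keeps \<open>V\<close>,
  and the diagonal step is not tame.\<close>

lemma tame_drift_quadrant_5:
  fixes \<beta> :: real
  assumes \<beta>: "\<beta> > 1"
  shows "tame_drift \<beta> (\<lambda>a b. a < 0 \<and> 0 < b) (\<lambda>a _. 3 * \<beta> / (\<beta> - 1) * \<beta> powi (- a)) 1"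
proof (rule tame_driftI[OF \<beta>])
  fix a b :: int and A B :: real
  assume P: "a < 0 \<and> 0 < b" and A: "A = \<beta> powi a" and B: "B = \<beta> powi b" and pos: "0 < A" "0 < B"
  let ?V = "\<lambda>a. 3 * \<beta> / (\<beta> - 1) * \<beta> powi (- a)"
  have V0: "0 \<le> ?V k" for k using \<beta> by (simp add: zero_le_power_int)
  have A1: "A \<le> 1" using power_int_increasing[of a 0 \<beta>] \<beta> P A by simp
  have AB: "A \<le> B" unfolding A B using \<beta> P by (intro power_int_increasing) auto
  have AV: "A * ?V a = 3 * \<beta> / (\<beta> - 1)" unfolding A using \<beta> by (simp add: power_int_minus)
  have neg: "- (a + 1) = - a - 1" by simp
  have "\<beta> powi (- a - 1) = \<beta> powi (- a) / \<beta>" using \<beta> by (subst power_int_diff) auto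
  then have V1: "?V (a + 1) = ?V a / \<beta>" unfolding neg by simp
  have "A * ?V a - A * (?V a / \<beta>) = A * ?V a * (1 - 1 / \<beta>)" by (simp only: right_diff_distrib mult_1_right times_divide_eq_right)
  also have "\<dots> = 3" unfolding AV using \<beta> by (simp add: field_simps)
  finally have drop: "A * (?V a / \<beta>) = A * ?V a - 3" by simp
  have "A * B * ?V (a + 1) = B * (A * (?V a / \<beta>))" unfolding V1 by simp
  also have "\<dots> = A * B * ?V a - 3 * B" unfolding drop by (simp add: algebra_simps)
  finally have step: "A * B * ?V (a + 1) = A * B * ?V a - 3 * B" .
  have bal: "A * B * v - 3 * B + B * v \<le> (v - 1) * (A * B + B + A)" if "A * B + B + A \<le> 3 * B" "0 \<le> A * v" for v
    using that by (simp add: algebra_simps)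
  have "A * B \<le> 1 * B" using A1 pos by (intro mult_right_mono) auto
  then have "A * B + B + A \<le> 3 * B" using AB by simp
  moreover have "0 \<le> A * ?V a" by (rule mult_nonneg_nonneg[OF less_imp_le[OF pos(1)] V0])
  ultimately have "A * B * ?V (a + 1) + B * ?V a \<le> (?V a - 1) * (A * B + B + A)"
    unfolding step by (rule bal)
  moreover have "A * B * (if (a + 1 < 0 \<and> 0 < b) \<and> (0 < a \<or> 0 < b) then ?V (a + 1) else 0) \<le> A * B * ?V (a + 1)"
    using V0[of "a + 1"] pos by (intro mult_left_mono) auto
  ultimately show "A * B * (if (a + 1 < 0 \<and> 0 < b) \<and> (0 < a \<or> 0 < b) then ?V (a + 1) else 0) +
     B * (if (a < 0 \<and> 0 < b + 1) \<and> (a < b \<or> a < 0) then ?V a else 0) +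
     A * (if (a - 1 < 0 \<and> 0 < b - 1) \<and> (b < a \<or> b < 0) then ?V (a - 1) else 0)
     \<le> (?V a - 1) * (A * B + B + A)"
    using P by simp
qed

text \<open>As \<open>A \<ge> \<beta>\<close>, raising \<open>a\<close> (weight
  \<open>A * B\<close>) outweighs raising \<open>b\<close> (weight \<open>B\<close>), and the total
  weight is at most \<open>3 * (A * B)\<close>. The diagonal step is not tame.\<close>

lemma tame_drift_quadrant_7_upper:
  fixes \<beta> :: real
  assumes \<beta>: "\<beta> > 1"
  shows "tame_drift \<beta> (\<lambda>a b. 0 < a \<and> a < b) (\<lambda>a b. real_of_int (b - a)) ((1 - 1 / \<beta>) / 3)"
proof (rule tame_driftI[OF \<beta>])
  fix a b :: int and A B :: real
  assume P: "0 < a \<and> a < b" and A: "A = \<beta> powi a" and B: "B = \<beta> powi b" and pos: "0 < A" "0 < B"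
  define d where "d = real_of_int (b - a)"
  have A1: "\<beta> \<le> A" using power_int_increasing[of 1 a \<beta>] \<beta> P A by simp
  have AB: "A \<le> B" unfolding A B using \<beta> P by (intro power_int_increasing) auto
  have "\<beta> * B \<le> A * B" using A1 pos by (intro mult_right_mono) auto
  then have B1: "B \<le> A * B * (1 / \<beta>)" using \<beta> by (simp add: field_simps)
  have "1 * B \<le> A * B" using A1 \<beta> pos by (intro mult_right_mono) auto
  then have "(1 - 1 / \<beta>) / 3 * (A * B + B + A) \<le> (1 - 1 / \<beta>) / 3 * (3 * (A * B))"
    using AB \<beta> by (intro mult_left_mono) auto
  also have "\<dots> = (1 - 1 / \<beta>) * (A * B)" by simp
  also have "\<dots> = A * B - A * B * (1 / \<beta>)" by (simp only: left_diff_distrib mult_1_left mult_1_right times_divide_eq_left times_divide_eq_right)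
  also have "\<dots> \<le> A * B - B" using B1 by simp
  finally have *: "(1 - 1 / \<beta>) / 3 * (A * B + B + A) \<le> A * B - B" .
  have dA: "0 \<le> d * A" using P pos unfolding d_def by simp
  have "A * B * (d - 1) + B * (d + 1) \<le> (d - (1 - 1 / \<beta>) / 3) * (A * B + B + A)"
    using * dA unfolding left_diff_distrib[of d] by (simp only: algebra_simps)
  moreover have "d + 1 = real_of_int (b + 1 - a)" "d - 1 = real_of_int (b - (a + 1))" unfolding d_def by simp_all
  ultimately have "A * B * real_of_int (b - (a + 1)) + B * real_of_int (b + 1 - a) \<le>
      (real_of_int (b - a) - (1 - 1 / \<beta>) / 3) * (A * B + B + A)"
    unfolding d_def by (simp only:)
  then show "A * B * (if (0 < a + 1 \<and> a + 1 < b) \<and> (0 < a \<or> 0 < b) then real_of_int (b - (a + 1)) else 0) +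
     B * (if (0 < a \<and> a < b + 1) \<and> (a < b \<or> a < 0) then real_of_int (b + 1 - a) else 0) +
     A * (if (0 < a - 1 \<and> a - 1 < b - 1) \<and> (b < a \<or> b < 0) then real_of_int (b - 1 - (a - 1)) else 0)
     \<le> (real_of_int (b - a) - (1 - 1 / \<beta>) / 3) * (A * B + B + A)"
    using P by (cases "b = a + 1") auto
qed

text \<open>Raising \<open>a\<close> keeps \<open>V\<close> and raising \<open>b\<close> is not
  tame, so \<open>b\<close> changes only by the rare diagonal step of weight \<open>A\<close>. With
  \<open>V\<close> proportional to \<open>B\<close> its weighted drop is \<open>3 * A * B\<close>,
  at least the total weight. For \<open>b = a\<close> the diagonal step is not tame either and
  counts as killing.\<close>

lemma tame_drift_quadrant_7_lower:
  fixes \<beta> :: real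
  assumes \<beta>: "\<beta> > 1"
  shows "tame_drift \<beta> (\<lambda>a b. 0 < b \<and> b \<le> a) (\<lambda>_ b. 3 * \<beta> / (\<beta> - 1) * \<beta> powi b) 1"
proof (rule tame_driftI[OF \<beta>])
  fix a b :: int and A B :: real
  assume P: "0 < b \<and> b \<le> a" and A: "A = \<beta> powi a" and B: "B = \<beta> powi b" and pos: "0 < A" "0 < B"
  let ?V = "\<lambda>b. 3 * \<beta> / (\<beta> - 1) * \<beta> powi b"
  have V0: "0 \<le> ?V k" for k using \<beta> by (simp add: zero_le_power_int)
  have B1: "1 \<le> B" using power_int_increasing[of 0 b \<beta>] \<beta> P B by simp
  have BA: "B \<le> A" unfolding A B using \<beta> P by (intro power_int_increasing) auto
  have V1: "?V (b - 1) = ?V b / \<beta>" using \<beta> by (simp add: power_int_diff field_simps)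
  have "?V b - ?V b / \<beta> = ?V b * (1 - 1 / \<beta>)" by (simp only: right_diff_distrib mult_1_right times_divide_eq_right)
  also have "\<dots> = 3 * \<beta> / (\<beta> - 1) * (1 - 1 / \<beta>) * B" unfolding B by (simp only: mult_ac)
  also have "3 * \<beta> / (\<beta> - 1) * (1 - 1 / \<beta>) = 3" using \<beta> by (simp add: field_simps)
  finally have drop: "?V (b - 1) = ?V b - 3 * B" unfolding V1 by simp
  have bal: "A * B * v + A * (v - 3 * B) \<le> (v - 1) * (A * B + B + A)" if "A * B + B + A \<le> 3 * (A * B)" "0 \<le> B * v" for v
    using that by (simp add: algebra_simps)
  have "A * 1 \<le> A * B" using B1 pos by (intro mult_left_mono) auto
  then have "A * B + B + A \<le> 3 * (A * B)" using BA by simp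
  moreover have "0 \<le> B * ?V b" by (rule mult_nonneg_nonneg[OF less_imp_le[OF pos(2)] V0])
  ultimately have "A * B * ?V b + A * ?V (b - 1) \<le> (?V b - 1) * (A * B + B + A)"
    unfolding drop by (rule bal)
  moreover have "A * (if (0 < b - 1 \<and> b - 1 \<le> a - 1) \<and> (b < a \<or> b < 0) then ?V (b - 1) else 0) \<le> A * ?V (b - 1)"
    using V0[of "b - 1"] pos by (intro mult_left_mono) auto
  ultimately show "A * B * (if (0 < b \<and> b \<le> a + 1) \<and> (0 < a \<or> 0 < b) then ?V b else 0) +
     B * (if (0 < b + 1 \<and> b + 1 \<le> a) \<and> (a < b \<or> a < 0) then ?V (b + 1) else 0) +
     A * (if (0 < b - 1 \<and> b - 1 \<le> a - 1) \<and> (b < a \<or> b < 0) then ?V (b - 1) else 0)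
     \<le> (?V b - 1) * (A * B + B + A)"
    using P by simp
qed

text \<open>Once \<open>b \<le> a\<close>, tame steps inside the quadrant cannot restore
  \<open>a < b\<close>. After leaving the upper piece the path is confined to the lower one, which
  it also leaves.\<close>

lemma leaves_quadrant_7:
  fixes a b :: "nat \<Rightarrow> int"
  assumes tame: "\<And>t. T \<le> t \<Longrightarrow> tame_step (a t) (b t) (a (Suc t)) (b (Suc t))"
    and upper: "\<And>t. \<exists>s\<ge>t. \<not> (0 < a s \<and> a s < b s)"
    and lower: "\<And>t. \<exists>s\<ge>t. \<not> (0 < b s \<and> b s \<le> a s)"
  shows "\<exists>s\<ge>t. \<not> (0 < a s \<and> 0 < b s)"
proof (rule ccontr)
  assume "\<not> ?thesis"
  then have pos: "0 < a s \<and> 0 < b s" if "t \<le> s" for s using that by blast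
  obtain u where u: "max t T \<le> u" "\<not> (0 < a u \<and> a u < b u)" using upper by blast
  have "b s \<le> a s" if "u \<le> s" for s
    using that
  proof (induction s rule: dec_induct)
    case base
    show ?case using u pos[of u] by auto
  next
    case (step s)
    then show ?case using tame[of s] pos[of s] u(1) by (auto simp: tame_step_def)
  qed
  moreover obtain v where "u \<le> v" "\<not> (0 < b v \<and> b v \<le> a v)" using lower by blast
  ultimately show False using pos[of v] u(1) by auto
qed

section \<open>Almost sure spiralling for three sites\<close>

lemma growth_spiral:
  assumes \<beta>: "\<beta> > 1" and \<xi>: "growth_process M 2 (asymmetric_nbhd 2) \<beta> \<xi>"
  shows "AE \<omega> in M. essentially_clockwise_spiral
    (\<lambda>t. Complex (of_int (differences 2 \<xi> t \<omega> 1)) (of_int (differences 2 \<xi> t \<omega> 2)))"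
proof -
  have \<beta>0: "\<beta> > 0" using \<beta> by simp
  let ?K = "growth_kernel 2 (asymmetric_nbhd 2) \<beta>"
  interpret countable_chain M "growth_states 2" ?K \<xi>
    by (rule growth_process_countable_chain[OF \<xi> \<beta>0])
  have \<zeta>: "countable_chain M (diff_states 2) (diff_kernel 2 (asymmetric_nbhd 2) \<beta>) (differences 2 \<xi>)"
  proof (rule markov_chain_countable_chain)
    show "markov_chain M (diff_states 2) (diff_kernel 2 (asymmetric_nbhd 2) \<beta>) (differences 2 \<xi>)"
      using \<xi> \<beta>0 by (rule differences_markov_chain) simp
  qed (rule diff_kernel_closed[OF \<beta>0])
  note leaves = tame_drift_leaves[OF \<zeta> \<beta>0]
  obtain \<theta> where \<theta>: "0 < \<theta>" "\<theta> \<le> 1"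
    and fin: "(\<Sum>t. \<integral>\<^sup>+\<omega>. exp (- (\<theta> * free_energy 2 \<beta> (\<xi> t \<omega>))) \<partial>M) < \<top>"
    by (rule AE_free_energy[OF _ \<beta> \<xi>]) auto
  let ?g = "\<lambda>x. ennreal 3 * ennreal (exp (- (\<theta> * free_energy 2 \<beta> x)))"
  have wild: "AE \<omega> in M. \<forall>\<^sub>F t in sequentially. \<not> wild_step (\<xi> t \<omega>) (\<xi> (Suc t) \<omega>)"
  proof (rule AE_eventually_not[where g = ?g])
    fix x
    \<comment> \<open>Since \<theta> is at most 1 and the free energy is nonnegative, the summable
      means with factor \<theta> dominate the wild-step probabilities.\<close>
    have "\<theta> * free_energy 2 \<beta> x \<le> 1 * free_energy 2 \<beta> x"
      using \<theta> free_energy_nonneg[of 2 \<beta> x] \<beta> by (intro mult_right_mono) auto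
    then have "ennreal (3 * exp (- free_energy 2 \<beta> x)) \<le> ennreal (3 * exp (- (\<theta> * free_energy 2 \<beta> x)))"
      by (intro ennreal_leI) simp
    then show "(\<integral>\<^sup>+y. indicator {y. wild_step x y} y \<partial>measure_pmf (?K x)) \<le> ?g x"
      using wild_step_prob[OF \<beta>, of x] by (simp add: ennreal_mult)
  next
    have "(\<Sum>t. \<integral>\<^sup>+\<omega>. ?g (\<xi> t \<omega>) \<partial>M) = (\<Sum>t. ennreal 3 * (\<integral>\<^sup>+\<omega>. exp (- (\<theta> * free_energy 2 \<beta> (\<xi> t \<omega>))) \<partial>M))"
      by (intro suminf_cong nn_integral_cmult measurable_compose[OF rv]) simp
    also have "\<dots> = ennreal 3 * (\<Sum>t. \<integral>\<^sup>+\<omega>. exp (- (\<theta> * free_energy 2 \<beta> (\<xi> t \<omega>))) \<partial>M)"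
      by (rule ennreal_suminf_cmult)
    also have "\<dots> < \<top>" using fin by (intro ennreal_mult_less_top[THEN iffD2]) auto
    finally show "(\<Sum>t. \<integral>\<^sup>+\<omega>. ?g (\<xi> t \<omega>) \<partial>M) < \<top>" .
  qed
  have lim: "AE \<omega> in M. filterlim (\<lambda>t. L2_set (\<lambda>i. real_of_int (differences 2 \<xi> t \<omega> i)) {1..2}) at_top sequentially"
    by (rule growth_transient[OF _ \<beta> \<xi>]) simp
  let ?L = "\<lambda>P \<omega>. \<forall>t. \<exists>s\<ge>t. \<not> (P (differences 2 \<xi> s \<omega> 1) (differences 2 \<xi> s \<omega> 2) \<and>
    tame_step (differences 2 \<xi> s \<omega> 1) (differences 2 \<xi> s \<omega> 2) (differences 2 \<xi> (Suc s) \<omega> 1) (differences 2 \<xi> (Suc s) \<omega> 2))"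
  have \<epsilon>: "0 < (1 - 1 / \<beta>) / 3" using \<beta> by simp
  have c: "0 \<le> 2 * \<beta> / (\<beta> - 1) * \<beta> powi k" "0 \<le> 3 * \<beta> / (\<beta> - 1) * \<beta> powi k" for k
    using \<beta> by (simp_all add: zero_le_power_int)
  have L0: "AE \<omega> in M. ?L (\<lambda>a b. 0 < a \<and> b = 0) \<omega>"
    by (rule leaves[OF tame_drift_axes(1)[OF \<beta>]]) simp_all
  have L2: "AE \<omega> in M. ?L (\<lambda>a b. a = 0 \<and> b < 0) \<omega>"
    by (rule leaves[OF tame_drift_axes(2)[OF \<beta>]]) simp_all
  have L4: "AE \<omega> in M. ?L (\<lambda>a b. a < 0 \<and> b = 0) \<omega>"
    by (rule leaves[OF tame_drift_axes(3)[OF \<beta>]]) simp_all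
  have L6: "AE \<omega> in M. ?L (\<lambda>a b. a = 0 \<and> 0 < b) \<omega>"
    by (rule leaves[OF tame_drift_axes(4)[OF \<beta>]]) simp_all
  have L1: "AE \<omega> in M. ?L (\<lambda>a b. 0 < a \<and> b < 0) \<omega>"
    by (rule leaves[OF tame_drift_quadrant_1[OF \<beta>] _ \<epsilon>]) simp
  have L3: "AE \<omega> in M. ?L (\<lambda>a b. a < 0 \<and> b < 0) \<omega>"
    by (rule leaves[OF tame_drift_quadrant_3[OF \<beta>]]) (rule add_nonneg_nonneg[OF _ c(1)], simp_all)
  have L5: "AE \<omega> in M. ?L (\<lambda>a b. a < 0 \<and> 0 < b) \<omega>"
    by (rule leaves[OF tame_drift_quadrant_5[OF \<beta>]]) (rule c(2), simp)
  have L7: "AE \<omega> in M. ?L (\<lambda>a b. 0 < a \<and> a < b) \<omega>"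
    by (rule leaves[OF tame_drift_quadrant_7_upper[OF \<beta>] _ \<epsilon>]) simp
  have L7': "AE \<omega> in M. ?L (\<lambda>a b. 0 < b \<and> b \<le> a) \<omega>"
    by (rule leaves[OF tame_drift_quadrant_7_lower[OF \<beta>]]) (rule c(2), simp)
  show ?thesis
    using wild AE_step lim L0 L1 L2 L3 L4 L5 L6 L7 L7'
  proof eventually_elim
    case (elim \<omega>)
    define a b where "a t = differences 2 \<xi> t \<omega> 1" and "b t = differences 2 \<xi> t \<omega> 2" for t
    have "L2_set (\<lambda>i. real_of_int (differences 2 \<xi> t \<omega> i)) {1..2} = cmod (Complex (of_int (a t)) (of_int (b t)))" for t
    proof -
      have "{1..2} = {1, 2::nat}" by auto
      then show ?thesis by (simp add: L2_set_def a_def b_def complex_norm)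
    qed
    then have norm: "filterlim (\<lambda>t. cmod (Complex (of_int (a t)) (of_int (b t)))) at_top sequentially"
      using elim(3) by simp
    \<comment> \<open>A norm above 1 excludes the origin, which belongs to no cell, and the point
      (1, 0), where a cell may be skipped.\<close>
    then have "\<forall>\<^sub>F t in sequentially. 1 < cmod (Complex (of_int (a t)) (of_int (b t)))"
      by (simp add: filterlim_at_top_dense)
    with elim(1) have "\<forall>\<^sub>F t in sequentially. \<not> wild_step (\<xi> t \<omega>) (\<xi> (Suc t) \<omega>) \<and> 1 < cmod (Complex (of_int (a t)) (of_int (b t)))"
      by eventually_elim simp
    then obtain T where T: "\<And>t. T \<le> t \<Longrightarrow> \<not> wild_step (\<xi> t \<omega>) (\<xi> (Suc t) \<omega>)"
      "\<And>t. T \<le> t \<Longrightarrow> 1 < cmod (Complex (of_int (a t)) (of_int (b t)))"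
      unfolding eventually_sequentially by blast
    have tame: "tame_step (a t) (b t) (a (Suc t)) (b (Suc t))" if "T \<le> t" for t
      unfolding a_def b_def differences_eq
      by (rule tame_step_diff_map[OF _ \<beta>0 T(1)[OF that]]) (use elim(2) in blast)
    \<comment> \<open>After \<open>T\<close> all steps are tame, so a sojourn in \<open>P\<close>
      can only have ended by leaving \<open>P\<close>.\<close>
    have leave: "\<exists>s\<ge>t. \<not> P (a s) (b s)" if "?L P \<omega>" for P t
    proof -
      from that obtain s where "max t T \<le> s" "\<not> (P (a s) (b s) \<and> tame_step (a s) (b s) (a (Suc s)) (b (Suc s)))"
        unfolding a_def b_def by blast
      then show ?thesis using tame[of s] by (intro exI[of _ s]) auto
    qed
    have "essentially_clockwise_spiral (\<lambda>t. Complex (of_int (a t)) (of_int (b t)))"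
    proof (rule spiral_criterion[where T = T])
      show "filterlim (\<lambda>t. cmod (Complex (of_int (a t)) (of_int (b t)))) at_top sequentially" by (rule norm)
      show "a t \<noteq> 0 \<or> b t \<noteq> 0" if "T \<le> t" for t
        using T(2)[OF that] by (auto simp: complex_norm)
      show "cell r (a (Suc t)) (b (Suc t)) \<or> cell (Suc r) (a (Suc t)) (b (Suc t))"
        if "T \<le> t" "r < 8" "cell r (a t) (b t)" for t r
        using T(2)[OF that(1)] by (intro tame_step_cell[OF that(2,3) tame[OF that(1)]]) (auto simp: complex_norm)
      show "\<exists>s\<ge>t. \<not> cell r (a s) (b s)" if "r < 8" for r t
      proof -
        have quadrant_7: "\<exists>s\<ge>t. \<not> (0 < a s \<and> 0 < b s)"
          using tame leave[OF elim(11)] leave[OF elim(12)] by (rule leaves_quadrant_7)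
        from \<open>r < 8\<close> consider "r = 0" | "r = 1" | "r = 2" | "r = 3" | "r = 4" | "r = 5" | "r = 6" | "r = 7" by linarith
        then show ?thesis
        proof cases
          case 1 then show ?thesis using leave[OF elim(4), of t] by simp
        next
          case 2 then show ?thesis using leave[OF elim(5), of t] by simp
        next
          case 3 then show ?thesis using leave[OF elim(6), of t] by (simp add: numeral_eq_Suc conj_commute)
        next
          case 4 then show ?thesis using leave[OF elim(7), of t] by (simp add: numeral_eq_Suc conj_commute)
        next
          case 5 then show ?thesis using leave[OF elim(8), of t] by (simp add: numeral_eq_Suc)
        next
          case 6 then show ?thesis using leave[OF elim(9), of t] by (simp add: numeral_eq_Suc)
        next
          case 7 then show ?thesis using leave[OF elim(10), of t] by (simp add: numeral_eq_Suc conj_commute)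
        next
          case 8 then show ?thesis using quadrant_7 by (simp add: numeral_eq_Suc conj_commute)
        qed
      qed
    qed
    then show ?case unfolding a_def b_def .
  qed
qed

lemma coincidence_finitely_often:
  assumes "filterlim (\<lambda>t. L2_set (\<lambda>i. real_of_int (differences 2 \<xi> t \<omega> i)) {1..2}) at_top sequentially"
  shows "finite {t. \<xi> t \<omega> 1 = \<xi> t \<omega> 2 \<and> \<xi> t \<omega> 2 = \<xi> t \<omega> 3}"
proof -
  have "\<forall>\<^sub>F t in sequentially. 0 < L2_set (\<lambda>i. real_of_int (differences 2 \<xi> t \<omega> i)) {1..2}"
    using assms by (simp add: filterlim_at_top_dense)
  then obtain T where T: "\<And>t. T \<le> t \<Longrightarrow> 0 < L2_set (\<lambda>i. real_of_int (differences 2 \<xi> t \<omega> i)) {1..2}"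
    unfolding eventually_sequentially by blast
  have "{t. \<xi> t \<omega> 1 = \<xi> t \<omega> 2 \<and> \<xi> t \<omega> 2 = \<xi> t \<omega> 3} \<subseteq> {..<T}"
  proof
    fix t assume "t \<in> {t. \<xi> t \<omega> 1 = \<xi> t \<omega> 2 \<and> \<xi> t \<omega> 2 = \<xi> t \<omega> 3}"
    then have "differences 2 \<xi> t \<omega> = plane 0 0" by (simp add: differences_eq coincidence_iff)
    then have "L2_set (\<lambda>i. real_of_int (differences 2 \<xi> t \<omega> i)) {1..2} = 0"
      by (simp add: L2_set_eq_0_iff plane_def)
    then show "t \<in> {..<T}" using T[of t] by (cases "T \<le> t") auto
  qed
  then show ?thesis by (rule finite_subset) simp
qed

theorem theorem2:
  fixes M :: "'w measure" and N :: nat and \<beta> :: real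
    and \<xi> :: "nat \<Rightarrow> 'w \<Rightarrow> nat \<Rightarrow> nat"
  assumes "N \<ge> 2" and "\<beta> > 0"
    and "growth_process M N (asymmetric_nbhd N) \<beta> \<xi>"
  shows
    "(N = 2 \<and> \<beta> < 1 \<longrightarrow>
        ergodic_chain M (diff_states N) (diff_kernel N (asymmetric_nbhd N) \<beta>) (differences N \<xi>) \<and>
        (AE \<omega> in M. infinite {t. \<xi> t \<omega> 1 = \<xi> t \<omega> 2 \<and> \<xi> t \<omega> 2 = \<xi> t \<omega> 3})) \<and>
     (\<beta> > 1 \<longrightarrow>
        transient_chain M N (asymmetric_nbhd N) \<beta> (differences N \<xi>) \<and>
        (N = 2 \<longrightarrow>
          (AE \<omega> in M. essentially_clockwise_spiral
             (\<lambda>t. Complex (of_int (differences N \<xi> t \<omega> 1)) (of_int (differences N \<xi> t \<omega> 2)))) \<and>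
          (AE \<omega> in M. finite {t. \<xi> t \<omega> 1 = \<xi> t \<omega> 2 \<and> \<xi> t \<omega> 2 = \<xi> t \<omega> 3})))"
proof (intro conjI impI)
  note \<xi> = assms(3)
  have N: "N \<ge> 1" using assms(1) by simp
  note markov = differences_markov_chain[OF \<xi> assms(2) N]
  {
    assume *: "N = 2 \<and> \<beta> < 1"
    show "ergodic_chain M (diff_states N) (diff_kernel N (asymmetric_nbhd N) \<beta>) (differences N \<xi>)"
      unfolding ergodic_chain_def using markov diff_chain_positive_recurrent[OF assms(2)] * by simp
    show "AE \<omega> in M. infinite {t. \<xi> t \<omega> 1 = \<xi> t \<omega> 2 \<and> \<xi> t \<omega> 2 = \<xi> t \<omega> 3}"
      using coincidence_infinitely_often[OF assms(2), of M \<xi>] \<xi> * by simp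
  next
    assume \<beta>: "\<beta> > 1"
    note transient = growth_transient[OF assms(1) \<beta> \<xi>]
    show "transient_chain M N (asymmetric_nbhd N) \<beta> (differences N \<xi>)"
      unfolding transient_chain_def using markov transient by blast
    assume N: "N = 2"
    show "AE \<omega> in M. essentially_clockwise_spiral
        (\<lambda>t. Complex (of_int (differences N \<xi> t \<omega> 1)) (of_int (differences N \<xi> t \<omega> 2)))"
      using growth_spiral[OF \<beta>, of M \<xi>] \<xi> unfolding N by blast
    show "AE \<omega> in M. finite {t. \<xi> t \<omega> 1 = \<xi> t \<omega> 2 \<and> \<xi> t \<omega> 2 = \<xi> t \<omega> 3}"
      using transient unfolding N by eventually_elim (rule coincidence_finitely_often)
  }
qed

end
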